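(* Let $(X,\mathcal{B},\mu,T)$ be an ergodic dynamical system. Then: (1) The Kronecker factor of $T$ is characteristic for the pointwise convergence of the averages $$\frac{1}{N^2}\sum_{n,m=0}^{N-1} f_1(T^nx)f_2(T^mx)f_3(T^{n+m}x);$$ that is, whenever $f_1,f_2,f_3$ are bounded measurable functions and at least one of them belongs to the orthocomplement of the Kronecker factor, these averages converge to $0$ for $\mu$-a.e. $x$ as $N\to\infty$. (2) The $CL$ factor of $T$ is characteristic for the pointwise convergence of the averages $$\frac{1}{N^3}\sum_{m,n,p=0}^{N-1} f_1(T^mx)f_2(T^nx)f_3(T^{m+n}x)f_4(T^px)f_5(T^{m+p}x)f_6(T^{n+p}x)f_7(T^{m+n+p}x);$$ that is, whenever $f_1,\dots,f_7$ are bounded measurable functions and at least one of them belongs to $CL^{\perp}$, these averages converge to $0$ for $\mu$-a.e. $x$ as $N\to\infty$.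
   Context: An ergodic dynamical system $(X,\mathcal{B},\mu,T)$ is a probability space $(X,\mathcal{B},\mu)$ with a measurable $\mu$-preserving ergodic map $T:X\to X$. Functions are complex-valued. The Kronecker factor is the closed linear span in $L^2(\mu)$ of the eigenfunctions of $f\mapsto f\circ T$; orthocomplements are taken in $L^2(\mu)$. For $f\in L^\infty(\mu)$ define the seminorms $|||f|||_2$ and $|||f|||_3$ by $$|||f|||_2^4=\lim_{H\to\infty}\frac1H\sum_{h=0}^{H-1}\Big|\int f\cdot\overline{f\circ T^h}\,d\mu\Big|^2,\qquad |||f|||_3^8=\lim_{H\to\infty}\frac1H\sum_{h=0}^{H-1}|||f\cdot\overline{f\circ T^h}|||_2^4 .$$ The $CL$ (Conze–Lesigne) factor is the factor of $T$ characterized by: a function $f\in L^\infty(\mu)$ lies in $CL^\perp$ (i.e. its conditional expectation on the $CL$ factor is $0$) if and only if $|||f|||_3=0$. A factor is called characteristic for the pointwise convergence of a family of multilinear averages if the averages converge to $0$ a.e. whenever one of the bounded functions is orthogonal to the factor; equivalently, the a.e. asymptotic behaviour is unchanged when each function is replaced by its projection (conditional expectation) onto the factor. *)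

theory Defs
  imports "HOL-Probability.Probability"
begin

locale ergodic_system = prob_space M for M :: "'a measure" +
  fixes T :: "'a \<Rightarrow> 'a"
  assumes measurable_T: "T \<in> measurable M M"
    and preserving_T: "distr M M T = M"
    and ergodic_T: "\<And>A. \<lbrakk>A \<in> sets M; T -` A \<inter> space M = A\<rbrakk> \<Longrightarrow> prob A = 0 \<or> prob A = 1"

text \<open>
  Elements of \<open>L\<^sup>2\<close> and \<open>L\<^sup>\<infinity>\<close> are represented by functions rather than by classes modulo
  almost-everywhere equality. Membership in the sets of functions below, and the seminorms,
  only depend on the class.
\<close>

definition L2 :: "'a measure \<Rightarrow> ('a \<Rightarrow> complex) set" where
  "L2 M = {f \<in> borel_measurable M. integrable M (\<lambda>x. (cmod (f x))\<^sup>2)}"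

definition L2_norm :: "'a measure \<Rightarrow> ('a \<Rightarrow> complex) \<Rightarrow> real" where
  "L2_norm M f = sqrt (\<integral>x. (cmod (f x))\<^sup>2 \<partial>M)"

definition Linf :: "'a measure \<Rightarrow> ('a \<Rightarrow> complex) set" where
  "Linf M = {f \<in> borel_measurable M. \<exists>C. AE x in M. cmod (f x) \<le> C}"

definition orthocomplement :: "'a measure \<Rightarrow> ('a \<Rightarrow> complex) set \<Rightarrow> ('a \<Rightarrow> complex) set" where
  "orthocomplement M S = {f \<in> L2 M. \<forall>g\<in>S. (\<integral>x. f x * cnj (g x) \<partial>M) = 0}"

definition closed_linear_span :: "'a measure \<Rightarrow> ('a \<Rightarrow> complex) set \<Rightarrow> ('a \<Rightarrow> complex) set" where
  "closed_linear_span M E = {f \<in> L2 M. \<forall>\<epsilon>>0. \<exists>(k::nat) (c :: nat \<Rightarrow> complex) e.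
     (\<forall>i<k. e i \<in> E) \<and> L2_norm M (\<lambda>x. f x - (\<Sum>i<k. c i * e i x)) < \<epsilon>}"

definition eigenfunctions :: "'a measure \<Rightarrow> ('a \<Rightarrow> 'a) \<Rightarrow> ('a \<Rightarrow> complex) set" where
  "eigenfunctions M T = {f \<in> L2 M. \<not> (AE x in M. f x = 0) \<and>
     (\<exists>c. AE x in M. f (T x) = c * f x)}"

definition kronecker_factor :: "'a measure \<Rightarrow> ('a \<Rightarrow> 'a) \<Rightarrow> ('a \<Rightarrow> complex) set" where
  "kronecker_factor M T = closed_linear_span M (eigenfunctions M T)"

definition seminorm2 :: "'a measure \<Rightarrow> ('a \<Rightarrow> 'a) \<Rightarrow> ('a \<Rightarrow> complex) \<Rightarrow> real" where
  "seminorm2 M T f = root 4 (lim (\<lambda>H. 1 / real H *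
     (\<Sum>h<H. (cmod (\<integral>x. f x * cnj (f ((T ^^ h) x)) \<partial>M))\<^sup>2)))"

definition seminorm3 :: "'a measure \<Rightarrow> ('a \<Rightarrow> 'a) \<Rightarrow> ('a \<Rightarrow> complex) \<Rightarrow> real" where
  "seminorm3 M T f = root 8 (lim (\<lambda>H. 1 / real H *
     (\<Sum>h<H. (seminorm2 M T (\<lambda>x. f x * cnj (f ((T ^^ h) x)))) ^ 4)))"

text \<open>
  A factor is given by a sub-\<open>\<sigma>\<close>-algebra \<open>F\<close> of \<open>M\<close> with \<open>T\<^sup>-\<^sup>1 F \<subseteq> F\<close>; since \<open>T\<close> need not be
  invertible, equality is not required.
\<close>

definition is_factor :: "'a measure \<Rightarrow> ('a \<Rightarrow> 'a) \<Rightarrow> 'a measure \<Rightarrow> bool" where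
  "is_factor M T F \<longleftrightarrow> subalgebra M F \<and> T \<in> measurable F F"

definition complex_cond_exp ::
    "'a measure \<Rightarrow> 'a measure \<Rightarrow> ('a \<Rightarrow> complex) \<Rightarrow> 'a \<Rightarrow> complex" where
  "complex_cond_exp M F f x =
     Complex (real_cond_exp M F (\<lambda>y. Re (f y)) x) (real_cond_exp M F (\<lambda>y. Im (f y)) x)"

definition factor_perp :: "'a measure \<Rightarrow> 'a measure \<Rightarrow> ('a \<Rightarrow> complex) set" where
  "factor_perp M F = {f \<in> Linf M. AE x in M. complex_cond_exp M F f x = 0}"

text \<open>
  The Conze--Lesigne factor is determined by this property only up to null sets, hence a predicate.
\<close>

definition is_CL_factor :: "'a measure \<Rightarrow> ('a \<Rightarrow> 'a) \<Rightarrow> 'a measure \<Rightarrow> bool" where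
  "is_CL_factor M T F \<longleftrightarrow> is_factor M T F \<and>
     (\<forall>f\<in>Linf M. f \<in> factor_perp M F \<longleftrightarrow> seminorm3 M T f = 0)"

definition bounded_measurable :: "'a measure \<Rightarrow> ('a \<Rightarrow> complex) \<Rightarrow> bool" where
  "bounded_measurable M f \<longleftrightarrow> f \<in> borel_measurable M \<and> bounded (f ` space M)"

definition avg2 :: "('a \<Rightarrow> 'a) \<Rightarrow> (nat \<Rightarrow> 'a \<Rightarrow> complex) \<Rightarrow> 'a \<Rightarrow> nat \<Rightarrow> complex" where
  "avg2 T f x N = 1 / of_nat N ^ 2 * (\<Sum>n<N. \<Sum>m<N.
     f 1 ((T ^^ n) x) * f 2 ((T ^^ m) x) * f 3 ((T ^^ (n + m)) x))"

definition avg3 :: "('a \<Rightarrow> 'a) \<Rightarrow> (nat \<Rightarrow> 'a \<Rightarrow> complex) \<Rightarrow> 'a \<Rightarrow> nat \<Rightarrow> complex" where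
  "avg3 T f x N = 1 / of_nat N ^ 3 * (\<Sum>m<N. \<Sum>n<N. \<Sum>p<N.
     f 1 ((T ^^ m) x) * f 2 ((T ^^ n) x) * f 3 ((T ^^ (m + n)) x) * f 4 ((T ^^ p) x) *
     f 5 ((T ^^ (m + p)) x) * f 6 ((T ^^ (n + p)) x) * f 7 ((T ^^ (m + n + p)) x))"

end

theory Submission
  imports Defs
begin

text \<open>
  Fourier inversion on the \<open>2N\<close>-th roots of unity bounds an average
  \<open>N\<^sup>-\<^sup>2 \<Sum>\<^sub>n\<^sub>,\<^sub>m a\<^sub>n b\<^sub>m c\<^sub>n\<^sub>+\<^sub>m\<close> by the largest exponential sum of any one of the three
  sequences. By van der Corput's inequality and Birkhoff's theorem, the exponential sums of an orbit
  \<open>f (T\<^sup>n x)\<close> are controlled, uniformly in the frequency, by the averages of the squared correlations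
  \<open>\<integral> f \<cdot> cnj (f \<circ> T\<^sup>h)\<close>, that is, by the second seminorm. This seminorm vanishes when \<open>f\<close> is
  orthogonal to the eigenfunctions: the mean ergodic theorem for the rotated Koopman operators holds
  uniformly in the rotation by compactness, and Parseval turns this into decay of the correlations.
  For the three-dimensional averages one fixes \<open>p\<close>, bounds the average over \<open>m\<close> and \<open>n\<close> as before by
  exponential sums of \<open>s k * u (k + p)\<close>, and applies van der Corput's inequality in \<open>k\<close>;
  averaging over \<open>p\<close> gives again averages of the first kind, now for the sequences
  \<open>u n * cnj (u (n + d))\<close>. The limits defining the seminorms exist because the sequences averaged there
  are positive definite.
\<close>


section \<open>Fourier analysis on the roots of unity\<close>

text \<open>The frequency produced by the trilinear bound depends on \<open>N\<close>, on the point
  \<open>x\<close> and, in the cube averages, on \<open>p\<close>, so convergence almost everywhere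
  at each fixed frequency would not help. The right-hand side of van der Corput's inequality is free
  of the frequency; the exceptional null set therefore comes only from applications of Birkhoff's
  theorem, one for each lag, and everything else concerns the sequence read along one orbit. For the
  cube averages a qualitative statement would not do: a single \<open>mderiv f d\<close> may have a
  nonzero second seminorm, and only the mean over \<open>d\<close> is small. Hence exponential sums
  are bounded by a number \<open>\<delta> d\<close> that is carried along until the lags are
  averaged. Existence of the limits in the seminorms matters because \<open>lim\<close> of a
  divergent sequence is an unspecified value, so that \<open>seminorm3 M T f = 0\<close> alone would
  say nothing. The compactness argument for the rotations is of Dini type; monotonicity is replaced
  by \<open>toeplitz_mean_almost_antimono\<close>, whose error depends on the sequence only through
  \<open>r 0\<close>.\<close>

lemma sum_roots_of_unity_orthogonal:
  fixes L i k :: nat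
  assumes "i < L" "k < L"
  defines "w \<equiv> cis (2 * pi / real L)"
  shows "(\<Sum>j<L. (w ^ j) ^ i * cnj ((w ^ j) ^ k)) = (if i = k then of_nat L else 0)"
proof -
  define x where "x = w ^ i * cnj (w ^ k)"
  have x: "x = cis (2 * pi * (real i - real k) / real L)"
    unfolding x_def w_def cis_cnj[symmetric] complex_cnj_power
    by (simp add: Complex.DeMoivre cis_mult cis_cnj diff_divide_distrib right_diff_distrib mult_ac)
  have e: "(w ^ j) ^ i * cnj ((w ^ j) ^ k) = x ^ j" for j
    by (simp add: x_def power_mult_distrib power_mult[symmetric] mult.commute)
  show ?thesis
  proof (cases "i = k")
    case True
    then have "x = 1" by (simp add: x)
    then have "(\<Sum>j<L. x ^ j) = of_nat L" by simp
    then show ?thesis using True unfolding e by simp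
  next
    case False
    have "x \<noteq> 1"
    proof
      assume "x = 1"
      then have "cos (2 * pi * (real i - real k) / real L) = 1"
        by (simp add: x complex_eq_iff)
      then obtain n :: int where n: "2 * pi * (real i - real k) / real L = of_int n * 2 * pi"
        using cos_one_2pi_int by auto
      then have "2 * pi * (real i - real k) = 2 * pi * (of_int n * real L)"
        using assms by (simp add: divide_eq_eq mult_ac)
      then have "(real i - real k) = of_int n * real L" by simp
      then have m: "int i - int k = n * int L"
        by (metis of_int_diff of_int_eq_iff of_int_mult of_int_of_nat_eq)
      \<comment> \<open>A multiple of \<open>L\<close> of absolute value below \<open>L\<close> is
        0.\<close>
      then have "\<bar>n * int L\<bar> < int L" using assms by auto
      then have "\<bar>n\<bar> * int L < 1 * int L" by (simp add: abs_mult)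
      then have "n = 0" using mult_less_cancel_right[of "\<bar>n\<bar>" "int L" 1] by auto
      with m False show False by simp
    qed
    moreover have "x ^ L = 1"
    proof -
      have "x ^ L = cis (2 * pi * (real i - real k))"
        using assms by (simp add: x Complex.DeMoivre)
      also have "\<dots> = cis (2*pi * real i) / cis (2*pi*real k)"
        by (simp only: cis_divide right_diff_distrib)
      also have "\<dots> = 1"
        using cis_multiple_2pi[of "real i"] cis_multiple_2pi[of "real k"] by (simp del: cis_multiple_2pi)
      finally show ?thesis .
    qed
    ultimately have "(\<Sum>j<L. x ^ j) = 0"
      by (simp add: geometric_sum)
    then show ?thesis using False unfolding e by simp
  qed
qed

lemma parseval_roots_of_unity:
  fixes L :: nat and a :: "nat \<Rightarrow> complex"
  defines "w \<equiv> cis (2 * pi / real L)"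
  shows "(\<Sum>j<L. (cmod (\<Sum>n<L. a n * (w ^ j) ^ n))\<^sup>2) = real L * (\<Sum>n<L. (cmod (a n))\<^sup>2)"
proof -
  have "complex_of_real (\<Sum>j<L. (cmod (\<Sum>n<L. a n * (w ^ j) ^ n))\<^sup>2)
      = (\<Sum>j<L. \<Sum>n<L. \<Sum>m<L. a n * cnj (a m) * ((w ^ j) ^ n * cnj ((w ^ j) ^ m)))"
    unfolding of_real_sum complex_norm_square cnj_sum sum_product
    by (intro sum.cong refl) (simp add: mult_ac)
  also have "\<dots> = (\<Sum>n<L. \<Sum>m<L. \<Sum>j<L. a n * cnj (a m) * ((w ^ j) ^ n * cnj ((w ^ j) ^ m)))"
    by (subst sum.swap, rule sum.cong[OF refl], rule sum.swap)
  also have "\<dots> = (\<Sum>n<L. \<Sum>m<L. a n * cnj (a m) * (if n = m then of_nat L else 0))"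
    using sum_roots_of_unity_orthogonal[of _ L]
    by (intro sum.cong refl) (simp only: sum_distrib_left[symmetric] w_def lessThan_iff)
  also have "\<dots> = (\<Sum>n<L. a n * cnj (a n) * of_nat L)"
    by (intro sum.cong refl) (simp add: if_distrib cong: if_cong)
  also have "\<dots> = complex_of_real (real L * (\<Sum>n<L. (cmod (a n))\<^sup>2))"
    unfolding of_real_sum of_real_mult complex_norm_square
    by (simp add: sum_distrib_left mult_ac)
  finally show ?thesis using of_real_eq_iff by blast
qed

lemma sum_mult_le_sqrt:
  fixes f g :: "'b \<Rightarrow> real"
  shows "(\<Sum>i\<in>A. f i * g i) \<le> sqrt (\<Sum>i\<in>A. (f i)\<^sup>2) * sqrt (\<Sum>i\<in>A. (g i)\<^sup>2)"
proof -
  have "(\<Sum>i\<in>A. f i * g i) \<le> (\<Sum>i\<in>A. \<bar>f i\<bar> * \<bar>g i\<bar>)"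
    by (intro sum_mono) (metis abs_ge_self abs_mult)
  also have "\<dots> \<le> L2_set f A * L2_set g A" by (rule L2_set_mult_ineq)
  finally show ?thesis by (simp add: L2_set_def)
qed

text \<open>Hoelder's inequality with exponents infinity, 2 and 2; the index \<open>j\<close>
  becomes the frequency in the trilinear bounds. The disjunct \<open>x j < 0\<close> settles
  negative \<open>x\<close>; in the uses \<open>x\<close> is a modulus, so it cannot occur
  there.\<close>

lemma sum_prod3_le_max:
  fixes x y z :: "nat \<Rightarrow> real"
  assumes "L > 0" "\<And>j. j < L \<Longrightarrow> y j \<ge> 0" "\<And>j. j < L \<Longrightarrow> z j \<ge> 0"
  shows "\<exists>j<L. (\<Sum>i<L. x i * y i * z i) \<le> x j * (sqrt (\<Sum>i<L. (y i)\<^sup>2) * sqrt (\<Sum>i<L. (z i)\<^sup>2))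
    \<or> x j < 0"
proof (cases "\<exists>j<L. x j < 0")
  case False
  obtain j where j: "j < L" "\<And>i. i < L \<Longrightarrow> x i \<le> x j"
  proof -
    have "Max (x ` {..<L}) \<in> x ` {..<L}" by (rule Max_in) (use assms in auto)
    then obtain j where "j < L" "x j = Max (x ` {..<L})" by auto
    then show thesis by (intro that[of j]) auto
  qed
  have "(\<Sum>i<L. x i * y i * z i) \<le> (\<Sum>i<L. x j * (y i * z i))"
    using assms j by (intro sum_mono) (simp add: mult.assoc mult_right_mono)
  also have "\<dots> = x j * (\<Sum>i<L. y i * z i)" by (simp add: sum_distrib_left)
  also have "\<dots> \<le> x j * (sqrt (\<Sum>i<L. (y i)\<^sup>2) * sqrt (\<Sum>i<L. (z i)\<^sup>2))"
    using False j by (intro mult_left_mono sum_mult_le_sqrt) auto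
  finally show ?thesis using j by auto
qed auto

text \<open>Since \<open>n + m \<le> 2 * N - 2\<close>, the \<open>2 * N\<close>-th roots of unity
  pick out exactly \<open>k = n + m\<close>; with \<open>N\<close>-th roots the indices would wrap
  around. The sequence \<open>c\<close> enters conjugated so that its exponential sum, too, has
  positive powers of the frequency.\<close>

lemma sumset_fourier:
  fixes a b c :: "nat \<Rightarrow> complex" and N :: nat
  defines "w \<equiv> cis (2 * pi / real (2 * N))"
  shows "real (2 * N) * cmod (\<Sum>n<N. \<Sum>m<N. a n * b m * c (n + m)) \<le>
    (\<Sum>j<2*N. cmod (\<Sum>n<N. a n * (w ^ j) ^ n) * cmod (\<Sum>n<N. b n * (w ^ j) ^ n) *
       cmod (\<Sum>n<2*N. cnj (c n) * (w ^ j) ^ n))"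
proof -
  have "(\<Sum>j<2*N. (\<Sum>n<N. a n * (w ^ j) ^ n) * (\<Sum>m<N. b m * (w ^ j) ^ m) *
       cnj (\<Sum>k<2*N. cnj (c k) * (w ^ j) ^ k))
     = (\<Sum>j<2*N. \<Sum>n<N. \<Sum>m<N. \<Sum>k<2*N. a n * b m * c k * ((w ^ j) ^ (n + m) * cnj ((w ^ j) ^ k)))"
    unfolding cnj_sum mult.assoc[of "sum _ _" "sum _ _" "sum _ _"] sum_product[of _ "{..<N}" _ "{..<2*N}"]
    unfolding sum_distrib_right unfolding sum_distrib_left
    by (intro sum.cong refl) (simp add: power_add mult_ac)
  also have "\<dots> = (\<Sum>n<N. \<Sum>m<N. \<Sum>k<2*N. \<Sum>j<2*N. a n * b m * c k * ((w ^ j) ^ (n + m) * cnj ((w ^ j) ^ k)))"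
    apply (subst sum.swap, rule sum.cong[OF refl])
    apply (subst sum.swap, rule sum.cong[OF refl])
    by (rule sum.swap)
  also have "\<dots> = (\<Sum>n<N. \<Sum>m<N. \<Sum>k<2*N. a n * b m * c k * (if n + m = k then of_nat (2*N) else 0))"
    using sum_roots_of_unity_orthogonal[of _ "2*N"]
    by (intro sum.cong refl) (simp only: sum_distrib_left[symmetric] w_def lessThan_iff)
  also have "\<dots> = (\<Sum>n<N. \<Sum>m<N. a n * b m * c (n + m) * of_nat (2*N))"
    by (intro sum.cong refl) (auto simp: if_distrib cong: if_cong)
  also have "\<dots> = of_nat (2*N) * (\<Sum>n<N. \<Sum>m<N. a n * b m * c (n + m))"
    by (simp add: sum_distrib_left sum_distrib_right mult_ac)
  finally have "of_nat (2*N) * (\<Sum>n<N. \<Sum>m<N. a n * b m * c (n + m)) =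
     (\<Sum>j<2*N. (\<Sum>n<N. a n * (w ^ j) ^ n) * (\<Sum>m<N. b m * (w ^ j) ^ m) *
       cnj (\<Sum>k<2*N. cnj (c k) * (w ^ j) ^ k))" ..
  then have "cmod (of_nat (2*N) * (\<Sum>n<N. \<Sum>m<N. a n * b m * c (n + m))) = cmod \<dots>"
    by (rule arg_cong)
  also have "\<dots> \<le> (\<Sum>j<2*N. cmod ((\<Sum>n<N. a n * (w ^ j) ^ n) * (\<Sum>m<N. b m * (w ^ j) ^ m) *
       cnj (\<Sum>k<2*N. cnj (c k) * (w ^ j) ^ k)))" by (rule norm_sum)
  finally show ?thesis by (simp only: norm_mult complex_mod_cnj norm_of_nat)
qed

text \<open>The frequencies are \<open>L\<close>-th roots of unity although only \<open>K\<close>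
  terms are present; padding by zeros up to \<open>L\<close> reduces this to the plain Parseval
  identity.\<close>

lemma parseval_le:
  fixes a :: "nat \<Rightarrow> complex"
  assumes "K \<le> L" "B \<ge> 0" "\<And>n. n < K \<Longrightarrow> cmod (a n) \<le> B"
  defines "w \<equiv> cis (2 * pi / real L)"
  shows "sqrt (\<Sum>j<L. (cmod (\<Sum>n<K. a n * (w ^ j) ^ n))\<^sup>2) \<le> sqrt (real L) * (sqrt (real K) * B)"
proof -
  define a' where "a' n = (if n < K then a n else 0)" for n
  have s: "(\<Sum>n<L. a' n * x ^ n) = (\<Sum>n<K. a n * x ^ n)" for x
    using assms(1) by (intro sum.mono_neutral_cong_right) (auto simp: a'_def)
  have s2: "(\<Sum>n<L. (cmod (a' n))\<^sup>2) = (\<Sum>n<K. (cmod (a n))\<^sup>2)"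
    using assms(1) by (intro sum.mono_neutral_cong_right) (auto simp: a'_def)
  have "(\<Sum>j<L. (cmod (\<Sum>n<K. a n * (w ^ j) ^ n))\<^sup>2) = real L * (\<Sum>n<K. (cmod (a n))\<^sup>2)"
    using parseval_roots_of_unity[of a' L] unfolding w_def s s2 .
  also have "\<dots> \<le> real L * (\<Sum>n<K. B\<^sup>2)"
    using assms by (intro mult_left_mono sum_mono power_mono) auto
  finally have "sqrt (\<Sum>j<L. (cmod (\<Sum>n<K. a n * (w ^ j) ^ n))\<^sup>2) \<le> sqrt (real L * (real K * B\<^sup>2))"
    by simp
  then show ?thesis using assms by (simp add: real_sqrt_mult)
qed

text \<open>The exponential sum of \<open>a\<close> is taken out in the supremum over the
  frequencies, while \<open>b\<close> and \<open>c\<close> are merely bounded and enter through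
  Parseval. The frequency \<open>z\<close> depends on \<open>N\<close> and on all three
  sequences.\<close>

lemma trilinear_bound_left:
  fixes a b c :: "nat \<Rightarrow> complex"
  assumes B: "B \<ge> 0" "\<And>n. n < N \<Longrightarrow> cmod (b n) \<le> B" "\<And>n. n < 2 * N \<Longrightarrow> cmod (c n) \<le> B"
  shows "\<exists>z. cmod z = 1 \<and>
    cmod (\<Sum>n<N. \<Sum>m<N. a n * b m * c (n + m)) \<le> 2 * B\<^sup>2 * real N * cmod (\<Sum>n<N. a n * z ^ n)"
proof (cases "N = 0")
  case False
  define w where "w = cis (2 * pi / real (2 * N))"
  have "(s * (s * B)) * (s * (s * B)) = (s * s) * (s * s) * B\<^sup>2" for s :: real
    by (simp add: power2_eq_square algebra_simps)
  from this[of "sqrt (real (2*N))"]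
  have s4: "(sqrt (real (2*N)) * (sqrt (real (2*N)) * B)) * (sqrt (real (2*N)) * (sqrt (real (2*N)) * B))
    = real (2*N) * real (2*N) * B\<^sup>2" by (simp only: real_sqrt_mult_self abs_of_nat)
  obtain j where j: "(\<Sum>j<2*N. cmod (\<Sum>n<N. a n * (w ^ j) ^ n) * cmod (\<Sum>n<N. b n * (w ^ j) ^ n) *
       cmod (\<Sum>n<2*N. cnj (c n) * (w ^ j) ^ n)) \<le> cmod (\<Sum>n<N. a n * (w ^ j) ^ n) *
      (sqrt (\<Sum>j<2*N. (cmod (\<Sum>n<N. b n * (w ^ j) ^ n))\<^sup>2) *
       sqrt (\<Sum>j<2*N. (cmod (\<Sum>n<2*N. cnj (c n) * (w ^ j) ^ n))\<^sup>2))"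
    using sum_prod3_le_max[of "2*N" "\<lambda>j. cmod (\<Sum>n<N. b n * (w ^ j) ^ n)"
       "\<lambda>j. cmod (\<Sum>n<2*N. cnj (c n) * (w ^ j) ^ n)" "\<lambda>j. cmod (\<Sum>n<N. a n * (w ^ j) ^ n)"] False
    by (force simp del: mult_2)
  have "real (2 * N) * cmod (\<Sum>n<N. \<Sum>m<N. a n * b m * c (n + m)) \<le> cmod (\<Sum>n<N. a n * (w ^ j) ^ n) *
      (sqrt (\<Sum>j<2*N. (cmod (\<Sum>n<N. b n * (w ^ j) ^ n))\<^sup>2) *
       sqrt (\<Sum>j<2*N. (cmod (\<Sum>n<2*N. cnj (c n) * (w ^ j) ^ n))\<^sup>2))"
    using sumset_fourier[of N a b c] j unfolding w_def by linarith
  also have "\<dots> \<le> cmod (\<Sum>n<N. a n * (w ^ j) ^ n) *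
      ((sqrt (real (2*N)) * (sqrt (real N) * B)) * (sqrt (real (2*N)) * (sqrt (real (2*N)) * B)))"
    unfolding w_def using B
    by (intro mult_left_mono mult_mono parseval_le mult_nonneg_nonneg) (auto intro: sum_nonneg)
  \<comment> \<open>Rounding \<open>sqrt N\<close> up to \<open>sqrt (2 * N)\<close> replaces the
    constant \<open>sqrt 2\<close> by 2.\<close>
  also have "\<dots> \<le> cmod (\<Sum>n<N. a n * (w ^ j) ^ n) *
      ((sqrt (real (2*N)) * (sqrt (real (2*N)) * B)) * (sqrt (real (2*N)) * (sqrt (real (2*N)) * B)))"
    using B by (intro mult_left_mono mult_mono mult_nonneg_nonneg) auto
  also have "\<dots> = real (2*N) * (2 * B\<^sup>2 * real N * cmod (\<Sum>n<N. a n * (w ^ j) ^ n))"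
    unfolding s4 by simp
  finally have "cmod (\<Sum>n<N. \<Sum>m<N. a n * b m * c (n + m)) \<le> 2 * B\<^sup>2 * real N * cmod (\<Sum>n<N. a n * (w ^ j) ^ n)"
    using False by (simp add: mult_ac)
  then show ?thesis by (intro exI[of _ "w ^ j"]) (auto simp: w_def norm_power)
qed (auto intro: exI[of _ 1])

lemma trilinear_bound_middle:
  fixes a b c :: "nat \<Rightarrow> complex"
  assumes B: "B \<ge> 0" "\<And>n. n < N \<Longrightarrow> cmod (a n) \<le> B" "\<And>n. n < 2 * N \<Longrightarrow> cmod (c n) \<le> B"
  shows "\<exists>z. cmod z = 1 \<and>
    cmod (\<Sum>n<N. \<Sum>m<N. a n * b m * c (n + m)) \<le> 2 * B\<^sup>2 * real N * cmod (\<Sum>n<N. b n * z ^ n)"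
proof -
  have "(\<Sum>n<N. \<Sum>m<N. a n * b m * c (n + m)) = (\<Sum>n<N. \<Sum>m<N. b n * a m * c (n + m))"
    by (subst sum.swap) (simp add: mult.commute[of "a _" "b _"] add.commute)
  then show ?thesis using trilinear_bound_left[of B N a c b] B by simp
qed

lemma trilinear_bound_right:
  fixes a b c :: "nat \<Rightarrow> complex"
  assumes B: "B \<ge> 0" "\<And>n. n < N \<Longrightarrow> cmod (a n) \<le> B" "\<And>n. n < N \<Longrightarrow> cmod (b n) \<le> B"
  shows "\<exists>z. cmod z = 1 \<and>
    cmod (\<Sum>n<N. \<Sum>m<N. a n * b m * c (n + m)) \<le> 2 * B\<^sup>2 * real N * cmod (\<Sum>n<2*N. c n * z ^ n)"
proof (cases "N = 0")
  case False
  define w where "w = cis (2 * pi / real (2 * N))"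
  have "(s * (s * B)) * (s * (s * B)) = (s * s) * (s * s) * B\<^sup>2" for s :: real
    by (simp add: power2_eq_square algebra_simps)
  from this[of "sqrt (real (2*N))"]
  have s4: "(sqrt (real (2*N)) * (sqrt (real (2*N)) * B)) * (sqrt (real (2*N)) * (sqrt (real (2*N)) * B))
    = real (2*N) * real (2*N) * B\<^sup>2" by (simp only: real_sqrt_mult_self abs_of_nat)
  obtain j where j: "(\<Sum>j<2*N. cmod (\<Sum>n<2*N. cnj (c n) * (w ^ j) ^ n) *
       cmod (\<Sum>n<N. a n * (w ^ j) ^ n) * cmod (\<Sum>n<N. b n * (w ^ j) ^ n))
     \<le> cmod (\<Sum>n<2*N. cnj (c n) * (w ^ j) ^ n) *
      (sqrt (\<Sum>j<2*N. (cmod (\<Sum>n<N. a n * (w ^ j) ^ n))\<^sup>2) *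
       sqrt (\<Sum>j<2*N. (cmod (\<Sum>n<N. b n * (w ^ j) ^ n))\<^sup>2))"
    using sum_prod3_le_max[of "2*N" "\<lambda>j. cmod (\<Sum>n<N. a n * (w ^ j) ^ n)" "\<lambda>j. cmod (\<Sum>n<N. b n * (w ^ j) ^ n)"
       "\<lambda>j. cmod (\<Sum>n<2*N. cnj (c n) * (w ^ j) ^ n)"] False
    by (force simp del: mult_2)
  have "real (2 * N) * cmod (\<Sum>n<N. \<Sum>m<N. a n * b m * c (n + m)) \<le> cmod (\<Sum>n<2*N. cnj (c n) * (w ^ j) ^ n) *
      (sqrt (\<Sum>j<2*N. (cmod (\<Sum>n<N. a n * (w ^ j) ^ n))\<^sup>2) *
       sqrt (\<Sum>j<2*N. (cmod (\<Sum>n<N. b n * (w ^ j) ^ n))\<^sup>2))"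
    using sumset_fourier[of N a b c] j unfolding w_def by (simp only: mult.commute mult.left_commute mult.assoc)
  also have "\<dots> \<le> cmod (\<Sum>n<2*N. cnj (c n) * (w ^ j) ^ n) *
      ((sqrt (real (2*N)) * (sqrt (real N) * B)) * (sqrt (real (2*N)) * (sqrt (real N) * B)))"
    unfolding w_def using B
    by (intro mult_left_mono mult_mono parseval_le mult_nonneg_nonneg) (auto intro: sum_nonneg)
  also have "\<dots> \<le> cmod (\<Sum>n<2*N. cnj (c n) * (w ^ j) ^ n) *
      ((sqrt (real (2*N)) * (sqrt (real (2*N)) * B)) * (sqrt (real (2*N)) * (sqrt (real (2*N)) * B)))"
    using B by (intro mult_left_mono mult_mono mult_nonneg_nonneg) auto
  also have "\<dots> = real (2*N) * (2 * B\<^sup>2 * real N * cmod (\<Sum>n<2*N. cnj (c n) * (w ^ j) ^ n))"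
    unfolding s4 by simp
  finally have "cmod (\<Sum>n<N. \<Sum>m<N. a n * b m * c (n + m)) \<le> 2 * B\<^sup>2 * real N * cmod (\<Sum>n<2*N. cnj (c n) * (w ^ j) ^ n)"
    using False by (simp add: mult_ac)
  \<comment> \<open>Conjugating the sum removes the conjugates from \<open>c\<close> and replaces
    the frequency by its inverse \<open>cnj (w ^ j)\<close>.\<close>
  also have "cmod (\<Sum>n<2*N. cnj (c n) * (w ^ j) ^ n) = cmod (cnj (\<Sum>n<2*N. cnj (c n) * (w ^ j) ^ n))"
    by (simp only: complex_mod_cnj)
  also have "\<dots> = cmod (\<Sum>n<2*N. c n * cnj (w ^ j) ^ n)"
    by (simp only: cnj_sum complex_cnj_mult complex_cnj_power complex_cnj_cnj)
  finally show ?thesis by (intro exI[of _ "cnj (w ^ j)"]) (auto simp: w_def norm_power)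
qed (auto intro: exI[of _ 1])

section \<open>The van der Corput inequality\<close>

text \<open>Each distance \<open>d\<close> from \<open>h\<close> is attained by at most two indices,
  \<open>h - d\<close> and \<open>h + d\<close>.\<close>

lemma sum_abs_diff_le:
  fixes R :: "nat \<Rightarrow> real"
  assumes "h < H" and R: "\<And>d. R d \<ge> 0"
  shows "(\<Sum>i<H. R ((h - i) + (i - h))) \<le> 2 * (\<Sum>d<H. R d)"
proof -
  have "(\<Sum>i<H. R ((h - i) + (i - h))) = (\<Sum>i<h. R (h - i)) + (\<Sum>i\<in>{h..<H}. R (i - h))"
  proof -
    have "(\<Sum>i<H. R ((h - i) + (i - h))) =
      (\<Sum>i<h. R ((h - i) + (i - h))) + (\<Sum>i\<in>{h..<H}. R ((h - i) + (i - h)))"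
      using assms sum.atLeastLessThan_concat[of 0 h H "\<lambda>i. R ((h - i) + (i - h))"]
      by (simp only: atLeast0LessThan)
    then show ?thesis by simp
  qed
  also have "(\<Sum>i<h. R (h - i)) = sum R ((\<lambda>i. h - i) ` {..<h})"
    by (subst sum.reindex) (auto intro!: inj_onI)
  also have "(\<Sum>i\<in>{h..<H}. R (i - h)) = sum R ((\<lambda>i. i - h) ` {h..<H})"
    by (subst sum.reindex) (auto intro!: inj_onI)
  also have "sum R ((\<lambda>i. h - i) ` {..<h}) \<le> (\<Sum>d<H. R d)"
    using assms by (intro sum_mono2) auto
  also have "sum R ((\<lambda>i. i - h) ` {h..<H}) \<le> (\<Sum>d<H. R d)"
    using assms by (intro sum_mono2) auto
  finally show ?thesis by simp
qed

text \<open>The sum is written \<open>H\<close> times with shifted windows, the order of summation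
  is exchanged, and Cauchy-Schwarz is applied over the \<open>N + H\<close> positions. A shift
  changes the twist only by a power of \<open>z\<close>, of modulus 1, so \<open>z\<close>
  disappears from the moduli of the correlations.\<close>

lemma van_der_corput:
  fixes u :: "nat \<Rightarrow> complex" and N H :: nat
  assumes "H > 0" and z: "cmod z = 1"
  shows "(cmod (\<Sum>n<N. u n * z ^ n))\<^sup>2 \<le>
     2 * real (N + H) / real H * (\<Sum>d<H. cmod (\<Sum>n<N - d. u n * cnj (u (n + d))))"
proof -
  define v where "v n = (if n < N then u n * z ^ n else 0)" for n
  \<comment> \<open>\<open>x h\<close> is the sequence \<open>v\<close>, which is cut off at
    \<open>N\<close>, shifted by \<open>h\<close>; for \<open>h < H\<close> it is supported in
    \<open>{..<N + H}\<close>.\<close>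
  define x where "x h k = (if h \<le> k then v (k - h) else 0)" for h k
  define \<rho> where "\<rho> d = cmod (\<Sum>n<N - d. u n * cnj (u (n + d)))" for d
  have zz: "z * cnj z = 1" using z complex_norm_square[of z] by simp
  have sumx: "(\<Sum>k<N+H. x h k) = (\<Sum>n<N. u n * z ^ n)" if "h < H" for h
  proof -
    have "(\<Sum>k<N+H. x h k) = (\<Sum>k\<in>{0+h..<(N+H-h)+h}. x h k)"
      using that by (intro sum.mono_neutral_right) (auto simp: x_def)
    also have "\<dots> = (\<Sum>n<N+H-h. v n)"
      unfolding sum.shift_bounds_nat_ivl by (simp add: x_def atLeast0LessThan)
    also have "\<dots> = (\<Sum>n<N. u n * z ^ n)"
      using that by (intro sum.mono_neutral_cong_right) (auto simp: v_def)
    finally show ?thesis .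
  qed
  have corr0: "cmod (\<Sum>k<N+H. x h k * cnj (x i k)) = \<rho> ((h - i) + (i - h))" if "h < H" "i < H" "h \<le> i" for h i
  proof -
    have "(\<Sum>k<N+H. x h k * cnj (x i k)) = (\<Sum>k\<in>{0+i..<(N+H-i)+i}. x h k * cnj (x i k))"
      using that by (intro sum.mono_neutral_right) (auto simp: x_def)
    also have "\<dots> = (\<Sum>n<N+H-i. v (n + (i - h)) * cnj (v n))"
      unfolding sum.shift_bounds_nat_ivl using that by (simp add: x_def atLeast0LessThan)
    also have "\<dots> = (\<Sum>n<N-(i-h). v (n + (i - h)) * cnj (v n))"
      using that by (intro sum.mono_neutral_right) (auto simp: v_def)
    also have "\<dots> = (\<Sum>n<N-(i-h). z ^ (i - h) * cnj (u n * cnj (u (n + (i - h)))))"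
    proof (intro sum.cong refl)
      fix n assume "n \<in> {..<N-(i-h)}"
      then have "v (n + (i - h)) * cnj (v n) = u (n + (i-h)) * cnj (u n) * z ^ (i - h) * (z ^ n * cnj z ^ n)"
        by (simp add: v_def power_add)
      also have "z ^ n * cnj z ^ n = 1" by (metis zz power_mult_distrib power_one)
      finally show "v (n + (i - h)) * cnj (v n) = z ^ (i - h) * cnj (u n * cnj (u (n + (i - h))))"
        by simp
    qed
    also have "\<dots> = z ^ (i - h) * cnj (\<Sum>n<N-(i-h). u n * cnj (u (n + (i - h))))"
      by (simp only: sum_distrib_left cnj_sum)
    finally have "cmod (\<Sum>k<N+H. x h k * cnj (x i k)) =
       cmod (z ^ (i - h)) * cmod (\<Sum>n<N-(i-h). u n * cnj (u (n + (i - h))))"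
      by (simp only: norm_mult complex_mod_cnj)
    then show ?thesis using that by (simp add: \<rho>_def norm_power z)
  qed
  have corr: "cmod (\<Sum>k<N+H. x h k * cnj (x i k)) = \<rho> ((h - i) + (i - h))" if "h < H" "i < H" for h i
  proof (cases "h \<le> i")
    case False
    have "(\<Sum>k<N+H. x h k * cnj (x i k)) = cnj (\<Sum>k<N+H. x i k * cnj (x h k))"
      by (simp add: mult.commute)
    then have "cmod (\<Sum>k<N+H. x h k * cnj (x i k)) = cmod (\<Sum>k<N+H. x i k * cnj (x h k))"
      by (simp only: complex_mod_cnj)
    then show ?thesis using corr0[of i h] that False by (simp only: add.commute)
  next
    case True
    then show ?thesis using corr0[OF that] by simp
  qed
  define S where "S = (\<Sum>n<N. u n * z ^ n)"
  have "of_nat H * S = (\<Sum>h<H. \<Sum>k<N+H. x h k)"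
    using sumx by (simp add: S_def)
  also have "\<dots> = (\<Sum>k<N+H. \<Sum>h<H. x h k)" by (rule sum.swap)
  finally have "cmod (of_nat H * S) \<le> (\<Sum>k<N+H. cmod (\<Sum>h<H. x h k))"
    by (simp only:) (rule norm_sum)
  then have "(real H * cmod S)\<^sup>2 \<le> (\<Sum>k<N+H. 1 * cmod (\<Sum>h<H. x h k))\<^sup>2"
    by (intro power_mono) (auto simp: norm_mult)
  also have "\<dots> \<le> (\<Sum>k<N+H. 1\<^sup>2) * (\<Sum>k<N+H. (cmod (\<Sum>h<H. x h k))\<^sup>2)"
    by (rule Cauchy_Schwarz_ineq_sum)
  finally have CS: "(real H * cmod S)\<^sup>2 \<le> (\<Sum>k<N+H. 1\<^sup>2) * (\<Sum>k<N+H. (cmod (\<Sum>h<H. x h k))\<^sup>2)" .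
  have "(\<Sum>k<N+H. (cmod (\<Sum>h<H. x h k))\<^sup>2) \<le> 2 * real H * (\<Sum>d<H. \<rho> d)"
  proof -
    have "complex_of_real (\<Sum>k<N+H. (cmod (\<Sum>h<H. x h k))\<^sup>2) =
        (\<Sum>k<N+H. \<Sum>h<H. \<Sum>i<H. x h k * cnj (x i k))"
      unfolding of_real_sum complex_norm_square cnj_sum sum_product ..
    also have "\<dots> = (\<Sum>h<H. \<Sum>i<H. \<Sum>k<N+H. x h k * cnj (x i k))"
      by (subst sum.swap, rule sum.cong[OF refl], rule sum.swap)
    finally have "cmod (complex_of_real (\<Sum>k<N+H. (cmod (\<Sum>h<H. x h k))\<^sup>2)) \<le>
       (\<Sum>h<H. \<Sum>i<H. cmod (\<Sum>k<N+H. x h k * cnj (x i k)))"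
      by (simp only:) (intro order.trans[OF norm_sum] sum_mono norm_sum)
    also have "\<dots> = (\<Sum>h<H. \<Sum>i<H. \<rho> ((h - i) + (i - h)))"
      using corr by simp
    also have "\<dots> \<le> (\<Sum>h<H. 2 * (\<Sum>d<H. \<rho> d))"
      by (intro sum_mono sum_abs_diff_le) (auto simp: \<rho>_def)
    finally have "\<bar>\<Sum>k<N+H. (cmod (\<Sum>h<H. x h k))\<^sup>2\<bar> \<le> (\<Sum>h<H. 2 * (\<Sum>d<H. \<rho> d))"
      by (simp only: norm_of_real)
    then show ?thesis by (simp add: sum_nonneg)
  qed
  then have "real (N + H) * (\<Sum>k<N+H. (cmod (\<Sum>h<H. x h k))\<^sup>2) \<le> real (N + H) * (2 * real H * (\<Sum>d<H. \<rho> d))"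
    by (intro mult_left_mono) auto
  with CS have "(real H)\<^sup>2 * (cmod S)\<^sup>2 \<le> real (N + H) * (2 * real H * (\<Sum>d<H. \<rho> d))"
    by (simp add: power_mult_distrib)
  moreover have eq: "(real H)\<^sup>2 * (2 * real (N + H) / real H * (\<Sum>d<H. \<rho> d)) = real (N + H) * (2 * real H * (\<Sum>d<H. \<rho> d))"
    using assms by (simp add: power2_eq_square)
  ultimately have "(real H)\<^sup>2 * (cmod S)\<^sup>2 \<le> (real H)\<^sup>2 * (2 * real (N + H) / real H * (\<Sum>d<H. \<rho> d))"
    by (simp only: eq)
  then have "(cmod S)\<^sup>2 \<le> 2 * real (N + H) / real H * (\<Sum>d<H. \<rho> d)"
    using assms by (subst (asm) mult_le_cancel_left_pos) auto
  then show ?thesis by (simp add: S_def \<rho>_def)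
qed

section \<open>Positive definite sequences\<close>

text \<open>On \<open>nat\<close> one of the two truncated differences is 0, so
  \<open>(i - j) + (j - i)\<close> is the distance of \<open>i\<close> and \<open>j\<close>: the
  symmetric Toeplitz matrices of \<open>r\<close> are positive semidefinite. Indexing by distances
  avoids negative lags, which a noninvertible map does not provide.\<close>

definition positive_definite :: "(nat \<Rightarrow> real) \<Rightarrow> bool" where
  "positive_definite r \<longleftrightarrow>
     (\<forall>c n. 0 \<le> (\<Sum>i<n. \<Sum>j<n. c i * c j * r ((i - j) + (j - i))))"

text \<open>Divided by the square of \<open>N\<close>, this will be the squared norm of the
  \<open>N\<close>-th mean of an isometry; it is also a Fejer-weighted sum of
  \<open>r\<close>.\<close>

definition toeplitz_sum :: "(nat \<Rightarrow> real) \<Rightarrow> nat \<Rightarrow> real" where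
  "toeplitz_sum r N = (\<Sum>i<N. \<Sum>j<N. r ((i - j) + (j - i)))"

context
  fixes r :: "nat \<Rightarrow> real"
  assumes pd: "positive_definite r"
begin

private abbreviation K :: "nat \<Rightarrow> nat \<Rightarrow> real" where
  "K i j \<equiv> r ((i - j) + (j - i))"

private abbreviation P :: "nat set \<Rightarrow> nat set \<Rightarrow> real" where
  "P A B \<equiv> (\<Sum>i\<in>A. \<Sum>j\<in>B. K i j)"

text \<open>The quadratic form is evaluated at the difference of the indicators of \<open>A\<close>
  and \<open>B\<close>: twice an inner product is at most the sum of the two squared norms.\<close>

lemma pd_cross_le:
  assumes "finite A" "finite B"
  shows "2 * (\<Sum>i\<in>A. \<Sum>j\<in>B. r ((i - j) + (j - i))) \<le>
    (\<Sum>i\<in>A. \<Sum>j\<in>A. r ((i - j) + (j - i))) + (\<Sum>i\<in>B. \<Sum>j\<in>B. r ((i - j) + (j - i)))"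
proof -
  obtain n where n: "A \<subseteq> {..<n}" "B \<subseteq> {..<n}"
    using assms finite_nat_iff_bounded[of "A \<union> B"] by auto
  define ind :: "nat set \<Rightarrow> nat \<Rightarrow> real" where "ind X i = (if i \<in> X then 1 else 0)" for X i
  have e: "(\<Sum>i<n. \<Sum>j<n. ind X i * ind Y j * K i j) = P X Y" if "X \<subseteq> {..<n}" "Y \<subseteq> {..<n}" for X Y
  proof -
    have "(\<Sum>i<n. \<Sum>j<n. ind X i * ind Y j * K i j) = (\<Sum>i\<in>X. \<Sum>j<n. ind X i * ind Y j * K i j)"
      using that by (intro sum.mono_neutral_right) (auto simp: ind_def)
    also have "\<dots> = (\<Sum>i\<in>X. \<Sum>j\<in>Y. ind X i * ind Y j * K i j)"
      using that by (intro sum.cong refl sum.mono_neutral_right) (auto simp: ind_def)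
    also have "\<dots> = P X Y" by (intro sum.cong refl) (auto simp: ind_def)
    finally show ?thesis .
  qed
  have "0 \<le> (\<Sum>i<n. \<Sum>j<n. (ind A i - ind B i) * (ind A j - ind B j) * K i j)"
    by (rule pd[unfolded positive_definite_def, rule_format])
  also have "\<dots> = (\<Sum>i<n. \<Sum>j<n. ind A i * ind A j * K i j) + (\<Sum>i<n. \<Sum>j<n. ind B i * ind B j * K i j)
     - (\<Sum>i<n. \<Sum>j<n. ind A i * ind B j * K i j) - (\<Sum>i<n. \<Sum>j<n. ind B i * ind A j * K i j)"
    by (simp add: algebra_simps sum.distrib sum_subtractf)
  also have "\<dots> = P A A + P B B - P A B - P B A" using n by (simp only: e)
  also have "P B A = P A B" by (subst sum.swap) (simp add: add.commute)
  finally show ?thesis by simp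
qed

lemma pd_zero_nonneg: "0 \<le> r 0"
  using pd_cross_le[of "{}" "{0}"] by simp

lemma pd_abs_le: "\<bar>r h\<bar> \<le> r 0"
proof -
  have "r h \<le> r 0" using pd_cross_le[of "{0}" "{h}"] by simp
  moreover have "- r h \<le> r 0"
  proof (cases "h = 0")
    case False
    \<comment> \<open>The vector with entries 1 at \<open>0\<close> and \<open>h\<close> gives the
      lower bound, its form being \<open>2 * (r 0 + r h)\<close>.\<close>
    let ?c = "\<lambda>i. if i = 0 \<or> i = h then 1 else (0::real)"
    have "0 \<le> (\<Sum>i<Suc h. \<Sum>j<Suc h. ?c i * ?c j * K i j)"
      by (rule pd[unfolded positive_definite_def, rule_format])
    also have "\<dots> = (\<Sum>i\<in>{0,h}. \<Sum>j<Suc h. ?c i * ?c j * K i j)"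
      by (intro sum.mono_neutral_right) auto
    also have "\<dots> = (\<Sum>i\<in>{0,h}. \<Sum>j\<in>{0,h}. ?c i * ?c j * K i j)"
      by (intro sum.cong refl sum.mono_neutral_right) auto
    also have "\<dots> = 2 * (r 0 + r h)" using False by simp
    finally show ?thesis by simp
  qed (use pd_zero_nonneg in auto)
  ultimately show ?thesis by linarith
qed

lemma toeplitz_sum_nonneg: "0 \<le> toeplitz_sum r N"
  using pd_cross_le[of "{}" "{..<N}"] by (simp add: toeplitz_sum_def)

text \<open>The triangle inequality for \<open>k\<close> consecutive blocks of length
  \<open>N\<close>: by shift invariance all diagonal blocks have the same sum, and
  \<open>pd_cross_le\<close> bounds the mixed blocks by it.\<close>

lemma toeplitz_sum_block: "toeplitz_sum r (k * N) \<le> (real k)\<^sup>2 * toeplitz_sum r N"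
proof -
  let ?A = "\<lambda>i. {i * N..<i * N + N}"
  have d: "P (?A i) (?A i) = toeplitz_sum r N" for i
  proof -
    have sh: "sum g {i * N..<i * N + N} = (\<Sum>j<N. g (j + i * N))" for g :: "nat \<Rightarrow> real"
      using sum.shift_bounds_nat_ivl[of g 0 "i*N" N] by (simp add: atLeast0LessThan add.commute)
    show ?thesis unfolding toeplitz_sum_def sh by simp
  qed
  have "toeplitz_sum r (k * N) = (\<Sum>i<k. \<Sum>a\<in>?A i. \<Sum>j<k. \<Sum>b\<in>?A j. K a b)"
    unfolding toeplitz_sum_def sum.nat_group ..
  also have "\<dots> = (\<Sum>i<k. \<Sum>j<k. P (?A i) (?A j))"
    by (intro sum.cong refl sum.swap)
  also have "\<dots> \<le> (\<Sum>i<k. \<Sum>j<k. toeplitz_sum r N)"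
  proof (intro sum_mono)
    fix i j
    show "P (?A i) (?A j) \<le> toeplitz_sum r N"
      using pd_cross_le[of "?A i" "?A j"] d[of i] d[of j] by simp
  qed
  also have "\<dots> = (real k)\<^sup>2 * toeplitz_sum r N" by (simp add: power2_eq_square)
  finally show ?thesis .
qed

lemma toeplitz_sum_add_le:
  "toeplitz_sum r (n + q) \<le> toeplitz_sum r n + 2 * real (n + q) * real q * r 0"
proof -
  have le: "K i j \<le> r 0" for i j using pd_abs_le[of "(i - j) + (j - i)"] by linarith
  have split: "sum g {..<n+q} = sum g {..<n} + sum g {n..<n+q}" for g :: "nat \<Rightarrow> real"
    by (simp add: sum.atLeastLessThan_concat[of 0 n "n+q" g, symmetric] flip: atLeast0LessThan)
  have "toeplitz_sum r (n + q) = toeplitz_sum r n + (\<Sum>i<n. \<Sum>j=n..<n+q. K i j) + (\<Sum>i=n..<n+q. \<Sum>j<n+q. K i j)"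
    unfolding toeplitz_sum_def split[of "\<lambda>i. \<Sum>j<n+q. K i j"] split by (simp add: sum.distrib)
  also have "(\<Sum>i<n. \<Sum>j=n..<n+q. K i j) \<le> (\<Sum>i<n. \<Sum>j=n..<n+q. r 0)"
    by (intro sum_mono le)
  also have "\<dots> \<le> real (n + q) * real q * r 0"
    using pd_zero_nonneg by (simp add: algebra_simps)
  also have "(\<Sum>i=n..<n+q. \<Sum>j<n+q. K i j) \<le> (\<Sum>i=n..<n+q. \<Sum>j<n+q. r 0)"
    by (intro sum_mono le)
  also have "\<dots> = real (n + q) * real q * r 0" by (simp add: algebra_simps)
  finally show ?thesis by (simp add: algebra_simps)
qed

text \<open>Division of \<open>M\<close> by \<open>N\<close> with remainder: the full blocks are
  handled by \<open>toeplitz_sum_block\<close>, and the fewer than \<open>N\<close> leftover rows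
  and columns cost the error term. As this error involves \<open>r\<close> only through
  \<open>r 0\<close>, it can later be made small for all rotations at once.\<close>

lemma toeplitz_mean_almost_antimono:
  assumes "N > 0" "M > 0"
  shows "toeplitz_sum r M / (real M)\<^sup>2 \<le> toeplitz_sum r N / (real N)\<^sup>2 + 2 * real N * r 0 / real M"
proof -
  define k q where "k = M div N" and "q = M mod N"
  have M: "M = k * N + q" by (simp add: k_def q_def)
  have q: "q < N" using assms by (simp add: q_def)
  have "toeplitz_sum r M \<le> toeplitz_sum r (k * N) + 2 * real M * real q * r 0"
    using toeplitz_sum_add_le[of "k * N" q] M by simp
  also have "\<dots> \<le> (real k)\<^sup>2 * toeplitz_sum r N + 2 * real M * real N * r 0"
    using toeplitz_sum_block[of k N] q pd_zero_nonneg assms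
    by (intro add_mono mult_right_mono mult_left_mono) auto
  also have "(real k)\<^sup>2 * toeplitz_sum r N = (real (k * N))\<^sup>2 * (toeplitz_sum r N / (real N)\<^sup>2)"
    using assms by (simp add: power_mult_distrib)
  also have "\<dots> \<le> (real M)\<^sup>2 * (toeplitz_sum r N / (real N)\<^sup>2)"
    using toeplitz_sum_nonneg by (intro mult_right_mono power_mono) (auto simp: M simp del: of_nat_add of_nat_mult)
  finally show ?thesis
    using assms by (simp add: field_simps power2_eq_square)
qed

text \<open>By almost monotonicity the means converge to their infimum, as in Fekete's
  lemma.\<close>

lemma toeplitz_mean_convergent:
  obtains L where "0 \<le> L" "(\<lambda>N. toeplitz_sum r N / (real N)\<^sup>2) \<longlonglongrightarrow> L"
proof -
  define a where "a N = toeplitz_sum r N / (real N)\<^sup>2" for N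
  have a0: "0 \<le> a N" for N by (simp add: a_def toeplitz_sum_nonneg)
  define L where "L = Inf (a ` {0<..})"
  have bdd: "bdd_below (a ` {0<..})" using a0 by (intro bdd_belowI[of _ 0]) auto
  have ge: "L \<le> a N" if "N > 0" for N unfolding L_def using that bdd by (intro cINF_lower) auto
  have L0: "0 \<le> L" unfolding L_def by (intro cINF_greatest a0) auto
  have "a \<longlonglongrightarrow> L"
  proof (rule LIMSEQ_I)
    fix \<epsilon> :: real assume e: "\<epsilon> > 0"
    have "\<exists>x\<in>a ` {0<..}. x < L + \<epsilon>/2"
      using cInf_less_iff[of "a ` {0<..}" "L + \<epsilon>/2"] bdd e unfolding L_def by auto
    then obtain N where N: "N > 0" "a N < L + \<epsilon>/2" by auto
    obtain M0 :: nat where M0: "2 * real N * r 0 / (\<epsilon>/2) < real M0" using reals_Archimedean2 by blast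
    show "\<exists>no. \<forall>n\<ge>no. norm (a n - L) < \<epsilon>"
    proof (intro exI[of _ "Suc M0"] allI impI)
      fix n assume n: "n \<ge> Suc M0"
      have "2 * real N * r 0 < \<epsilon>/2 * real M0" using M0 e by (simp add: field_simps)
      also have "\<dots> \<le> \<epsilon>/2 * real n" using n e by (intro mult_left_mono) auto
      finally have "2 * real N * r 0 / real n < \<epsilon>/2" using n by (simp add: divide_less_eq)
      then have "a n < L + \<epsilon>"
        using toeplitz_mean_almost_antimono[of N n] N n unfolding a_def by linarith
      then show "norm (a n - L) < \<epsilon>" using ge[of n] n by simp
    qed
  qed
  then show thesis using that L0 unfolding a_def by blast
qed

lemma toeplitz_sum_Suc:
  "toeplitz_sum r (Suc M) = toeplitz_sum r M + 2 * (\<Sum>h<Suc M. r h) - r 0"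
proof -
  have "(\<Sum>i<M. r (M - i)) = (\<Sum>i<M. r (Suc i))"
    using sum.nat_diff_reindex[of "\<lambda>i. r (Suc i)" M] 
    by (intro trans[OF sum.cong sum.nat_diff_reindex]) (auto simp: Suc_diff_Suc)
  also have "\<dots> = (\<Sum>h<Suc M. r h) - r 0" by (subst sum.lessThan_Suc_shift) simp
  finally have "(\<Sum>i<M. r (M - i)) = (\<Sum>h<Suc M. r h) - r 0" .
  then show ?thesis by (simp add: toeplitz_sum_def sum.distrib)
qed

text \<open>A Tauberian step: the second-order means converge and \<open>r\<close> is bounded, so the
  first-order means, which are their discrete derivative, converge to the same limit.\<close>

lemma pd_partial_sum_diff:
  "\<bar>toeplitz_sum r (M + k) - toeplitz_sum r M - 2 * real k * (\<Sum>h<M. r h)\<bar> \<le> 3 * (real k)\<^sup>2 * r 0"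
proof -
  define T where "T m = (\<Sum>h<m. r h)" for m
  have Td: "\<bar>T (M + i) - T M\<bar> \<le> real i * r 0" for i
  proof (induction i)
    case (Suc i)
    then show ?case using pd_abs_le[of "M + i"] by (simp add: T_def algebra_simps)
  qed simp
  have "toeplitz_sum r (M + k) - toeplitz_sum r M = (\<Sum>i<k. 2 * T (M + Suc i) - r 0)"
  proof (induction k)
    case (Suc k)
    then show ?case using toeplitz_sum_Suc[of "M + k"] by (simp add: T_def)
  qed simp
  then have "\<bar>toeplitz_sum r (M + k) - toeplitz_sum r M - 2 * real k * T M\<bar>
     = \<bar>\<Sum>i<k. 2 * (T (M + Suc i) - T M) - r 0\<bar>"
    by (simp add: sum_subtractf algebra_simps sum_distrib_left)
  also have "\<dots> \<le> (\<Sum>i<k. \<bar>2 * (T (M + Suc i) - T M) - r 0\<bar>)" by (rule sum_abs)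
  also have "\<dots> \<le> (\<Sum>i<k. 3 * real k * r 0)"
  proof (intro sum_mono)
    fix i assume "i \<in> {..<k}"
    then have "real (Suc i) * r 0 \<le> real k * r 0" "1 * r 0 \<le> real k * r 0"
      using pd_zero_nonneg by (intro mult_right_mono; simp)+
    then show "\<bar>2 * (T (M + Suc i) - T M) - r 0\<bar> \<le> 3 * real k * r 0"
    proof -
      have "\<bar>t\<bar> \<le> a \<Longrightarrow> a \<le> b \<Longrightarrow> c \<le> b \<Longrightarrow> 0 \<le> c \<Longrightarrow> \<bar>2 * t - c\<bar> \<le> 3 * b" for t a b c :: real
        by linarith
      from this[OF Td[of "Suc i"] \<open>real (Suc i) * r 0 \<le> real k * r 0\<close>, of "r 0"] show ?thesis
        using \<open>1 * r 0 \<le> real k * r 0\<close> pd_zero_nonneg by simp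
    qed
  qed
  also have "\<dots> = 3 * (real k)\<^sup>2 * r 0" by (simp add: power2_eq_square)
  finally show ?thesis by (simp add: T_def)
qed

lemma pd_cesaro_limit:
  assumes L: "(\<lambda>N. toeplitz_sum r N / (real N)\<^sup>2) \<longlonglongrightarrow> L"
  shows "(\<lambda>N. (\<Sum>h<N. r h) / real N) \<longlonglongrightarrow> L"
proof (rule LIMSEQ_I)
  fix \<epsilon> :: real assume e: "\<epsilon> > 0"
  define T where "T m = (\<Sum>h<m. r h)" for m
  define C where "C = \<bar>L\<bar> + 3 * r 0 + 1"
  have C: "C > 0" using pd_zero_nonneg by (simp add: C_def)
  \<comment> \<open>The partial sum at \<open>n\<close> is compared with the increment of
    \<open>toeplitz_sum\<close> over a window of length \<open>k\<close>, about
    \<open>\<eta> * n\<close>. The window causes an error of order \<open>k\<close> squared, hence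
    \<open>\<eta>\<close> is small in terms of \<open>C\<close>; the convergence error,
    \<open>\<delta>\<close> times \<open>n\<close> squared, must be small against
    \<open>k * n\<close>, hence \<open>\<delta>\<close> is small in terms of
    \<open>\<eta>\<close>.\<close>
  define \<eta> where "\<eta> = min (1/2) (\<epsilon> / (4 * C))"
  have eta: "\<eta> > 0" "\<eta> \<le> 1/2" "\<eta> * C \<le> \<epsilon>/4"
    using e C by (auto simp: \<eta>_def min_def field_simps)
  define \<delta> where "\<delta> = \<epsilon> * \<eta> / 10"
  have \<delta>: "\<delta> > 0" using e eta by (simp add: \<delta>_def)
  define S where "S = toeplitz_sum r"
  obtain M0 where M0: "\<And>n. n \<ge> M0 \<Longrightarrow> \<bar>S n / (real n)\<^sup>2 - L\<bar> < \<delta>"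
    using LIMSEQ_D[OF L \<delta>] by (auto simp: S_def)
  have Se: "\<bar>S n - L * (real n)\<^sup>2\<bar> \<le> \<delta> * (real n)\<^sup>2" if "n \<ge> M0" "n > 0" for n
  proof -
    have "\<bar>S n - L * (real n)\<^sup>2\<bar> = \<bar>S n / (real n)\<^sup>2 - L\<bar> * (real n)\<^sup>2"
      using that by (simp add: field_simps flip: abs_mult_pos)
    then show ?thesis using M0[OF that(1)] by (simp add: mult_right_mono)
  qed
  obtain M1 :: nat where M1: "1 / \<eta> < real M1" using reals_Archimedean2 by blast
  show "\<exists>no. \<forall>n\<ge>no. norm ((\<Sum>h<n. r h) / real n - L) < \<epsilon>"
  proof (intro exI[of _ "M0 + M1 + 1"] allI impI)
    fix n assume n: "n \<ge> M0 + M1 + 1"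
    define k where "k = nat \<lceil>\<eta> * real n\<rceil>"
    have "1 < \<eta> * real M1" using M1 eta by (simp add: field_simps)
    also have "\<dots> \<le> \<eta> * real n" using n eta by (intro mult_left_mono) auto
    finally have n1: "1 < \<eta> * real n" .
    have k: "\<eta> * real n \<le> real k" "real k \<le> 2 * \<eta> * real n"
      using n1 unfolding k_def by linarith+
    have kpos: "real k > 0" using k n1 by linarith
    have "2 * \<eta> * real n \<le> 1 * real n" using eta by (intro mult_right_mono) auto
    with k have kn: "real k \<le> real n" by linarith
    have npos: "real n > 0" using n by simp
    have "\<bar>S (n + k) - L * (real (n + k))\<^sup>2\<bar> \<le> \<delta> * (real (n + k))\<^sup>2" using Se[of "n + k"] n by simp
    also have "\<dots> \<le> \<delta> * (2 * real n)\<^sup>2" using kn \<delta> by (intro mult_left_mono power_mono) auto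
    finally have b1: "\<bar>S (n + k) - L * (real n + real k)\<^sup>2\<bar> \<le> 4 * \<delta> * (real n)\<^sup>2"
      by (simp add: power_mult_distrib)
    have b2: "\<bar>S n - L * (real n)\<^sup>2\<bar> \<le> \<delta> * (real n)\<^sup>2" using Se n by simp
    have b3: "\<bar>S (n + k) - S n - 2 * real k * T n\<bar> \<le> 3 * (real k)\<^sup>2 * r 0"
      using pd_partial_sum_diff[of n k] by (simp add: S_def T_def)
    have b4: "\<bar>L * (real k)\<^sup>2\<bar> = \<bar>L\<bar> * (real k)\<^sup>2" by (simp add: abs_mult)
    have sq: "L * (real n + real k)\<^sup>2 = L * (real n)\<^sup>2 + 2 * real k * (L * real n) + L * (real k)\<^sup>2"
      by (simp add: power2_eq_square algebra_simps)
    have "\<bar>2 * real k * T n - 2 * real k * (L * real n)\<bar>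
        \<le> 5 * \<delta> * (real n)\<^sup>2 + 3 * (real k)\<^sup>2 * r 0 + \<bar>L\<bar> * (real k)\<^sup>2"
      using b1 b2 b3 b4 sq by linarith
    also have "\<dots> \<le> 5 * \<delta> * (real n)\<^sup>2 + C * (real k)\<^sup>2"
      by (simp add: C_def algebra_simps)
    also have "5 * \<delta> * (real n)\<^sup>2 = (\<epsilon> / 2 * real n) * (\<eta> * real n)"
      by (simp add: \<delta>_def power2_eq_square)
    also have "\<dots> \<le> (\<epsilon> / 2 * real n) * real k" using k e by (intro mult_left_mono) auto
    also have "C * (real k)\<^sup>2 = (C * real k) * real k" by (simp add: power2_eq_square)
    also have "\<dots> \<le> (\<epsilon> / 2 * real n) * real k"
    proof (intro mult_right_mono)
      have "C * real k \<le> C * (2 * \<eta> * real n)" using k C by (intro mult_left_mono) auto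
      also have "\<dots> = 2 * (\<eta> * C) * real n" by simp
      also have "\<dots> \<le> 2 * (\<epsilon>/4) * real n" using eta by (intro mult_right_mono mult_left_mono) auto
      finally show "C * real k \<le> \<epsilon> / 2 * real n" by simp
    qed simp
    finally have "\<bar>2 * real k * T n - 2 * real k * (L * real n)\<bar> \<le> 2 * real k * (\<epsilon> / 2 * real n)"
      by (simp add: mult_ac)
    then have "2 * real k * \<bar>T n - L * real n\<bar> \<le> 2 * real k * (\<epsilon> / 2 * real n)"
      using kpos by (simp add: abs_mult flip: right_diff_distrib)
    then have "\<bar>T n - L * real n\<bar> \<le> \<epsilon> / 2 * real n" using kpos by simp
    also have "\<dots> < \<epsilon> * real n" using e npos by simp
    finally have "\<bar>T n - L * real n\<bar> / real n < \<epsilon>" using npos by (simp add: divide_less_eq)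
    moreover have "\<bar>T n - L * real n\<bar> / real n = \<bar>T n / real n - L\<bar>"
      using npos by (simp only: abs_div_pos) (simp add: diff_divide_distrib)
    ultimately show "norm ((\<Sum>h<n. r h) / real n - L) < \<epsilon>"
      by (simp add: T_def)
  qed
qed

lemma pd_cesaro_convergent: "convergent (\<lambda>N. (\<Sum>h<N. r h) / real N)"
  using toeplitz_mean_convergent pd_cesaro_limit convergentI by metis

lemma pd_row_sum:
  assumes "i < M"
  shows "(\<Sum>j<M. r ((i - j) + (j - i))) = (\<Sum>h<Suc i. r h) + (\<Sum>h<M - i. r h) - r 0"
proof -
  have "(\<Sum>j<M. K i j) = (\<Sum>j<i. K i j) + (\<Sum>j\<in>{i..<M}. K i j)"
    using assms sum.atLeastLessThan_concat[of 0 i M "K i"] by (simp flip: atLeast0LessThan)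
  also have "(\<Sum>j\<in>{i..<M}. K i j) = (\<Sum>j\<in>{0+i..<(M-i)+i}. K i j)" using assms by simp
  also have "\<dots> = (\<Sum>h<M - i. r h)" unfolding sum.shift_bounds_nat_ivl by (simp add: atLeast0LessThan)
  also have "(\<Sum>j<i. K i j) = (\<Sum>j<i. r (Suc j))"
    by (intro trans[OF sum.cong sum.nat_diff_reindex]) (auto simp: Suc_diff_Suc)
  also have "\<dots> = (\<Sum>h<Suc i. r h) - r 0" by (subst sum.lessThan_Suc_shift) simp
  finally show ?thesis by simp
qed

text \<open>Cesaro means of the underlying isometry form a Cauchy sequence; the left-hand side is the squared
  norm of the difference of the means of order \<open>N\<close> and \<open>M\<close>.\<close>

lemma pd_means_Cauchy:
  assumes "\<epsilon> > 0"
  shows "\<exists>n0. \<forall>N\<ge>n0. \<forall>M\<ge>N. toeplitz_sum r N / (real N)\<^sup>2 + toeplitz_sum r M / (real M)\<^sup>2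
     - 2 * (\<Sum>i<N. \<Sum>j<M. r ((i - j) + (j - i))) / (real N * real M) < \<epsilon>"
proof -
  obtain L where L0: "0 \<le> L" and L: "(\<lambda>N. toeplitz_sum r N / (real N)\<^sup>2) \<longlonglongrightarrow> L"
    by (rule toeplitz_mean_convergent)
  define T where "T m = (\<Sum>h<m. r h)" for m
  define \<delta> where "\<delta> = \<epsilon> / 10"
  have d: "\<delta> > 0" using assms by (simp add: \<delta>_def)
  obtain n1 where n1: "\<And>n. n \<ge> n1 \<Longrightarrow> \<bar>toeplitz_sum r n / (real n)\<^sup>2 - L\<bar> < \<delta>"
    using LIMSEQ_D[OF L d] by auto
  obtain n2 where n2: "\<And>n. n \<ge> n2 \<Longrightarrow> \<bar>T n / real n - L\<bar> < \<delta>"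
    using LIMSEQ_D[OF pd_cesaro_limit[OF L] d] by (auto simp: T_def)
  define C where "C = real n2 * (r 0 + L)"
  have C: "C \<ge> 0" using pd_zero_nonneg L0 by (simp add: C_def)
  \<comment> \<open>Lengths below \<open>n2\<close> are absorbed by \<open>C\<close>, so that the
    lower bound holds for every \<open>m\<close>.\<close>
  have T: "T m \<ge> (L - \<delta>) * real m - C" for m
  proof (cases "m \<ge> n2 \<and> m > 0")
    case True
    then have "T m / real m > L - \<delta>" using n2[of m] by linarith
    then have "T m > (L - \<delta>) * real m" using True by (simp add: field_simps)
    then show ?thesis using C by linarith
  next
    case False
    have "- T m \<le> (\<Sum>h<m. r 0)"
      unfolding T_def sum_negf[symmetric] using pd_abs_le by (intro sum_mono) (meson abs_le_D2)
    moreover have "real m * (r 0 + L) \<le> C"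
      unfolding C_def using False pd_zero_nonneg L0 by (intro mult_right_mono) (cases "m = 0", auto)
    moreover have "(L - \<delta>) * real m \<le> L * real m" using d by (intro mult_right_mono) auto
    ultimately show ?thesis by (simp add: algebra_simps)
  qed
  obtain n3 :: nat where n3: "(2 * C + r 0 + \<delta>) / \<delta> < real n3" using reals_Archimedean2 by blast
  show ?thesis
  proof (intro exI[of _ "n1 + n3 + 1"] allI impI)
    fix N M assume N: "N \<ge> n1 + n3 + 1" and M: "M \<ge> N"
    \<comment> \<open>The two partial sums that make up a row have lengths \<open>i + 1\<close> and
      \<open>M - i\<close>, together \<open>M + 1\<close>; wherever the row meets the diagonal, its
      mean is therefore almost \<open>L\<close> or larger.\<close>
    have row: "(\<Sum>j<M. K i j) \<ge> (L - 2 * \<delta>) * real M" if "i < N" for i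
    proof -
      have "2 * C + r 0 + \<delta> \<le> \<delta> * real n3" using n3 d by (simp add: field_simps)
      also have "\<dots> \<le> \<delta> * real M" using N M d by (intro mult_left_mono) auto
      finally have a: "2 * C + r 0 + \<delta> \<le> \<delta> * real M" .
      have "(\<Sum>j<M. K i j) = T (Suc i) + T (M - i) - r 0"
        using pd_row_sum[of i M] that M unfolding T_def by simp
      also have "\<dots> \<ge> ((L - \<delta>) * real (Suc i) - C) + ((L - \<delta>) * real (M - i) - C) - r 0"
        using T[of "Suc i"] T[of "M - i"] by linarith
      also have "((L - \<delta>) * real (Suc i) - C) + ((L - \<delta>) * real (M - i) - C) - r 0
         = (L - \<delta>) * real M + (L - \<delta>) - 2 * C - r 0"
        using that M by (simp add: of_nat_diff algebra_simps)
      finally have "(\<Sum>j<M. K i j) \<ge> (L - \<delta>) * real M + (L - \<delta>) - 2 * C - r 0" .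
      then show ?thesis using a L0 unfolding left_diff_distrib by linarith
    qed
    have "(\<Sum>i<N. \<Sum>j<M. K i j) \<ge> (\<Sum>i<N. (L - 2 * \<delta>) * real M)" using row by (intro sum_mono) auto
    then have "(\<Sum>i<N. \<Sum>j<M. K i j) / (real N * real M) \<ge> L - 2 * \<delta>"
      using N M by (simp add: field_simps)
    moreover have "toeplitz_sum r N / (real N)\<^sup>2 < L + \<delta>" using n1[of N] N by auto
    moreover have "toeplitz_sum r M / (real M)\<^sup>2 < L + \<delta>" using n1[of M] N M by auto
    ultimately have "toeplitz_sum r N / (real N)\<^sup>2 + toeplitz_sum r M / (real M)\<^sup>2
     - 2 * ((\<Sum>i<N. \<Sum>j<M. K i j) / (real N * real M)) < 10 * \<delta>" using d by linarith
    then show "toeplitz_sum r N / (real N)\<^sup>2 + toeplitz_sum r M / (real M)\<^sup>2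
     - 2 * (\<Sum>i<N. \<Sum>j<M. K i j) / (real N * real M) < \<epsilon>" by (simp add: \<delta>_def)
  qed
qed

end

section \<open>The pointwise ergodic theorem\<close>

context ergodic_system
begin

lemma funpow_measurable [measurable]: "(T ^^ n) \<in> measurable M M"
proof (induction n)
  case (Suc n)
  then show ?case using measurable_comp[OF Suc measurable_T] by (simp add: comp_def)
qed simp

lemma T_in_space: "x \<in> space M \<Longrightarrow> T x \<in> space M"
  using measurable_T by (auto simp: measurable_def)

lemma funpow_in_space: "x \<in> space M \<Longrightarrow> (T ^^ n) x \<in> space M"
  by (induction n) (auto intro: T_in_space)

lemma integral_T:
  fixes f :: "'a \<Rightarrow> 'b :: {banach, second_countable_topology}"
  assumes "f \<in> borel_measurable M"
  shows "(\<integral>x. f (T x) \<partial>M) = (\<integral>x. f x \<partial>M)"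
  using integral_distr[OF measurable_T assms] preserving_T by simp

lemma integral_funpow:
  fixes f :: "'a \<Rightarrow> 'b :: {banach, second_countable_topology}"
  assumes [measurable]: "f \<in> borel_measurable M"
  shows "(\<integral>x. f ((T ^^ n) x) \<partial>M) = (\<integral>x. f x \<partial>M)"
proof (induction n)
  case (Suc n)
  have "(\<integral>x. f ((T ^^ Suc n) x) \<partial>M) = (\<integral>x. f ((T ^^ n) (T x)) \<partial>M)"
    by (simp add: funpow_swap1)
  also have "\<dots> = (\<integral>x. f ((T ^^ n) x) \<partial>M)" by (rule integral_T) simp
  finally show ?case using Suc by simp
qed simp

lemma AE_T:
  assumes "AE x in M. P x"
  shows "AE x in M. P (T x)"
proof -
  have "AE x in distr M M T. P x" using assms by (simp only: preserving_T)
  then show ?thesis by (rule AE_distrD[OF measurable_T])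
qed

lemma bounded_integrable:
  fixes f :: "'a \<Rightarrow> 'b :: {banach, second_countable_topology}"
  assumes "f \<in> borel_measurable M" "\<And>x. x \<in> space M \<Longrightarrow> norm (f x) \<le> B"
  shows "integrable M f"
  using assms by (intro integrable_const_bound[of _ B]) auto

text \<open>\<open>maxsum g n\<close> is the maximum of the partial ergodic sums of lengths \<open>0, \<dots>, n\<close>.\<close>

primrec maxsum :: "('a \<Rightarrow> real) \<Rightarrow> nat \<Rightarrow> 'a \<Rightarrow> real" where
  "maxsum g 0 x = 0"
| "maxsum g (Suc n) x = max 0 (g x + maxsum g n (T x))"

lemma maxsum_nonneg: "0 \<le> maxsum g n x"
  by (cases n) auto

lemma maxsum_mono: "maxsum g n x \<le> maxsum g (Suc n) x"
proof (induction n arbitrary: x)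
  case (Suc n)
  then show ?case unfolding maxsum.simps(2)[of g "Suc n"] maxsum.simps(2)[of g n x]
    by (intro max.mono add_left_mono order.refl)
qed simp

lemma sum_le_maxsum: "(\<Sum>i<n. g ((T ^^ i) x)) \<le> maxsum g n x"
proof (induction n arbitrary: x)
  case (Suc n)
  have "(\<Sum>i<Suc n. g ((T ^^ i) x)) = g x + (\<Sum>i<n. g ((T ^^ i) (T x)))"
    by (subst sum.lessThan_Suc_shift) (simp add: funpow_swap1)
  then show ?case using Suc[of "T x"] by simp
qed simp

lemma maxsum_measurable [measurable]:
  assumes [measurable]: "g \<in> borel_measurable M"
  shows "maxsum g n \<in> borel_measurable M"
proof (induction n)
  case (Suc n)
  note [measurable] = Suc measurable_T
  have "(\<lambda>x. max 0 (g x + maxsum g n (T x))) \<in> borel_measurable M" by measurable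
  then show ?case by (simp add: fun_eq_iff[of "maxsum g (Suc n)"] cong: measurable_cong)
qed simp

lemma maxsum_bound:
  assumes "\<And>x. x \<in> space M \<Longrightarrow> \<bar>g x\<bar> \<le> B"
  shows "x \<in> space M \<Longrightarrow> \<bar>maxsum g n x\<bar> \<le> real n * B"
proof (induction n arbitrary: x)
  case (Suc n)
  have "\<bar>max 0 (g x + maxsum g n (T x))\<bar> \<le> \<bar>g x\<bar> + \<bar>maxsum g n (T x)\<bar>" by linarith
  also have "\<dots> \<le> B + real n * B" using assms Suc T_in_space by (intro add_mono) auto
  finally show ?case by (simp add: algebra_simps)
qed simp

text \<open>Garsia's argument. Where \<open>maxsum g n\<close> is positive it is at most
  \<open>g x + maxsum g n (T x)\<close>, and elsewhere it is 0; on integration the two maxima cancel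
  by invariance of the measure. By \<open>pos\<close> the sets where \<open>maxsum g n\<close> is
  positive exhaust the space up to a null set.\<close>

lemma maximal_ergodic:
  fixes g :: "'a \<Rightarrow> real"
  assumes g[measurable]: "g \<in> borel_measurable M" and B: "\<And>x. x \<in> space M \<Longrightarrow> \<bar>g x\<bar> \<le> B"
    and pos: "AE x in M. \<exists>n. (\<Sum>i<n. g ((T ^^ i) x)) > 0"
  shows "0 \<le> (\<integral>x. g x \<partial>M)"
proof -
  note [measurable] = measurable_T
  have int: "integrable M (maxsum g n)" for n
    by (rule bounded_integrable[where B="real n * B"]) (use maxsum_bound[OF B] in auto)
  have intT: "integrable M (\<lambda>x. maxsum g n (T x))" for n
    by (rule bounded_integrable[where B="real n * B"]) (use maxsum_bound[OF B] T_in_space in auto)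
  define I where "I n x = (if maxsum g n x > 0 then g x else 0)" for n x
  have [measurable]: "I n \<in> borel_measurable M" for n unfolding I_def by measurable
  have intI: "integrable M (I n)" for n
    by (rule bounded_integrable[where B="\<bar>B\<bar>"]) (use B in \<open>force simp: I_def\<close>)+
  have nonneg: "0 \<le> (\<integral>x. I n x \<partial>M)" for n
  proof -
    have "0 = (\<integral>x. maxsum g n x \<partial>M) - (\<integral>x. maxsum g n (T x) \<partial>M)"
      by (simp add: integral_T)
    also have "\<dots> = (\<integral>x. maxsum g n x - maxsum g n (T x) \<partial>M)"
      using int intT by simp
    also have "\<dots> \<le> (\<integral>x. I n x \<partial>M)"
    proof (intro integral_mono intI Bochner_Integration.integrable_diff int intT)
      fix x
      show "maxsum g n x - maxsum g n (T x) \<le> I n x"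
      proof (cases n)
        case (Suc k)
        then show ?thesis using maxsum_mono[where g=g and n=k and x="T x"] maxsum_nonneg[where g=g and n=n and x="T x"]
          by (auto simp: I_def max_def simp del: maxsum.simps(2) split: if_splits)
             (auto simp: max_def split: if_splits)
      qed (simp add: I_def)
    qed
    finally show ?thesis .
  qed
  have "(\<lambda>n. \<integral>x. I n x \<partial>M) \<longlonglongrightarrow> (\<integral>x. g x \<partial>M)"
  proof (rule integral_dominated_convergence[where w="\<lambda>_. \<bar>B\<bar>"])
    show "AE x in M. (\<lambda>n. I n x) \<longlonglongrightarrow> g x"
      using pos
    proof eventually_elim
      case (elim x)
      then obtain k where "(\<Sum>i<k. g ((T ^^ i) x)) > 0" by blast
      then have k: "maxsum g k x > 0" using sum_le_maxsum[where g=g and n=k and x=x] by linarith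
      have "maxsum g n x > 0" if "n \<ge> k" for n
        using lift_Suc_mono_le[where f="\<lambda>n. maxsum g n x", OF maxsum_mono that] k by linarith
      then have "eventually (\<lambda>n. I n x = g x) sequentially"
        unfolding eventually_sequentially I_def by auto
      then show ?case by (simp add: tendsto_eventually)
    qed
    show "AE x in M. norm (I n x) \<le> \<bar>B\<bar>" for n
      using B by (intro AE_I2) (force simp: I_def)
  qed auto
  then show ?thesis using nonneg by (intro LIMSEQ_le_const) auto
qed

text \<open>The upper limit is an invariant function, so by ergodicity it exceeds \<open>c\<close>
  almost everywhere or almost nowhere. In the first case the maximal inequality for
  \<open>f - c\<close> would make the integral at least \<open>c\<close>.\<close>

lemma ergodic_average_limsup:
  fixes f :: "'a \<Rightarrow> real"
  assumes f[measurable]: "f \<in> borel_measurable M" and B: "\<And>x. x \<in> space M \<Longrightarrow> \<bar>f x\<bar> \<le> B"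
    and c: "(\<integral>x. f x \<partial>M) < c"
  shows "AE x in M. limsup (\<lambda>n. ereal ((\<Sum>i<n. f ((T ^^ i) x)) / real n)) \<le> c"
proof -
  define S where "S n x = (\<Sum>i<n. f ((T ^^ i) x))" for n x
  have [measurable]: "S n \<in> borel_measurable M" for n unfolding S_def by measurable
  define X where "X x = limsup (\<lambda>n. ereal (S n x / real n))" for x
  have [measurable]: "X \<in> borel_measurable M" unfolding X_def by measurable
  have Sb: "\<bar>S n x\<bar> \<le> real n * B" if "x \<in> space M" for n x
  proof -
    have "\<bar>S n x\<bar> \<le> (\<Sum>i<n. \<bar>f ((T ^^ i) x)\<bar>)" unfolding S_def by (rule sum_abs)
    also have "\<dots> \<le> (\<Sum>i<n. B)" using B funpow_in_space that by (intro sum_mono) auto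
    finally show ?thesis by simp
  qed
  \<comment> \<open>\<open>ergodic_T\<close> speaks of sets that equal their preimage exactly, so
    invariance is proved at every point of the space and not just almost everywhere.\<close>
  have inv: "X (T x) = X x" if x: "x \<in> space M" for x
  proof -
    define e where "e n = S (Suc n) x / real (Suc n) - S n (T x) / real n" for n
    have B0: "0 \<le> B" using B[OF x] by linarith
    have e: "\<bar>e n\<bar> \<le> 2 * B * (1 / real (Suc n))" for n
    proof (cases "n = 0")
      \<comment> \<open>Division by 0 yields 0, so \<open>e 0 = f x\<close>.\<close>
      case True
      then show ?thesis using B[OF x] B0 by (simp add: e_def S_def)
    next
      case False
      have SS: "S (Suc n) x = f x + S n (T x)"
        unfolding S_def by (subst sum.lessThan_Suc_shift) (simp add: funpow_swap1)
      have "e n = (f x - S n (T x) / real n) / real (Suc n)"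
        using False by (simp add: e_def SS field_simps)
      moreover have "\<bar>S n (T x) / real n\<bar> \<le> B"
        using Sb[OF T_in_space[OF x], of n] False by (simp add: abs_divide divide_le_eq mult.commute)
      then have "\<bar>f x - S n (T x) / real n\<bar> \<le> 2 * B" using B[OF x] by linarith
      ultimately show ?thesis by (simp add: abs_divide divide_right_mono)
    qed
    have "e \<longlonglongrightarrow> 0"
    proof (rule Lim_null_comparison)
      show "(\<lambda>n. 2 * B * (1 / real (Suc n))) \<longlonglongrightarrow> 0"
        using tendsto_mult_right_zero[OF LIMSEQ_inverse_real_of_nat, of "2 * B"]
        by (simp add: inverse_eq_divide)
    qed (use e in auto)
    then have e0: "(\<lambda>n. ereal (e n)) \<longlonglongrightarrow> 0" by (simp add: zero_ereal_def)
    have "X x = limsup (\<lambda>n. ereal (S (n + 1) x / real (n + 1)))"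
      unfolding X_def by (rule limsup_shift[symmetric])
    also have "\<dots> = limsup (\<lambda>n. ereal (e n) + ereal (S n (T x) / real n))"
      by (simp add: e_def)
    also have "\<dots> = 0 + limsup (\<lambda>n. ereal (S n (T x) / real n))"
      by (rule ereal_limsup_lim_add[OF e0]) simp
    finally show ?thesis by (simp add: X_def)
  qed
  define A where "A = {x \<in> space M. X x > c}"
  have A[measurable]: "A \<in> sets M" unfolding A_def by measurable
  have "T -` A \<inter> space M = A" using inv T_in_space by (auto simp: A_def)
  then consider "prob A = 0" | "prob A = 1" using ergodic_T[OF A] by blast
  then show ?thesis
  proof cases
    case 1
    then have "AE x in M. x \<notin> A" using A by (simp add: AE_iff_null_sets[symmetric] null_sets_def emeasure_eq_measure)
    then have "AE x in M. X x \<le> c" using AE_space by eventually_elim (auto simp: A_def)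
    then show ?thesis by (simp add: X_def S_def)
  next
    case 2
    then have "AE x in M. x \<in> A" using A by (simp add: prob_eq_1)
    then have "AE x in M. \<exists>n. (\<Sum>i<n. f ((T ^^ i) x) - c) > 0"
    proof eventually_elim
      case (elim x)
      then have "limsup (\<lambda>n. ereal (S n x / real n)) > c" by (simp add: A_def X_def)
      then have "\<not> eventually (\<lambda>n. ereal (S n x / real n) \<le> c) sequentially"
        using Limsup_bounded[of "\<lambda>n. ereal (S n x / real n)" "ereal c" sequentially] by auto
      then have "\<exists>n\<ge>1. S n x / real n > c"
        unfolding eventually_sequentially by (auto simp: not_le)
      then obtain n where "n \<ge> 1" "S n x / real n > c" by blast
      then show ?case by (intro exI[of _ n]) (simp add: S_def sum_subtractf field_simps)
    qed
    then have "0 \<le> (\<integral>x. f x - c \<partial>M)"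
      by (intro maximal_ergodic[where B="B + \<bar>c\<bar>"]) (use B in \<open>force intro: order.trans[OF abs_triangle_ineq4]\<close>)+
    moreover have "integrable M f" using B by (intro bounded_integrable[of _ B]) auto
    ultimately have "c \<le> (\<integral>x. f x \<partial>M)" by (simp add: prob_space)
    then show ?thesis using c by simp
  qed
qed

text \<open>The upper bound is applied to \<open>f\<close> and to \<open>- f\<close>, at the levels
  \<open>1 / Suc k\<close> above the integral, so that only countably many null sets are
  discarded.\<close>

lemma birkhoff_real:
  fixes f :: "'a \<Rightarrow> real"
  assumes f[measurable]: "f \<in> borel_measurable M" and B: "\<And>x. x \<in> space M \<Longrightarrow> \<bar>f x\<bar> \<le> B"
  shows "AE x in M. (\<lambda>n. (\<Sum>i<n. f ((T ^^ i) x)) / real n) \<longlonglongrightarrow> (\<integral>x. f x \<partial>M)"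
proof -
  have up: "AE x in M. \<forall>k. limsup (\<lambda>n. ereal ((\<Sum>i<n. g ((T ^^ i) x)) / real n)) \<le> (\<integral>x. g x \<partial>M) + 1 / real (Suc k)"
    if "g \<in> borel_measurable M" "\<And>x. x \<in> space M \<Longrightarrow> \<bar>g x\<bar> \<le> B" for g
    unfolding AE_all_countable using that by (intro allI ergodic_average_limsup) auto
  have ev: "eventually (\<lambda>n. X n < a) sequentially"
    if X: "\<forall>k. limsup (\<lambda>n. ereal (X n)) \<le> l + 1 / real (Suc k)" and l: "l < a" for X :: "nat \<Rightarrow> real" and l a
  proof -
    obtain k where "1 / real (Suc k) < a - l" using l nat_approx_posE[of "a - l"] by auto
    then have "limsup (\<lambda>n. ereal (X n)) < ereal a"
      using X[rule_format, of k] by (auto elim!: le_less_trans)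
    from Limsup_lessD[OF this] show ?thesis by simp
  qed
  have "AE x in M. \<forall>k. limsup (\<lambda>n. ereal ((\<Sum>i<n. - f ((T ^^ i) x)) / real n)) \<le> (\<integral>x. - f x \<partial>M) + 1 / real (Suc k)"
    using up[of "\<lambda>x. - f x"] B by simp
  moreover have "AE x in M. \<forall>k. limsup (\<lambda>n. ereal ((\<Sum>i<n. f ((T ^^ i) x)) / real n)) \<le> (\<integral>x. f x \<partial>M) + 1 / real (Suc k)"
    using up[of f] B by simp
  ultimately show ?thesis
  proof eventually_elim
    case (elim x)
    show ?case
    proof (rule order_tendstoI)
      fix a assume "a < (\<integral>x. f x \<partial>M)"
      then have "(\<integral>x. - f x \<partial>M) < - a" by simp
      from ev[OF elim(1) this] show "\<forall>\<^sub>F n in sequentially. a < (\<Sum>i<n. f ((T ^^ i) x)) / real n"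
        by (simp add: sum_negf)
    next
      fix a assume "(\<integral>x. f x \<partial>M) < a"
      from ev[OF elim(2) this] show "\<forall>\<^sub>F n in sequentially. (\<Sum>i<n. f ((T ^^ i) x)) / real n < a" .
    qed
  qed
qed

lemma birkhoff:
  fixes f :: "'a \<Rightarrow> complex"
  assumes f[measurable]: "f \<in> borel_measurable M" and B: "\<And>x. x \<in> space M \<Longrightarrow> cmod (f x) \<le> B"
  shows "AE x in M. (\<lambda>n. (\<Sum>i<n. f ((T ^^ i) x)) / of_nat n) \<longlonglongrightarrow> (\<integral>x. f x \<partial>M)"
proof -
  have int: "integrable M f" using assms by (rule bounded_integrable)
  have "AE x in M. (\<lambda>n. (\<Sum>i<n. Re (f ((T ^^ i) x))) / real n) \<longlonglongrightarrow> (\<integral>x. Re (f x) \<partial>M)"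
    using B by (intro birkhoff_real[where B=B]) (auto intro: order.trans[OF abs_Re_le_cmod])
  moreover have "AE x in M. (\<lambda>n. (\<Sum>i<n. Im (f ((T ^^ i) x))) / real n) \<longlonglongrightarrow> (\<integral>x. Im (f x) \<partial>M)"
    using B by (intro birkhoff_real[where B=B]) (auto intro: order.trans[OF abs_Im_le_cmod])
  ultimately show ?thesis
  proof eventually_elim
    case (elim x)
    then show ?case using int by (simp add: tendsto_complex_iff Re_divide_of_nat Im_divide_of_nat)
  qed
qed

end

section \<open>Correlations and the seminorms\<close>

lemma bounded_measurableE:
  assumes "bounded_measurable M f"
  obtains B where "B \<ge> 0" "\<And>x. x \<in> space M \<Longrightarrow> cmod (f x) \<le> B"
proof -
  obtain b where "\<forall>x\<in>f ` space M. cmod x \<le> b"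
    using assms by (auto simp: bounded_measurable_def bounded_iff)
  then show thesis by (intro that[of "\<bar>b\<bar>"]) force+
qed

lemma bounded_measurableI:
  "f \<in> borel_measurable M \<Longrightarrow> (\<And>x. x \<in> space M \<Longrightarrow> cmod (f x) \<le> B) \<Longrightarrow> bounded_measurable M f"
  by (auto simp: bounded_measurable_def bounded_iff)

lemma bounded_measurable_borel: "bounded_measurable M f \<Longrightarrow> f \<in> borel_measurable M"
  by (simp add: bounded_measurable_def)

lemma borel_measurable_cnj [measurable (raw)]:
  "f \<in> borel_measurable M \<Longrightarrow> (\<lambda>x. cnj (f x)) \<in> borel_measurable M"
  by (rule measurable_compose[OF _ borel_measurable_continuous_onI]) (auto intro: continuous_intros)

lemma bounded_measurable_mult_cnj:
  assumes "bounded_measurable M f" "bounded_measurable M g"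
  shows "bounded_measurable M (\<lambda>x. f x * cnj (g x))"
proof -
  note [measurable] = assms[THEN bounded_measurable_borel]
  obtain B where B: "B \<ge> 0" "\<And>x. x \<in> space M \<Longrightarrow> cmod (f x) \<le> B" using assms by (metis bounded_measurableE)
  obtain C where C: "C \<ge> 0" "\<And>x. x \<in> space M \<Longrightarrow> cmod (g x) \<le> C" using assms by (metis bounded_measurableE)
  show ?thesis
    by (rule bounded_measurableI[where B="B * C"])
       (use B C in \<open>auto simp: norm_mult intro: mult_mono\<close>)
qed

context ergodic_system
begin

declare measurable_T [measurable]

text \<open>The Gram matrix of the functions \<open>f\<close> composed with \<open>T ^^ i\<close>.
  Two exponents instead of one lag give a meaning to negative lags for a \<open>T\<close> that need
  not be invertible.\<close>

definition corr :: "('a \<Rightarrow> complex) \<Rightarrow> nat \<Rightarrow> nat \<Rightarrow> complex" where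
  "corr f i j = (\<integral>x. f ((T ^^ i) x) * cnj (f ((T ^^ j) x)) \<partial>M)"

lemma bounded_measurable_funpow:
  assumes "bounded_measurable M f"
  shows "bounded_measurable M (\<lambda>x. f ((T ^^ n) x))"
proof -
  note [measurable] = assms[THEN bounded_measurable_borel]
  obtain B where B: "B \<ge> 0" "\<And>x. x \<in> space M \<Longrightarrow> cmod (f x) \<le> B" using assms by (metis bounded_measurableE)
  show ?thesis by (rule bounded_measurableI[where B=B]) (use B funpow_in_space in auto)
qed

lemma bounded_measurable_integrable: "bounded_measurable M f \<Longrightarrow> integrable M f"
  using bounded_integrable[OF bounded_measurable_borel] by (metis bounded_measurableE)

lemma corr_integrable:
  "bounded_measurable M f \<Longrightarrow> integrable M (\<lambda>x. f ((T ^^ i) x) * cnj (f ((T ^^ j) x)))"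
  by (intro bounded_measurable_integrable bounded_measurable_mult_cnj bounded_measurable_funpow)

lemma corr_cnj: "cnj (corr f i j) = corr f j i"
  by (simp add: corr_def mult.commute flip: Bochner_Integration.integral_cnj)

lemma corr_shift:
  assumes "bounded_measurable M f"
  shows "corr f (i + k) (j + k) = corr f i j"
proof -
  note [measurable] = assms[THEN bounded_measurable_borel]
  show ?thesis unfolding corr_def funpow_add comp_def
    by (rule integral_funpow[of "\<lambda>x. f ((T ^^ i) x) * cnj (f ((T ^^ j) x))"]) measurable
qed

lemma corr_reduce:
  assumes "bounded_measurable M f"
  shows "corr f i j = (if i \<le> j then corr f 0 (j - i) else cnj (corr f 0 (i - j)))"
  using corr_shift[OF assms, of 0 i "j - i"] corr_shift[OF assms, of "i - j" j 0]
  by (auto simp: corr_cnj)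

lemma cmod_corr:
  assumes "bounded_measurable M f"
  shows "cmod (corr f i j) = cmod (corr f 0 ((i - j) + (j - i)))"
  using corr_reduce[OF assms, of i j] by (cases "i \<le> j") auto

lemma corr_form:
  assumes f: "bounded_measurable M f"
  shows "(\<Sum>i<n. \<Sum>j<n. c i * cnj (c j) * corr f i j) =
    complex_of_real (\<integral>x. (cmod (\<Sum>i<n. c i * f ((T ^^ i) x)))\<^sup>2 \<partial>M)"
proof -
  have "complex_of_real (\<integral>x. (cmod (\<Sum>i<n. c i * f ((T ^^ i) x)))\<^sup>2 \<partial>M) =
     (\<integral>x. (\<Sum>i<n. \<Sum>j<n. c i * cnj (c j) * (f ((T ^^ i) x) * cnj (f ((T ^^ j) x)))) \<partial>M)"
    unfolding integral_complex_of_real[symmetric] complex_norm_square cnj_sum sum_product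
    by (simp add: mult_ac)
  also have "\<dots> = (\<Sum>i<n. \<Sum>j<n. c i * cnj (c j) * corr f i j)"
    unfolding corr_def
    by (subst Bochner_Integration.integral_sum
      | intro Bochner_Integration.integrable_sum integrable_mult_right corr_integrable f sum.cong refl integral_mult_right_zero)+
  finally show ?thesis ..
qed

text \<open>An instance of the Schur product theorem.\<close>

lemma corr_norm_positive_definite:
  assumes f: "bounded_measurable M f"
  shows "positive_definite (\<lambda>h. (cmod (corr f 0 h))\<^sup>2)"
  unfolding positive_definite_def
proof (intro allI)
  fix c :: "nat \<Rightarrow> real" and n :: nat
  \<comment> \<open>For fixed \<open>x\<close> the rank-one matrix of the values along the orbit is
    absorbed into the coefficients \<open>w i\<close>, and what remains is a Gram form of
    \<open>corr\<close>, hence nonnegative. Integration over \<open>x\<close> turns the rank-one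
    matrix into a second copy of \<open>corr\<close>.\<close>
  define G where "G x = (\<Sum>i<n. \<Sum>j<n. of_real (c i * c j) * cnj (corr f i j) *
     (f ((T ^^ i) x) * cnj (f ((T ^^ j) x))))" for x
  have intG: "integrable M G" unfolding G_def
    by (intro Bochner_Integration.integrable_sum integrable_mult_right corr_integrable f)
  have "(\<integral>x. G x \<partial>M) = (\<Sum>i<n. \<Sum>j<n. of_real (c i * c j) * cnj (corr f i j) * corr f i j)"
    unfolding G_def corr_def[of f i j for i j]
    by (subst Bochner_Integration.integral_sum
      | intro Bochner_Integration.integrable_sum integrable_mult_right corr_integrable f sum.cong refl integral_mult_right_zero)+
  also have "\<dots> = complex_of_real (\<Sum>i<n. \<Sum>j<n. c i * c j * (cmod (corr f i j))\<^sup>2)"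
    unfolding of_real_sum of_real_mult complex_norm_square by (simp add: mult_ac)
  also have "\<dots> = complex_of_real (\<Sum>i<n. \<Sum>j<n. c i * c j * (cmod (corr f 0 ((i - j) + (j - i))))\<^sup>2)"
    by (intro arg_cong[where f=complex_of_real] sum.cong refl) (metis cmod_corr[OF f])
  finally have eq: "(\<integral>x. G x \<partial>M) = \<dots>" .
  have Re_nonneg: "0 \<le> Re (G x)" for x
  proof -
    define w where "w i = cnj (of_real (c i) * f ((T ^^ i) x))" for i
    have "G x = cnj (\<Sum>i<n. \<Sum>j<n. w i * cnj (w j) * corr f i j)"
      unfolding G_def w_def cnj_sum by (intro sum.cong refl) (simp add: mult_ac)
    then show ?thesis unfolding corr_form[OF f] by simp
  qed
  have "0 \<le> (\<integral>x. Re (G x) \<partial>M)" using Re_nonneg by (rule Bochner_Integration.integral_nonneg)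
  also have "\<dots> = Re (\<integral>x. G x \<partial>M)" using intG by simp
  finally show "0 \<le> (\<Sum>i<n. \<Sum>j<n. c i * c j * (cmod (corr f 0 ((i - j) + (j - i))))\<^sup>2)"
    unfolding eq by simp
qed

text \<open>Convergence makes \<open>lim\<close> in the definition the actual limit, and
  nonnegativity of that limit lets the fourth power undo the root.\<close>

lemma seminorm2_limit:
  assumes f: "bounded_measurable M f"
  shows "(\<lambda>H. (\<Sum>h<H. (cmod (corr f 0 h))\<^sup>2) / real H) \<longlonglongrightarrow> (seminorm2 M T f) ^ 4"
    and "seminorm2 M T f \<ge> 0"
proof -
  let ?X = "\<lambda>H. (\<Sum>h<H. (cmod (corr f 0 h))\<^sup>2) / real H"
  have "convergent ?X" by (rule pd_cesaro_convergent[OF corr_norm_positive_definite[OF f]])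
  then have lim: "?X \<longlonglongrightarrow> lim ?X" by (simp add: convergent_LIMSEQ_iff)
  then have "0 \<le> lim ?X" by (rule LIMSEQ_le_const) (auto intro!: divide_nonneg_nonneg sum_nonneg)
  moreover have "seminorm2 M T f = root 4 (lim ?X)" by (simp add: seminorm2_def corr_def)
  ultimately show "?X \<longlonglongrightarrow> (seminorm2 M T f) ^ 4" "seminorm2 M T f \<ge> 0"
    using lim by (simp_all add: real_root_ge_zero)
qed

definition mderiv :: "('a \<Rightarrow> complex) \<Rightarrow> nat \<Rightarrow> 'a \<Rightarrow> complex" where
  "mderiv f h x = f x * cnj (f ((T ^^ h) x))"

lemma bounded_measurable_mderiv:
  "bounded_measurable M f \<Longrightarrow> bounded_measurable M (mderiv f h)"
  unfolding mderiv_def by (intro bounded_measurable_mult_cnj bounded_measurable_funpow)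

text \<open>This symmetry exhibits the sequence averaged in the definition of \<open>seminorm3\<close> as a limit of averages
  of sequences \<open>h \<mapsto> (cmod (corr (mderiv f k) 0 h))\<^sup>2\<close>, which are positive definite.\<close>

lemma corr_mderiv_swap: "corr (mderiv f h) 0 k = corr (mderiv f k) 0 h"
proof -
  have "(T ^^ h) ((T ^^ k) x) = (T ^^ k) ((T ^^ h) x)" for x
    by (metis add.commute comp_apply funpow_add)
  then show ?thesis unfolding corr_def mderiv_def by (simp add: mult_ac)
qed

lemma seminorm2_mderiv_positive_definite:
  assumes f: "bounded_measurable M f"
  shows "positive_definite (\<lambda>h. (seminorm2 M T (mderiv f h)) ^ 4)"
  unfolding positive_definite_def
proof (intro allI)
  fix c :: "nat \<Rightarrow> real" and n :: nat
  let ?d = "\<lambda>i j :: nat. (i - j) + (j - i)"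
  define X where "X K h = (\<Sum>k<K. (cmod (corr (mderiv f k) 0 h))\<^sup>2) / real K" for K h
  have X: "(\<lambda>K. X K h) \<longlonglongrightarrow> (seminorm2 M T (mderiv f h)) ^ 4" for h
    unfolding X_def using seminorm2_limit(1)[OF bounded_measurable_mderiv[OF f], of h]
    by (simp add: corr_mderiv_swap[of f h])
  have "(\<lambda>K. \<Sum>i<n. \<Sum>j<n. c i * c j * X K (?d i j)) \<longlonglongrightarrow>
      (\<Sum>i<n. \<Sum>j<n. c i * c j * (seminorm2 M T (mderiv f (?d i j))) ^ 4)"
    by (intro tendsto_sum tendsto_mult tendsto_const X)
  moreover have "0 \<le> (\<Sum>i<n. \<Sum>j<n. c i * c j * X K (?d i j))" for K
  proof -
    have "0 \<le> (\<Sum>k<K. (\<Sum>i<n. \<Sum>j<n. c i * c j * (cmod (corr (mderiv f k) 0 (?d i j)))\<^sup>2))"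
      using corr_norm_positive_definite[OF bounded_measurable_mderiv[OF f]]
      unfolding positive_definite_def by (intro sum_nonneg[of "{..<K}"]) blast
    also have "\<dots> = (\<Sum>i<n. \<Sum>j<n. \<Sum>k<K. c i * c j * (cmod (corr (mderiv f k) 0 (?d i j)))\<^sup>2)"
      by (subst sum.swap, rule sum.cong[OF refl], rule sum.swap)
    finally have "0 \<le> \<dots> / real K" by simp
    then show ?thesis by (simp add: X_def sum_divide_distrib sum_distrib_left)
  qed
  ultimately show "0 \<le> (\<Sum>i<n. \<Sum>j<n. c i * c j * (seminorm2 M T (mderiv f (?d i j))) ^ 4)"
    by (intro LIMSEQ_le_const) auto
qed

lemma seminorm3_zero_limit:
  assumes f: "bounded_measurable M f" and "seminorm3 M T f = 0"
  shows "(\<lambda>H. (\<Sum>h<H. (seminorm2 M T (mderiv f h)) ^ 4) / real H) \<longlonglongrightarrow> 0"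
proof -
  let ?X = "\<lambda>H. (\<Sum>h<H. (seminorm2 M T (mderiv f h)) ^ 4) / real H"
  have "convergent ?X" by (rule pd_cesaro_convergent[OF seminorm2_mderiv_positive_definite[OF f]])
  then have "?X \<longlonglongrightarrow> lim ?X" by (simp add: convergent_LIMSEQ_iff)
  moreover have "seminorm3 M T f = root 8 (lim ?X)"
    by (simp add: seminorm3_def mderiv_def[abs_def])
  then have "lim ?X = 0" using assms by simp
  ultimately show ?thesis by simp
qed

end

section \<open>Functions orthogonal to the eigenfunctions\<close>

context ergodic_system
begin

text \<open>For the isometry sending \<open>g\<close> to \<open>l * g (T x)\<close> this is the real
  part of the inner product of \<open>f\<close> with its \<open>h\<close>-th iterate. Quadratic
  forms with real coefficients see only this real part, which keeps the sequence within
  \<open>positive_definite\<close>.\<close>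

definition twisted_corr :: "('a \<Rightarrow> complex) \<Rightarrow> complex \<Rightarrow> nat \<Rightarrow> real" where
  "twisted_corr f l h = Re (cnj l ^ h * corr f 0 h)"

lemma twisted_corr_form:
  assumes f: "bounded_measurable M f" and l: "cmod l = 1"
  shows "(\<Sum>i<n. \<Sum>j<n. c i * c j * twisted_corr f l ((i - j) + (j - i))) =
    (\<integral>x. (cmod (\<Sum>i<n. of_real (c i) * l ^ i * f ((T ^^ i) x)))\<^sup>2 \<partial>M)"
proof -
  have ll: "l * cnj l = 1" using l complex_norm_square[of l] by simp
  have lln: "l ^ m * cnj l ^ m = 1" for m using ll by (metis power_mult_distrib power_one)
  have rc: "Re (cnj z) = Re z" for z by simp
  have rr: "Re (complex_of_real a * z) = a * Re z" for a z by simp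
  have e: "c i * c j * twisted_corr f l ((i - j) + (j - i)) =
     Re (of_real (c i) * l ^ i * cnj (of_real (c j) * l ^ j) * corr f i j)" for i j
  proof (cases "i \<le> j")
    case True
    then obtain k where k: "j = i + k" using le_Suc_ex by blast
    have "l ^ i * cnj (l ^ j) = cnj l ^ k * (l ^ i * cnj l ^ i)" by (simp add: k power_add)
    then have "l ^ i * cnj (l ^ j) = cnj l ^ k" by (simp add: lln)
    moreover have "corr f i j = corr f 0 k"
      using corr_reduce[OF f, of i j] k by simp
    ultimately have "of_real (c i) * l ^ i * cnj (of_real (c j) * l ^ j) * corr f i j
      = of_real (c i * c j) * (cnj l ^ k * corr f 0 k)"
      by (simp add: mult_ac)
    then show ?thesis using k by (simp only: rr rc) (simp add: twisted_corr_def)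
  next
    case False
    then obtain k where k: "i = j + k" using le_Suc_ex nat_le_linear by blast
    have "l ^ i * cnj (l ^ j) = l ^ k * (l ^ j * cnj l ^ j)" by (simp add: k power_add)
    then have "l ^ i * cnj (l ^ j) = l ^ k" by (simp add: lln)
    moreover have "corr f i j = cnj (corr f 0 k)"
      using corr_cnj[of f j i] corr_reduce[OF f, of j i] k by simp
    ultimately have "of_real (c i) * l ^ i * cnj (of_real (c j) * l ^ j) * corr f i j
      = of_real (c i * c j) * cnj (cnj l ^ k * corr f 0 k)"
      by (simp add: mult_ac)
    then show ?thesis using k by (simp only: rr rc) (simp add: twisted_corr_def)
  qed
  have "(\<Sum>i<n. \<Sum>j<n. c i * c j * twisted_corr f l ((i - j) + (j - i))) =
     Re (\<Sum>i<n. \<Sum>j<n. (of_real (c i) * l ^ i) * cnj (of_real (c j) * l ^ j) * corr f i j)"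
    unfolding e by simp
  also have "\<dots> = (\<integral>x. (cmod (\<Sum>i<n. (of_real (c i) * l ^ i) * f ((T ^^ i) x)))\<^sup>2 \<partial>M)"
    unfolding corr_form[OF f] by simp
  finally show ?thesis .
qed

lemma twisted_corr_positive_definite:
  assumes f: "bounded_measurable M f" and l: "cmod l = 1"
  shows "positive_definite (twisted_corr f l)"
  unfolding positive_definite_def twisted_corr_form[OF assms] by (intro allI Bochner_Integration.integral_nonneg) auto

definition twisted_mean :: "('a \<Rightarrow> complex) \<Rightarrow> complex \<Rightarrow> nat \<Rightarrow> 'a \<Rightarrow> complex" where
  "twisted_mean f l N x = (\<Sum>i<N. l ^ i * f ((T ^^ i) x)) / of_nat N"

lemma twisted_mean_norm2:
  assumes f: "bounded_measurable M f" and l: "cmod l = 1"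
  shows "(\<integral>x. (cmod (twisted_mean f l N x))\<^sup>2 \<partial>M) = toeplitz_sum (twisted_corr f l) N / (real N)\<^sup>2"
  using twisted_corr_form[OF assms, of "\<lambda>_. 1" N]
  by (simp add: toeplitz_sum_def twisted_mean_def norm_divide power_divide)

lemma twisted_mean_diff_norm2:
  assumes f: "bounded_measurable M f" and l: "cmod l = 1" and N: "0 < N" "N \<le> N'"
  shows "(\<integral>x. (cmod (twisted_mean f l N x - twisted_mean f l N' x))\<^sup>2 \<partial>M) =
    toeplitz_sum (twisted_corr f l) N / (real N)\<^sup>2 + toeplitz_sum (twisted_corr f l) N' / (real N')\<^sup>2
     - 2 * (\<Sum>i<N. \<Sum>j<N'. twisted_corr f l ((i - j) + (j - i))) / (real N * real N')"
proof -
  define K where "K i j = twisted_corr f l ((i - j) + (j - i))" for i j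
  define ind where "ind i = (if i < N then 1 else 0 :: real)" for i
  \<comment> \<open>Both means are expressed over the longer range \<open>N'\<close>, the shorter
    one cut off by \<open>ind\<close>, so that their difference is one combination with real
    coefficients.\<close>
  define c where "c i = ind i / real N - 1 / real N'" for i
  have i1: "(\<Sum>i<N'. ind i * g i) = (\<Sum>i<N. g i)" for g
    using N by (intro sum.mono_neutral_cong_right) (auto simp: ind_def)
  have i2: "(\<Sum>i<N'. of_real (ind i) * g i) = (\<Sum>i<N. g i)" for g :: "nat \<Rightarrow> complex"
    using N by (intro sum.mono_neutral_cong_right) (auto simp: ind_def)
  have "twisted_mean f l N x - twisted_mean f l N' x = (\<Sum>i<N'. of_real (c i) * l ^ i * f ((T ^^ i) x))" for x
  proof -
    have "(\<Sum>i<N'. of_real (c i) * l ^ i * f ((T ^^ i) x)) =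
      (\<Sum>i<N'. of_real (ind i) * (l ^ i * f ((T ^^ i) x))) / of_nat N - (\<Sum>i<N'. l ^ i * f ((T ^^ i) x)) / of_nat N'"
      unfolding sum_divide_distrib sum_subtractf[symmetric]
      by (intro sum.cong refl) (simp add: c_def left_diff_distrib right_diff_distrib mult_ac)
    then show ?thesis by (simp add: i2 twisted_mean_def)
  qed
  then have "(\<integral>x. (cmod (twisted_mean f l N x - twisted_mean f l N' x))\<^sup>2 \<partial>M)
     = (\<Sum>i<N'. \<Sum>j<N'. c i * c j * K i j)"
    using twisted_corr_form[OF f l, of c N'] by (simp add: K_def)
  also have "\<dots> = (\<Sum>i<N'. ind i * (\<Sum>j<N'. ind j * K i j)) / (real N * real N)
     - (\<Sum>i<N'. ind i * (\<Sum>j<N'. K i j)) / (real N * real N')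
     - (\<Sum>i<N'. \<Sum>j<N'. ind j * K i j) / (real N * real N')
     + (\<Sum>i<N'. \<Sum>j<N'. K i j) / (real N' * real N')"
    by (simp add: c_def algebra_simps sum.distrib sum_subtractf sum_divide_distrib sum_distrib_left)
  also have "\<dots> = (\<Sum>i<N. \<Sum>j<N. K i j) / (real N * real N) - (\<Sum>i<N. \<Sum>j<N'. K i j) / (real N * real N')
     - (\<Sum>i<N'. \<Sum>j<N. K i j) / (real N * real N') + (\<Sum>i<N'. \<Sum>j<N'. K i j) / (real N' * real N')"
    unfolding i1 ..
  also have "(\<Sum>i<N'. \<Sum>j<N. K i j) = (\<Sum>i<N. \<Sum>j<N'. K i j)"
    by (subst sum.swap) (simp add: K_def add.commute)
  finally show ?thesis
    by (simp add: K_def toeplitz_sum_def power2_eq_square)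
qed


lemma twisted_mean_bound:
  assumes B: "\<And>x. x \<in> space M \<Longrightarrow> cmod (f x) \<le> B" "0 \<le> B" and l: "cmod l = 1" and x: "x \<in> space M"
  shows "cmod (twisted_mean f l N x) \<le> B"
proof -
  have "cmod (\<Sum>i<N. l ^ i * f ((T ^^ i) x)) \<le> (\<Sum>i<N. B)"
    using B funpow_in_space[OF x] l
    by (intro order.trans[OF norm_sum] sum_mono) (simp add: norm_mult norm_power)
  then show ?thesis using B(2)
    by (cases "N = 0") (simp_all add: twisted_mean_def norm_divide divide_le_eq mult.commute)
qed

lemma twisted_mean_measurable:
  assumes [measurable]: "f \<in> borel_measurable M"
  shows "twisted_mean f l N \<in> borel_measurable M"
  unfolding twisted_mean_def by measurable

lemma L1_le_L2:
  assumes "bounded_measurable M g"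
  shows "(\<integral>x. cmod (g x) \<partial>M) \<le> sqrt (\<integral>x. (cmod (g x))\<^sup>2 \<partial>M)"
proof -
  obtain B where B: "B \<ge> 0" "\<And>x. x \<in> space M \<Longrightarrow> cmod (g x) \<le> B" using assms by (metis bounded_measurableE)
  have [measurable]: "g \<in> borel_measurable M" using assms by (rule bounded_measurable_borel)
  have "integrable M (\<lambda>x. (cmod (g x))\<^sup>2)"
    by (rule bounded_integrable[where B="B\<^sup>2"]) (use B in \<open>auto intro!: power_mono\<close>)
  moreover have "integrable M (\<lambda>x. cmod (g x))"
    using bounded_measurable_integrable[OF assms] by simp
  ultimately have "variance (\<lambda>x. cmod (g x)) = (\<integral>x. (cmod (g x))\<^sup>2 \<partial>M) - (\<integral>x. cmod (g x) \<partial>M)\<^sup>2"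
    by (intro variance_eq)
  moreover have "0 \<le> variance (\<lambda>x. cmod (g x))" by (rule variance_positive)
  ultimately show ?thesis by (intro real_le_rsqrt) linarith
qed

text \<open>The Riesz-Fischer argument: the sum of the moduli of the increments has a finite
  integral, hence is finite almost everywhere, and the series of increments converges absolutely
  there.\<close>

lemma AE_convergent_if_summable_L1_diff:
  fixes g :: "nat \<Rightarrow> 'a \<Rightarrow> complex"
  assumes g: "\<And>k. bounded_measurable M (g k)"
    and le: "\<And>k. (\<integral>x. cmod (g (Suc k) x - g k x) \<partial>M) \<le> (1/2) ^ k"
  shows "AE x in M. convergent (\<lambda>k. g k x)"
proof -
  have [measurable]: "g k \<in> borel_measurable M" for k using g by (rule bounded_measurable_borel)
  have int: "integrable M (\<lambda>x. cmod (g (Suc k) x - g k x))" for k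
    using g bounded_measurable_integrable by (intro integrable_norm Bochner_Integration.integrable_diff) auto
  have "(\<integral>\<^sup>+ x. (\<Sum>k. ennreal (cmod (g (Suc k) x - g k x))) \<partial>M) = 
     (\<Sum>k. \<integral>\<^sup>+ x. ennreal (cmod (g (Suc k) x - g k x)) \<partial>M)"
    by (rule nn_integral_suminf) measurable
  also have "\<dots> = (\<Sum>k. ennreal (\<integral>x. cmod (g (Suc k) x - g k x) \<partial>M))"
    by (intro suminf_cong nn_integral_eq_integral int) auto
  also have "\<dots> \<le> (\<Sum>k. ennreal ((1/2) ^ k))"
    by (intro suminf_le ennreal_leI le) auto
  also have "\<dots> = ennreal (\<Sum>k. (1/2) ^ k)"
    by (intro suminf_ennreal2) (auto intro: summable_geometric)
  also have "\<dots> < \<infinity>" by simp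
  finally have "(\<integral>\<^sup>+ x. (\<Sum>k. ennreal (cmod (g (Suc k) x - g k x))) \<partial>M) \<noteq> \<infinity>" by simp
  then have "AE x in M. (\<Sum>k. ennreal (cmod (g (Suc k) x - g k x))) \<noteq> \<infinity>"
    by (intro nn_integral_PInf_AE) auto
  then show ?thesis
  proof eventually_elim
    case (elim x)
    then have "summable (\<lambda>k. cmod (g (Suc k) x - g k x))"
      by (intro summable_suminf_not_top) (auto simp: infinity_ennreal_def)
    then have "summable (\<lambda>k. g (Suc k) x - g k x)" by (rule summable_norm_cancel)
    then have "convergent (\<lambda>n. \<Sum>k<n. g (Suc k) x - g k x)" by (simp add: summable_iff_convergent)
    from convergent_add[OF this convergent_const[of "g 0 x"]] show ?case
      using sum_lessThan_telescope[of "\<lambda>k. g k x"] by simp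
  qed
qed

text \<open>The twisted means converge in \<open>L\<^sup>2\<close>, and the limit is zero or an eigenfunction \<open>g\<close> with
  \<open>\<langle>f, g\<rangle> = \<parallel>g\<parallel>\<^sup>2\<close>.\<close>

lemma twisted_mean_tendsto_zero:
  assumes f: "bounded_measurable M f" and l: "cmod l = 1"
    and orth: "\<And>g. g \<in> eigenfunctions M T \<Longrightarrow> (\<integral>x. f x * cnj (g x) \<partial>M) = 0"
  shows "(\<lambda>N. toeplitz_sum (twisted_corr f l) N / (real N)\<^sup>2) \<longlonglongrightarrow> 0"
proof -
  note pd = twisted_corr_positive_definite[OF f l]
  define A where "A = twisted_mean f l"
  obtain B where B: "B \<ge> 0" "\<And>x. x \<in> space M \<Longrightarrow> cmod (f x) \<le> B" using f by (metis bounded_measurableE)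
  have fm[measurable]: "f \<in> borel_measurable M" using f by (rule bounded_measurable_borel)
  have Am[measurable]: "A N \<in> borel_measurable M" for N
    unfolding A_def by (rule twisted_mean_measurable) measurable
  have AB: "cmod (A N x) \<le> B" if "x \<in> space M" for N x
    unfolding A_def using B l that by (intro twisted_mean_bound) auto
  have Abm: "bounded_measurable M (A N)" for N using AB by (intro bounded_measurableI[where B=B]) auto
  have ll: "l * cnj l = 1" using l complex_norm_square[of l] by simp
  have "\<forall>k. \<exists>n0. \<forall>N\<ge>n0. \<forall>N'\<ge>N. (\<integral>x. cmod (A N' x - A N x) \<partial>M) \<le> (1/2) ^ k"
  proof
    fix k
    obtain n0 where n0: "\<forall>N\<ge>n0. \<forall>N'\<ge>N. toeplitz_sum (twisted_corr f l) N / (real N)\<^sup>2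
      + toeplitz_sum (twisted_corr f l) N' / (real N')\<^sup>2
     - 2 * (\<Sum>i<N. \<Sum>j<N'. twisted_corr f l ((i - j) + (j - i))) / (real N * real N') < ((1/2) ^ k)\<^sup>2"
      using pd_means_Cauchy[OF pd, of "((1/2) ^ k)\<^sup>2"] by auto
    show "\<exists>n0. \<forall>N\<ge>n0. \<forall>N'\<ge>N. (\<integral>x. cmod (A N' x - A N x) \<partial>M) \<le> (1/2) ^ k"
    proof (intro exI[of _ "Suc n0"] allI impI)
      fix N N' assume N: "Suc n0 \<le> N" "N \<le> N'"
      have "(\<integral>x. cmod (A N' x - A N x) \<partial>M) = (\<integral>x. cmod (A N x - A N' x) \<partial>M)"
        by (simp add: norm_minus_commute)
      also have "\<dots> \<le> sqrt (\<integral>x. (cmod (A N x - A N' x))\<^sup>2 \<partial>M)"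
      proof (rule L1_le_L2, rule bounded_measurableI[where B="B + B"])
        show "cmod (A N x - A N' x) \<le> B + B" if "x \<in> space M" for x
          using norm_triangle_ineq4 by (rule order.trans) (intro add_mono AB that)
      qed measurable
      also have "(\<integral>x. (cmod (A N x - A N' x))\<^sup>2 \<partial>M) \<le> ((1/2) ^ k)\<^sup>2"
        unfolding A_def using N n0 by (subst twisted_mean_diff_norm2[OF f l]) (auto intro: less_imp_le)
      finally show "(\<integral>x. cmod (A N' x - A N x) \<partial>M) \<le> (1/2) ^ k"
        by (simp add: real_sqrt_le_iff)
    qed
  qed
  then obtain n0 where n0: "\<And>k N N'. n0 k \<le> N \<Longrightarrow> N \<le> N' \<Longrightarrow> (\<integral>x. cmod (A N' x - A N x) \<partial>M) \<le> (1/2) ^ k"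
    by metis
  \<comment> \<open>Strictly increasing with \<open>n0 k \<le> s k\<close>, so that consecutive
    means along \<open>s\<close> differ by at most \<open>(1/2) ^ k\<close> in the L1 norm.\<close>
  define s where "s = rec_nat (n0 0) (\<lambda>k m. max (Suc m) (n0 (Suc k)))"
  have s0: "s 0 = n0 0" and sS: "s (Suc k) = max (Suc (s k)) (n0 (Suc k))" for k by (simp_all add: s_def)
  have sn: "n0 k \<le> s k" for k by (cases k) (auto simp: s0 sS)
  have smono: "strict_mono s" by (rule strict_monoI_Suc) (auto simp: sS)
  have stop: "filterlim s at_top sequentially" by (rule filterlim_subseq[OF smono])
  have conv: "AE x in M. convergent (\<lambda>k. A (s k) x)"
    by (rule AE_convergent_if_summable_L1_diff[OF Abm])
       (use n0 sn smono in \<open>auto simp: sS strict_mono_less_eq\<close>)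
  define g where "g x = lim (\<lambda>k. A (s k) x)" for x
  have gm[measurable]: "g \<in> borel_measurable M" unfolding g_def by (rule borel_measurable_lim_metric) measurable
  have Ag: "AE x in M. (\<lambda>k. A (s k) x) \<longlonglongrightarrow> g x"
    using conv by eventually_elim (simp add: g_def convergent_LIMSEQ_iff)
  have gB: "AE x in M. cmod (g x) \<le> B"
    using Ag AE_space
  proof eventually_elim
    case (elim x)
    then show ?case using AB[of x]
      by (intro LIMSEQ_le_const2[OF tendsto_norm[OF elim(1)]]) auto
  qed
  \<comment> \<open>Passing to \<open>T x\<close> and multiplying by \<open>l\<close> shifts the sum
    by one term, so \<open>l * A N (T x) - A N x\<close> tends to 0. The eigenvalue is
    \<open>cnj l\<close> because this is the inverse of \<open>l\<close>.\<close>
  have geig: "AE x in M. g (T x) = cnj l * g x"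
    using Ag AE_T[OF Ag] AE_space
  proof eventually_elim
    case (elim x)
    have step: "l * A N (T x) - A N x = (l ^ N * f ((T ^^ N) x) - f x) / of_nat N" for N
    proof -
      have "l * (\<Sum>i<N. l ^ i * f ((T ^^ i) (T x))) + f x = (\<Sum>i<Suc N. l ^ i * f ((T ^^ i) x))"
        by (subst sum.lessThan_Suc_shift) (simp add: sum_distrib_left funpow_swap1 mult_ac)
      then have "l * (\<Sum>i<N. l ^ i * f ((T ^^ i) (T x))) - (\<Sum>i<N. l ^ i * f ((T ^^ i) x)) = l ^ N * f ((T ^^ N) x) - f x"
        by (simp add: algebra_simps)
      then show ?thesis by (simp add: A_def twisted_mean_def diff_divide_distrib[symmetric])
    qed
    have "(\<lambda>k. l * A (s k) (T x) - A (s k) x) \<longlonglongrightarrow> l * g (T x) - g x"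
      by (intro tendsto_intros elim)
    moreover have "(\<lambda>k. l * A (s k) (T x) - A (s k) x) \<longlonglongrightarrow> 0"
    proof (rule Lim_null_comparison)
      show "\<forall>\<^sub>F k in sequentially. norm (l * A (s k) (T x) - A (s k) x) \<le> 2 * B / real (s k)"
      proof (intro always_eventually allI)
        fix k
        have "cmod (l ^ s k * f ((T ^^ s k) x) - f x) \<le> cmod (l ^ s k * f ((T ^^ s k) x)) + cmod (f x)"
          by (rule norm_triangle_ineq4)
        also have "\<dots> \<le> B + B"
          using B(2) elim(3) funpow_in_space l by (intro add_mono) (auto simp: norm_mult norm_power)
        finally show "norm (l * A (s k) (T x) - A (s k) x) \<le> 2 * B / real (s k)"
          unfolding step by (simp add: norm_divide divide_right_mono)
      qed
      show "(\<lambda>k. 2 * B / real (s k)) \<longlonglongrightarrow> 0"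
        by (intro tendsto_divide_0[OF tendsto_const] filterlim_compose[OF filterlim_real_sequentially stop, THEN filterlim_at_top_imp_at_infinity])
    qed
    ultimately have "l * g (T x) - g x = 0" by (rule LIMSEQ_unique)
    then have "cnj l * (l * g (T x)) = cnj l * g x" by simp
    then show ?case using ll by (simp add: mult_ac flip: mult.assoc)
  qed
  have orthg: "(\<integral>x. f x * cnj (g x) \<partial>M) = 0"
  proof (cases "AE x in M. g x = 0")
    case True
    then have "(\<integral>x. f x * cnj (g x) \<partial>M) = (\<integral>x. 0 \<partial>M)" by (intro integral_cong_AE) auto
    then show ?thesis by simp
  next
    case False
    have "integrable M (\<lambda>x. (cmod (g x))\<^sup>2)"
      by (rule integrable_const_bound[of _ "B\<^sup>2"]) (use gB in \<open>auto elim!: eventually_mono intro: power_mono\<close>)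
    then have "g \<in> eigenfunctions M T"
      using False geig by (auto simp: eigenfunctions_def L2_def)
    then show ?thesis by (rule orth)
  qed
  have geig_n: "AE x in M. g ((T ^^ n) x) = cnj l ^ n * g x" for n
  proof (induction n)
    case (Suc n)
    from AE_T[OF Suc] geig show ?case
      by eventually_elim (simp add: funpow_swap1 mult_ac)
  qed simp
  \<comment> \<open>By \<open>geig_n\<close> the factor \<open>l ^ i\<close> is absorbed into
    \<open>g\<close> at \<open>(T ^^ i) x\<close>; invariance of the measure then reduces every term
    to the inner product of \<open>f\<close> and \<open>g\<close>.\<close>
  have zero: "(\<integral>x. A N x * cnj (g x) \<partial>M) = 0" for N
  proof -
    have "(\<integral>x. l ^ i * f ((T ^^ i) x) * cnj (g x) \<partial>M) = 0" for i
    proof -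
      have "(\<integral>x. l ^ i * f ((T ^^ i) x) * cnj (g x) \<partial>M) = (\<integral>x. f ((T ^^ i) x) * cnj (g ((T ^^ i) x)) \<partial>M)"
        by (intro integral_cong_AE) (use geig_n[of i] in \<open>auto elim!: eventually_mono\<close>)
      also have "\<dots> = (\<integral>x. f x * cnj (g x) \<partial>M)"
        by (rule integral_funpow[where f="\<lambda>x. f x * cnj (g x)"]) measurable
      finally show ?thesis using orthg by simp
    qed
    moreover have "integrable M (\<lambda>x. l ^ i * f ((T ^^ i) x) * cnj (g x))" for i
    proof (rule integrable_const_bound[of _ "B * B"])
      show "AE x in M. cmod (l ^ i * f ((T ^^ i) x) * cnj (g x)) \<le> B * B"
        using gB AE_space by eventually_elim 
          (auto simp: norm_mult norm_power l intro!: mult_mono B funpow_in_space)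
    qed measurable
    ultimately show ?thesis
      by (simp add: A_def twisted_mean_def sum_divide_distrib sum_distrib_right)
  qed
  have "(\<lambda>k. \<integral>x. A (s k) x * cnj (g x) \<partial>M) \<longlonglongrightarrow> (\<integral>x. g x * cnj (g x) \<partial>M)"
  proof (rule integral_dominated_convergence[where w="\<lambda>_. B * B"])
    show "AE x in M. (\<lambda>k. A (s k) x * cnj (g x)) \<longlonglongrightarrow> g x * cnj (g x)"
      using Ag by eventually_elim (intro tendsto_intros)
    show "AE x in M. norm (A (s k) x * cnj (g x)) \<le> B * B" for k
      using gB AE_space by eventually_elim (auto simp: norm_mult intro!: mult_mono AB B)
  qed auto
  then have g0: "(\<integral>x. g x * cnj (g x) \<partial>M) = 0" using zero by (simp add: LIMSEQ_const_iff)
  have "(\<lambda>k. \<integral>x. (cmod (A (s k) x))\<^sup>2 \<partial>M) \<longlonglongrightarrow> (\<integral>x. (cmod (g x))\<^sup>2 \<partial>M)"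
  proof (rule integral_dominated_convergence[where w="\<lambda>_. B\<^sup>2"])
    show "AE x in M. (\<lambda>k. (cmod (A (s k) x))\<^sup>2) \<longlonglongrightarrow> (cmod (g x))\<^sup>2"
      using Ag by eventually_elim (intro tendsto_intros)
    show "AE x in M. norm ((cmod (A (s k) x))\<^sup>2) \<le> B\<^sup>2" for k
      using AE_space by eventually_elim (auto intro!: power_mono AB)
  qed auto
  moreover have "complex_of_real (\<integral>x. (cmod (g x))\<^sup>2 \<partial>M) = 0"
    unfolding integral_complex_of_real[symmetric] complex_norm_square by (rule g0)
  ultimately have "(\<lambda>k. toeplitz_sum (twisted_corr f l) (s k) / (real (s k))\<^sup>2) \<longlonglongrightarrow> 0"
    by (simp add: A_def twisted_mean_norm2[OF f l])
  \<comment> \<open>The subsequence decides the limit because the full sequence is known to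
    converge.\<close>
  moreover obtain L where L: "(\<lambda>N. toeplitz_sum (twisted_corr f l) N / (real N)\<^sup>2) \<longlonglongrightarrow> L"
    by (rule toeplitz_mean_convergent[OF pd])
  from LIMSEQ_subseq_LIMSEQ[OF this smono]
  have "(\<lambda>k. toeplitz_sum (twisted_corr f l) (s k) / (real (s k))\<^sup>2) \<longlonglongrightarrow> L" by (simp add: comp_def)
  ultimately have "L = 0" by (rule LIMSEQ_unique[rotated])
  with L show ?thesis by simp
qed


text \<open>Dini's argument on the unit circle: each \<open>q N\<close> is continuous, and a value
  that is small at one length stays small at all much larger lengths by
  \<open>toeplitz_mean_almost_antimono\<close>. The error contains only
  \<open>twisted_corr f l 0\<close>, which is the same for all \<open>l\<close>, so finitely many
  lengths serve all rotations.\<close>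

lemma twisted_corr_mean_uniform:
  assumes f: "bounded_measurable M f"
    and orth: "\<And>g. g \<in> eigenfunctions M T \<Longrightarrow> (\<integral>x. f x * cnj (g x) \<partial>M) = 0"
    and e: "\<epsilon> > 0"
  shows "\<exists>n0. \<forall>N\<ge>n0. \<forall>l. cmod l = 1 \<longrightarrow> toeplitz_sum (twisted_corr f l) N / (real N)\<^sup>2 \<le> \<epsilon>"
proof -
  define q where "q N l = toeplitz_sum (twisted_corr f l) N / (real N)\<^sup>2" for N l
  have cont: "continuous_on UNIV (q N)" for N
    unfolding q_def toeplitz_sum_def twisted_corr_def divide_inverse
    by (intro continuous_on_sum continuous_on_mult continuous_on_const continuous_on_Re continuous_on_power continuous_on_cnj continuous_on_id)
  have "\<exists>N>0. q N l < \<epsilon> / 2" if l: "cmod l = 1" for l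
  proof -
    obtain n0 where n0: "\<forall>N\<ge>n0. norm (q N l - 0) < \<epsilon> / 2"
      using LIMSEQ_D[OF twisted_mean_tendsto_zero[OF f l orth], of "\<epsilon>/2"] e unfolding q_def by auto
    from n0[rule_format, of "Suc n0"] show ?thesis by (intro exI[of _ "Suc n0"]) auto
  qed
  then obtain n where n: "\<And>l. cmod l = 1 \<Longrightarrow> n l > 0 \<and> q (n l) l < \<epsilon> / 2" by metis
  define U where "U l = q (n l) -` {..<\<epsilon>/2}" for l
  have "compact (sphere (0::complex) 1)" by simp
  moreover have "open (U l)" for l
    unfolding U_def using cont[of "n l"] by (intro open_vimage) auto
  moreover have "sphere (0::complex) 1 \<subseteq> (\<Union>l\<in>sphere 0 1. U l)"
    using n by (auto simp: U_def)
  ultimately obtain C where C: "C \<subseteq> sphere 0 1" "finite C" "sphere (0::complex) 1 \<subseteq> (\<Union>l\<in>C. U l)"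
    by (metis compactE_image)
  define m where "m = Max (n ` C)"
  have m: "n l \<le> m" if "l \<in> C" for l using C that by (simp add: m_def)
  define R where "R = Re (corr f 0 0)"
  have R: "twisted_corr f l 0 = R" for l by (simp add: twisted_corr_def R_def)
  have R0: "0 \<le> R" using pd_zero_nonneg[OF twisted_corr_positive_definite[OF f, of 1]] by (simp add: R)
  obtain n1 :: nat where n1: "2 * real m * R / (\<epsilon>/2) < real n1" using reals_Archimedean2 by blast
  show ?thesis
  proof (intro exI[of _ "Suc n1"] allI impI)
    fix N l assume N: "Suc n1 \<le> N" and l: "cmod l = 1"
    obtain l' where l': "l' \<in> C" "l \<in> U l'" using C l by force
    have "q N l \<le> q (n l') l + 2 * real (n l') * R / real N"
      using toeplitz_mean_almost_antimono[OF twisted_corr_positive_definite[OF f l], of "n l'" N] n[of l'] l' C N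
      by (auto simp: q_def R subset_iff)
    also have "q (n l') l \<le> \<epsilon>/2" using l' by (simp add: U_def)
    also have "2 * real (n l') * R / real N \<le> 2 * real m * R / real N"
      using m[OF l'(1)] R0 by (intro divide_right_mono mult_right_mono) auto
    also have "\<dots> \<le> \<epsilon>/2"
    proof -
      have "2 * real m * R < \<epsilon>/2 * real n1" using n1 e by (simp add: field_simps)
      also have "\<dots> \<le> \<epsilon>/2 * real N" using N e by (intro mult_left_mono) auto
      finally show ?thesis using N by (simp add: divide_le_eq)
    qed
    finally show "toeplitz_sum (twisted_corr f l) N / (real N)\<^sup>2 \<le> \<epsilon>" by (simp add: q_def)
  qed
qed

text \<open>As a function of \<open>l\<close>, the Toeplitz sum is a trigonometric polynomial with
  coefficients \<open>real (N - d) * corr f 0 d\<close> and their conjugates. Parseval expresses the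
  sum of their squared moduli as the mean of the squared polynomial; of the two factors one is
  bounded by \<open>\<delta>\<close>, and the mean of the other is its constant coefficient
  \<open>real N * Re (corr f 0 0)\<close>.\<close>

lemma corr_fejer_parseval:
  assumes f: "bounded_measurable M f"
    and d: "\<And>l. cmod l = 1 \<Longrightarrow> toeplitz_sum (twisted_corr f l) N \<le> \<delta>"
  shows "(\<Sum>d<N. (real (N - d))\<^sup>2 * (cmod (corr f 0 d))\<^sup>2) \<le> \<delta> * real N * Re (corr f 0 0)"
proof (cases "N = 0")
  case False
  define w where "w = cis (2 * pi / real (2 * N))"
  have w: "cmod (w ^ j) = 1" for j by (simp add: w_def norm_power)
  have ww: "w ^ j * cnj (w ^ j) = 1" for j using w[of j] complex_norm_square[of "w ^ j"] by simp
  define F where "F j = toeplitz_sum (twisted_corr f (w ^ j)) N" for j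
  have Fpos: "F j \<ge> 0" for j
    unfolding F_def by (rule toeplitz_sum_nonneg[OF twisted_corr_positive_definite[OF f w]])
  have F: "complex_of_real (F j) = (\<Sum>i<N. \<Sum>k<N. (w ^ j) ^ i * cnj ((w ^ j) ^ k) * corr f i k)" for j
    using twisted_corr_form[OF f w[of j], of "\<lambda>_. 1" N] corr_form[OF f, of "\<lambda>i. (w ^ j) ^ i" N]
    by (simp add: F_def toeplitz_sum_def)
  have "complex_of_real (\<Sum>j<2*N. F j) = (\<Sum>i<N. \<Sum>k<N. \<Sum>j<2*N. (w ^ j) ^ i * cnj ((w ^ j) ^ k) * corr f i k)"
    unfolding of_real_sum F
    by (subst sum.swap, rule sum.cong[OF refl], rule sum.swap)
  also have "\<dots> = (\<Sum>i<N. \<Sum>k<N. (if i = k then of_nat (2 * N) else 0) * corr f i k)"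
    using sum_roots_of_unity_orthogonal[of _ "2*N"]
    by (intro sum.cong refl) (simp only: sum_distrib_right[symmetric] w_def lessThan_iff)
  also have "\<dots> = (\<Sum>i<N. of_nat (2 * N) * corr f 0 0)"
  proof (intro sum.cong refl)
    fix i assume "i \<in> {..<N}"
    then have "(\<Sum>k<N. (if i = k then of_nat (2 * N) else 0) * corr f i k) = (\<Sum>k\<in>{i}. of_nat (2 * N) * corr f i k)"
      by (intro sum.mono_neutral_cong_right) auto
    then show "(\<Sum>k<N. (if i = k then of_nat (2 * N) else 0) * corr f i k) = of_nat (2 * N) * corr f 0 0"
      using corr_reduce[OF f, of i i] by simp
  qed
  also have "\<dots> = of_nat (2 * N) * of_nat N * corr f 0 0" by simp
  finally have "Re (complex_of_real (\<Sum>j<2*N. F j)) = Re (of_nat (2 * N) * of_nat N * corr f 0 0)" by (rule arg_cong)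
  then have sumF: "(\<Sum>j<2*N. F j) = 2 * real N * real N * Re (corr f 0 0)" by simp
  \<comment> \<open>Multiplication by the \<open>N\<close>-th power of the frequency moves the
    differences \<open>i - k\<close>, which lie strictly between \<open>- N\<close> and
    \<open>N\<close>, to exponents below \<open>2 * N\<close>, where Parseval applies.
    \<open>P e\<close> collects the pairs with exponent \<open>e\<close>.\<close>
  define P where "P e = {p \<in> {..<N} \<times> {..<N}. N + fst p - snd p = e}" for e :: nat
  define D where "D e = (\<Sum>p\<in>P e. corr f (fst p) (snd p))" for e
  have FD: "F j = cmod (\<Sum>e<2*N. D e * (w ^ j) ^ e)" for j
  proof -
    have pointwise: "(w ^ j) ^ N * ((w ^ j) ^ i * cnj ((w ^ j) ^ k) * corr f i k) = corr f i k * (w ^ j) ^ (N + i - k)"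
      if "k < N" for i k
    proof -
      have "(w ^ j) ^ (N + i) = (w ^ j) ^ (N + i - k) * (w ^ j) ^ k"
        using that by (subst power_add[symmetric]) simp
      then have e: "(w ^ j) ^ N * (w ^ j) ^ i = (w ^ j) ^ (N + i - k) * (w ^ j) ^ k" by (simp only: power_add)
      have c: "(w ^ j) ^ k * cnj ((w ^ j) ^ k) = 1"
        using ww[of j] by (metis complex_cnj_power power_mult_distrib power_one)
      have "(w ^ j) ^ N * ((w ^ j) ^ i * cnj ((w ^ j) ^ k) * corr f i k) =
          ((w ^ j) ^ N * (w ^ j) ^ i) * cnj ((w ^ j) ^ k) * corr f i k" by (simp only: mult.assoc)
      also have "\<dots> = (w ^ j) ^ (N + i - k) * ((w ^ j) ^ k * cnj ((w ^ j) ^ k)) * corr f i k"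
        unfolding e by (simp only: mult.assoc)
      also have "\<dots> = corr f i k * (w ^ j) ^ (N + i - k)"
        unfolding c by (simp only: mult_1_left mult_1_right mult.commute)
      finally show ?thesis .
    qed
    have "(w ^ j) ^ N * complex_of_real (F j) = (\<Sum>i<N. \<Sum>k<N. corr f i k * (w ^ j) ^ (N + i - k))"
      unfolding F sum_distrib_left by (intro sum.cong refl pointwise) simp
    also have "\<dots> = (\<Sum>p\<in>{..<N}\<times>{..<N}. corr f (fst p) (snd p) * (w ^ j) ^ (N + fst p - snd p))"
      by (simp add: sum.cartesian_product case_prod_beta)
    also have "\<dots> = (\<Sum>e<2*N. \<Sum>p\<in>P e. corr f (fst p) (snd p) * (w ^ j) ^ (N + fst p - snd p))"
      unfolding P_def by (rule sum.group[symmetric]) auto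
    also have "\<dots> = (\<Sum>e<2*N. D e * (w ^ j) ^ e)"
      unfolding D_def sum_distrib_right by (intro sum.cong refl) (auto simp: P_def)
    finally have "cmod ((w ^ j) ^ N * complex_of_real (F j)) = cmod (\<Sum>e<2*N. D e * (w ^ j) ^ e)" by (rule arg_cong)
    then show ?thesis using Fpos w by (simp add: norm_mult norm_power)
  qed
  have Dd: "D (N + d) = of_nat (N - d) * cnj (corr f 0 d)" if "d < N" for d
  proof -
    have "P (N + d) = (\<lambda>k. (k + d, k)) ` {..<N - d}"
      using that by (force simp: P_def image_iff)
    then have "D (N + d) = (\<Sum>k<N-d. corr f (k + d) k)"
      unfolding D_def by (subst sum.reindex[symmetric, unfolded comp_def]) (auto simp: inj_on_def sum.reindex)
    also have "\<dots> = (\<Sum>k<N-d. cnj (corr f 0 d))"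
    proof (intro sum.cong refl)
      fix k
      show "corr f (k + d) k = cnj (corr f 0 d)"
        using corr_cnj[of f k "k + d"] corr_reduce[OF f, of k "k + d"] by simp
    qed
    finally show ?thesis by simp
  qed
  have norm_D: "cmod (D (N + d)) = real (N - d) * cmod (corr f 0 d)" if "d < N" for d
    by (simp only: Dd[OF that] norm_mult norm_of_nat complex_mod_cnj)
  have "2 * real N * (\<Sum>d<N. (real (N - d))\<^sup>2 * (cmod (corr f 0 d))\<^sup>2) = 2 * real N * (\<Sum>d<N. (cmod (D (N + d)))\<^sup>2)"
    by (simp add: norm_D power_mult_distrib)
  also have "(\<Sum>d<N. (cmod (D (N + d)))\<^sup>2) = (\<Sum>e\<in>{0+N..<N+N}. (cmod (D e))\<^sup>2)"
    unfolding sum.shift_bounds_nat_ivl by (simp add: atLeast0LessThan add.commute)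
  \<comment> \<open>The added indices \<open>e < N\<close> belong to the negative
    differences.\<close>
  also have "\<dots> \<le> (\<Sum>e<2*N. (cmod (D e))\<^sup>2)" by (intro sum_mono2) auto
  also have "2 * real N * (\<Sum>e<2*N. (cmod (D e))\<^sup>2) = (\<Sum>j<2*N. (F j)\<^sup>2)"
    unfolding FD w_def using parseval_roots_of_unity[of D "2*N"] by simp
  also have "\<dots> \<le> (\<Sum>j<2*N. \<delta> * F j)"
    unfolding power2_eq_square by (intro sum_mono mult_right_mono Fpos) (auto simp: F_def intro: d w)
  also have "\<dots> = 2 * real N * (\<delta> * real N * Re (corr f 0 0))"
    unfolding sum_distrib_left[symmetric] sumF by simp
  finally show ?thesis using False by (simp add: mult_left_mono)
qed auto

lemma corr_norm_mean_tendsto_zero: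
  assumes f: "bounded_measurable M f"
    and orth: "\<And>g. g \<in> eigenfunctions M T \<Longrightarrow> (\<integral>x. f x * cnj (g x) \<partial>M) = 0"
  shows "(\<lambda>H. (\<Sum>h<H. (cmod (corr f 0 h))\<^sup>2) / real H) \<longlonglongrightarrow> 0"
proof (rule LIMSEQ_I)
  fix \<epsilon> :: real assume e: "\<epsilon> > 0"
  define R where "R = Re (corr f 0 0)"
  have R0: "0 \<le> R"
    using pd_zero_nonneg[OF twisted_corr_positive_definite[OF f, of 1]] by (simp add: R_def twisted_corr_def)
  define R' where "R' = R + 1"
  have R': "R' > 0" "R \<le> R'" using R0 by (simp_all add: R'_def)
  define \<delta> where "\<delta> = \<epsilon> / (16 * R')"
  have \<delta>: "\<delta> > 0" using e R' by (simp add: \<delta>_def)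
  obtain n0 where n0: "\<And>N l. N \<ge> n0 \<Longrightarrow> cmod l = 1 \<Longrightarrow> toeplitz_sum (twisted_corr f l) N / (real N)\<^sup>2 \<le> \<delta>"
    using twisted_corr_mean_uniform[OF f orth \<delta>] by auto
  show "\<exists>no. \<forall>n\<ge>no. norm ((\<Sum>h<n. (cmod (corr f 0 h))\<^sup>2) / real n - 0) < \<epsilon>"
  proof (intro exI[of _ "Suc n0"] allI impI)
    fix H assume H: "Suc n0 \<le> H"
    define S where "S = (\<Sum>h<H. (cmod (corr f 0 h))\<^sup>2)"
    have "(real H)\<^sup>2 * S = (\<Sum>d<H. (real H)\<^sup>2 * (cmod (corr f 0 d))\<^sup>2)" by (simp add: S_def sum_distrib_left)
    \<comment> \<open>The Fejer weights are taken for length \<open>2 * H\<close>: there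
      \<open>2 * H - d\<close> is at least \<open>H\<close> for all \<open>d < H\<close>, which
      removes the weights at the cost of a constant factor.\<close>
    also have "\<dots> \<le> (\<Sum>d<H. (real (2 * H - d))\<^sup>2 * (cmod (corr f 0 d))\<^sup>2)"
      by (intro sum_mono mult_right_mono power_mono) auto
    also have "\<dots> \<le> (\<Sum>d<2*H. (real (2 * H - d))\<^sup>2 * (cmod (corr f 0 d))\<^sup>2)"
      by (intro sum_mono2) auto
    also have "\<dots> \<le> (\<delta> * (real (2 * H))\<^sup>2) * real (2 * H) * R"
      unfolding R_def
    proof (rule corr_fejer_parseval[OF f])
      fix l :: complex assume "cmod l = 1"
      from n0[OF _ this, of "2*H"] show "toeplitz_sum (twisted_corr f l) (2 * H) \<le> \<delta> * (real (2 * H))\<^sup>2"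
        using H by (simp add: divide_le_eq)
    qed
    also have "\<dots> = (real H)\<^sup>2 * (8 * \<delta> * R * real H)" by (simp add: power2_eq_square)
    finally have "S \<le> 8 * \<delta> * R * real H" using H by (simp add: mult_le_cancel_left)
    also have "\<dots> \<le> 8 * \<delta> * R' * real H" using \<delta> R' by (intro mult_right_mono mult_left_mono) auto
    also have "\<dots> = \<epsilon> / 2 * real H" using R' by (simp add: \<delta>_def)
    finally have "S / real H \<le> \<epsilon> / 2" using H by (simp add: divide_le_eq)
    moreover have "0 \<le> S / real H" by (simp add: S_def sum_nonneg)
    ultimately have "norm (S / real H - 0) < \<epsilon>"
      using e by (simp only: real_norm_def diff_zero abs_of_nonneg)
    then show "norm ((\<Sum>h<H. (cmod (corr f 0 h))\<^sup>2) / real H - 0) < \<epsilon>"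
      by (simp only: S_def)
  qed
qed

end

section \<open>Exponential sums and cube averages\<close>

text \<open>The quantifier over \<open>z\<close> stands inside the eventuality because the trilinear
  bounds choose \<open>z\<close> depending on \<open>N\<close>.\<close>

definition uniform_exp_bound :: "(nat \<Rightarrow> complex) \<Rightarrow> real \<Rightarrow> bool" where
  "uniform_exp_bound u \<delta> \<longleftrightarrow> (\<forall>\<epsilon>>0. \<forall>\<^sub>F N in sequentially.
     \<forall>z. cmod z = 1 \<longrightarrow> cmod (\<Sum>n<N. u n * z ^ n) \<le> (\<delta> + \<epsilon>) * real N)"

lemma correlation_truncated:
  fixes v :: "nat \<Rightarrow> complex"
  assumes B: "\<And>n. cmod (v n) \<le> C" and lim: "(\<lambda>N. (\<Sum>n<N. v n) / of_nat N) \<longlonglongrightarrow> r"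
  shows "(\<lambda>N. cmod (\<Sum>n<N - d. v n) / real N) \<longlonglongrightarrow> cmod r"
proof -
  have C0: "0 \<le> C" using B[of 0] norm_ge_zero order.trans by blast
  have "(\<lambda>N. (\<Sum>n<N - d. v n) / of_nat N - (\<Sum>n<N. v n) / of_nat N) \<longlonglongrightarrow> 0"
  proof (rule Lim_null_comparison)
    show "\<forall>\<^sub>F N in sequentially. norm ((\<Sum>n<N - d. v n) / of_nat N - (\<Sum>n<N. v n) / of_nat N) \<le> real d * C / real N"
    proof (intro always_eventually allI)
      fix N
      have "(\<Sum>n<N. v n) = (\<Sum>n<N - d. v n) + (\<Sum>n=N-d..<N. v n)"
        using sum.atLeastLessThan_concat[of 0 "N - d" N v] by (simp add: atLeast0LessThan)
      then have "cmod ((\<Sum>n<N - d. v n) - (\<Sum>n<N. v n)) = cmod (\<Sum>n=N-d..<N. v n)" by simp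
      also have "\<dots> \<le> (\<Sum>n=N-d..<N. C)" by (intro order.trans[OF norm_sum] sum_mono B)
      also have "\<dots> \<le> real d * C" using C0 by (simp add: mult_right_mono)
      finally show "norm ((\<Sum>n<N - d. v n) / of_nat N - (\<Sum>n<N. v n) / of_nat N) \<le> real d * C / real N"
        by (simp add: norm_divide divide_right_mono flip: diff_divide_distrib)
    qed
    show "(\<lambda>N. real d * C / real N) \<longlonglongrightarrow> 0" by (rule lim_const_over_n)
  qed
  from tendsto_add[OF this lim] have "(\<lambda>N. (\<Sum>n<N - d. v n) / of_nat N) \<longlonglongrightarrow> r" by simp
  from tendsto_norm[OF this] show ?thesis by (simp add: norm_divide)
qed

text \<open>For large \<open>N\<close> van der Corput's inequality bounds the squared normalized sum
  by about twice the mean of \<open>cmod (\<rho> h)\<close> over \<open>h < H\<close>, hence by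
  twice the quadratic mean, which is close to \<open>2 * sqrt R\<close> for large \<open>H\<close>.
  The number \<open>H\<close> is fixed before \<open>N\<close> grows.\<close>

lemma uniform_exp_bound_of_correlations:
  assumes B: "\<And>n. cmod (u n) \<le> B"
    and \<rho>: "\<And>h. (\<lambda>N. (\<Sum>n<N. u n * cnj (u (n + h))) / of_nat N) \<longlonglongrightarrow> \<rho> h"
    and R: "(\<lambda>H. (\<Sum>h<H. (cmod (\<rho> h))\<^sup>2) / real H) \<longlonglongrightarrow> R"
  shows "uniform_exp_bound u (sqrt (2 * sqrt R))"
  unfolding uniform_exp_bound_def
proof (intro allI impI)
  fix \<epsilon> :: real assume e: "\<epsilon> > 0"
  define \<delta> where "\<delta> = sqrt (2 * sqrt R)"
  have R0: "0 \<le> R" by (rule LIMSEQ_le_const[OF R]) (auto intro!: divide_nonneg_nonneg sum_nonneg)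
  have \<delta>: "0 \<le> \<delta>" "\<delta>\<^sup>2 = 2 * sqrt R" using R0 by (simp_all add: \<delta>_def)
  have "2 * sqrt R < (\<delta> + \<epsilon>)\<^sup>2"
    using e \<delta> by (auto simp: power2_sum intro!: add_pos_nonneg)
  moreover have "(\<lambda>H. 2 * sqrt ((\<Sum>h<H. (cmod (\<rho> h))\<^sup>2) / real H)) \<longlonglongrightarrow> 2 * sqrt R"
    by (intro tendsto_intros R)
  ultimately have "\<forall>\<^sub>F H in sequentially. 2 * sqrt ((\<Sum>h<H. (cmod (\<rho> h))\<^sup>2) / real H) < (\<delta> + \<epsilon>)\<^sup>2"
    by (intro order_tendstoD)
  then have "\<forall>\<^sub>F H in sequentially. 2 * sqrt ((\<Sum>h<H. (cmod (\<rho> h))\<^sup>2) / real H) < (\<delta> + \<epsilon>)\<^sup>2 \<and> H > 0"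
    using eventually_gt_at_top by (rule eventually_conj)
  then obtain H where H: "2 * sqrt ((\<Sum>h<H. (cmod (\<rho> h))\<^sup>2) / real H) < (\<delta> + \<epsilon>)\<^sup>2" "H > 0"
    by (auto dest: eventually_happens)
  have "(\<Sum>h<H. cmod (\<rho> h)) \<le> sqrt (real H) * sqrt (\<Sum>h<H. (cmod (\<rho> h))\<^sup>2)"
    using sum_mult_le_sqrt[of "\<lambda>_. 1" "\<lambda>h. cmod (\<rho> h)" "{..<H}"] by simp
  also have "\<dots> = real H * sqrt ((\<Sum>h<H. (cmod (\<rho> h))\<^sup>2) / real H)"
  proof -
    have "real H / sqrt (real H) = sqrt (real H)" by (rule real_div_sqrt) simp
    then show ?thesis by (simp add: real_sqrt_divide) (metis times_divide_eq_left)
  qed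
  finally have "(\<Sum>h<H. cmod (\<rho> h)) / real H \<le> sqrt ((\<Sum>h<H. (cmod (\<rho> h))\<^sup>2) / real H)"
    using H(2) by (simp add: divide_le_eq mult.commute)
  then have "2 * ((\<Sum>h<H. cmod (\<rho> h)) / real H) < (\<delta> + \<epsilon>)\<^sup>2" using H(1) by linarith
  then have H': "2 / real H * (\<Sum>h<H. cmod (\<rho> h)) < (\<delta> + \<epsilon>)\<^sup>2" by simp
  \<comment> \<open>The right-hand side of van der Corput's inequality, divided by the square of
    \<open>N\<close>.\<close>
  define X where "X N = 2 * (1 + real H / real N) / real H *
      (\<Sum>d<H. cmod (\<Sum>n<N - d. u n * cnj (u (n + d))) / real N)" for N
  have "(\<lambda>N. cmod (\<Sum>n<N - d. u n * cnj (u (n + d))) / real N) \<longlonglongrightarrow> cmod (\<rho> d)" for d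
  proof (rule correlation_truncated[OF _ \<rho>])
    show "cmod (u n * cnj (u (n + d))) \<le> B * B" for n
      using B[of n] B[of "n + d"] order.trans[OF norm_ge_zero B[of 0]] by (auto simp: norm_mult intro: mult_mono)
  qed
  then have "X \<longlonglongrightarrow> 2 * (1 + 0) / real H * (\<Sum>h<H. cmod (\<rho> h))"
    unfolding X_def using H(2) by (intro tendsto_intros lim_const_over_n) auto
  then have "\<forall>\<^sub>F N in sequentially. X N < (\<delta> + \<epsilon>)\<^sup>2"
    using H' by (intro order_tendstoD(2)) auto
  then show "\<forall>\<^sub>F N in sequentially. \<forall>z. cmod z = 1 \<longrightarrow>
      cmod (\<Sum>n<N. u n * z ^ n) \<le> (sqrt (2 * sqrt R) + \<epsilon>) * real N"
    using eventually_gt_at_top[of 0]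
  proof eventually_elim
    case (elim N)
    show ?case
    proof (intro allI impI)
      fix z :: complex assume z: "cmod z = 1"
      have "(cmod (\<Sum>n<N. u n * z ^ n))\<^sup>2 \<le> 2 * real (N + H) / real H * (\<Sum>d<H. cmod (\<Sum>n<N - d. u n * cnj (u (n + d))))"
        by (rule van_der_corput[OF H(2) z])
      also have "\<dots> = X N * (real N)\<^sup>2"
        using elim H(2) by (simp add: X_def sum_divide_distrib[symmetric] power2_eq_square field_simps)
      also have "\<dots> \<le> (\<delta> + \<epsilon>)\<^sup>2 * (real N)\<^sup>2" using elim by (intro mult_right_mono) auto
      finally have "(cmod (\<Sum>n<N. u n * z ^ n))\<^sup>2 \<le> ((\<delta> + \<epsilon>) * real N)\<^sup>2" by (simp add: power_mult_distrib)
      then show "cmod (\<Sum>n<N. u n * z ^ n) \<le> (sqrt (2 * sqrt R) + \<epsilon>) * real N"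
        unfolding \<delta>_def[symmetric]
        by (rule power2_le_imp_le) (intro mult_nonneg_nonneg add_nonneg_nonneg \<delta>(1) less_imp_le[OF e] of_nat_0_le_iff)
    qed
  qed
qed

text \<open>The threshold for \<open>N\<close> is independent of \<open>a\<close> and
  \<open>b\<close>, since they will carry phases that change with \<open>N\<close>. The constant 4
  is the 2 of \<open>trilinear_bound_right\<close> times the 2 in the length \<open>2 * N\<close> of
  the exponential sum.\<close>

lemma trilinear_eventually_right:
  assumes u: "uniform_exp_bound u \<delta>" and e: "\<epsilon> > 0" and B: "B \<ge> 0"
  shows "\<forall>\<^sub>F N in sequentially. \<forall>a b. (\<forall>n. cmod (a n) \<le> B) \<longrightarrow> (\<forall>n. cmod (b n) \<le> B) \<longrightarrow>
    cmod (\<Sum>n<N. \<Sum>m<N. a n * b m * u (n + m)) \<le> 4 * B\<^sup>2 * (\<delta> + \<epsilon>) * (real N)\<^sup>2"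
proof -
  have "filterlim (\<lambda>N::nat. 2 * N) at_top sequentially"
    by (intro filterlim_subseq strict_monoI) simp
  from eventually_compose_filterlim[OF u[unfolded uniform_exp_bound_def, rule_format, OF e] this]
  show ?thesis
  proof eventually_elim
    case (elim N)
    show ?case
    proof (intro allI impI)
      fix a b :: "nat \<Rightarrow> complex" assume ab: "\<forall>n. cmod (a n) \<le> B" "\<forall>n. cmod (b n) \<le> B"
      obtain z where z: "cmod z = 1" "cmod (\<Sum>n<N. \<Sum>m<N. a n * b m * u (n + m)) \<le>
          2 * B\<^sup>2 * real N * cmod (\<Sum>n<2*N. u n * z ^ n)"
        using trilinear_bound_right[of B N a b u] B ab by auto
      note z(2)
      also have "2 * B\<^sup>2 * real N * cmod (\<Sum>n<2*N. u n * z ^ n) \<le> 2 * B\<^sup>2 * real N * ((\<delta> + \<epsilon>) * real (2 * N))"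
        using elim z(1) by (intro mult_left_mono) auto
      also have "\<dots> = 4 * B\<^sup>2 * (\<delta> + \<epsilon>) * (real N)\<^sup>2" by (simp add: power2_eq_square)
      finally show "cmod (\<Sum>n<N. \<Sum>m<N. a n * b m * u (n + m)) \<le> 4 * B\<^sup>2 * (\<delta> + \<epsilon>) * (real N)\<^sup>2" .
    qed
  qed
qed

text \<open>The truncation at \<open>N - k\<close> is the one that van der Corput's inequality
  leaves at lag \<open>k\<close>. Bounding the length \<open>N - k\<close> generously by
  \<open>2 * N\<close> gives the same constant as in
  \<open>trilinear_eventually_right\<close>.\<close>

lemma trilinear_eventually_left:
  assumes u: "uniform_exp_bound u \<delta>" and e: "\<epsilon> > 0" and B: "B \<ge> 0" and d: "\<delta> \<ge> 0"
  shows "\<forall>\<^sub>F N in sequentially. \<forall>a b. (\<forall>n. cmod (a n) \<le> B) \<longrightarrow> (\<forall>n. cmod (b n) \<le> B) \<longrightarrow>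
    cmod (\<Sum>n<N - k. \<Sum>m<N. u n * a m * b (n + m)) \<le> 4 * B\<^sup>2 * (\<delta> + \<epsilon>) * (real N)\<^sup>2"
proof -
  have "filterlim (\<lambda>N::nat. N - k) at_top sequentially" by (rule filterlim_minus_const_nat_at_top)
  from eventually_compose_filterlim[OF u[unfolded uniform_exp_bound_def, rule_format, OF e] this]
  show ?thesis
  proof eventually_elim
    case (elim N)
    show ?case
    proof (intro allI impI)
      fix a b :: "nat \<Rightarrow> complex" assume ab: "\<forall>n. cmod (a n) \<le> B" "\<forall>n. cmod (b n) \<le> B"
      define v where "v n = (if n < N - k then u n else 0)" for n
      obtain z where z: "cmod z = 1" "cmod (\<Sum>n<N. \<Sum>m<N. v n * a m * b (n + m)) \<le>
          2 * B\<^sup>2 * real N * cmod (\<Sum>n<N. v n * z ^ n)"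
        using trilinear_bound_left[of B N a b v] B ab by auto
      have "(\<Sum>n<N - k. \<Sum>m<N. u n * a m * b (n + m)) = (\<Sum>n<N. \<Sum>m<N. v n * a m * b (n + m))"
        by (intro sum.mono_neutral_cong_left) (auto simp: v_def)
      then have "cmod (\<Sum>n<N - k. \<Sum>m<N. u n * a m * b (n + m)) \<le> 2 * B\<^sup>2 * real N * cmod (\<Sum>n<N. v n * z ^ n)"
        using z by simp
      also have "(\<Sum>n<N. v n * z ^ n) = (\<Sum>n<N - k. u n * z ^ n)"
        by (intro sum.mono_neutral_cong_right) (auto simp: v_def)
      also have "2 * B\<^sup>2 * real N * cmod (\<Sum>n<N - k. u n * z ^ n) \<le> 2 * B\<^sup>2 * real N * ((\<delta> + \<epsilon>) * real (2 * N))"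
      proof (intro mult_left_mono)
        have "cmod (\<Sum>n<N - k. u n * z ^ n) \<le> (\<delta> + \<epsilon>) * real (N - k)" using elim z(1) by auto
        also have "\<dots> \<le> (\<delta> + \<epsilon>) * real (2 * N)" using d e by (intro mult_left_mono) auto
        finally show "cmod (\<Sum>n<N - k. u n * z ^ n) \<le> (\<delta> + \<epsilon>) * real (2 * N)" .
      qed simp
      also have "\<dots> = 4 * B\<^sup>2 * (\<delta> + \<epsilon>) * (real N)\<^sup>2" by (simp add: power2_eq_square)
      finally show "cmod (\<Sum>n<N - k. \<Sum>m<N. u n * a m * b (n + m)) \<le> 4 * B\<^sup>2 * (\<delta> + \<epsilon>) * (real N)\<^sup>2" .
    qed
  qed
qed

lemma square_average_tendsto_zero:
  fixes a b c :: "nat \<Rightarrow> complex"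
  assumes B: "\<And>n. cmod (a n) \<le> B" "\<And>n. cmod (b n) \<le> B" "\<And>n. cmod (c n) \<le> B"
    and u: "uniform_exp_bound a 0 \<or> uniform_exp_bound b 0 \<or> uniform_exp_bound c 0"
  shows "(\<lambda>N. 1 / of_nat N ^ 2 * (\<Sum>n<N. \<Sum>m<N. a n * b m * c (n + m))) \<longlonglongrightarrow> 0"
proof (rule LIMSEQ_I)
  fix \<epsilon> :: real assume e: "\<epsilon> > 0"
  have B0: "0 \<le> B" using order.trans[OF norm_ge_zero B(1)] .
  \<comment> \<open>The summand 1 keeps the denominator positive when \<open>B = 0\<close>.\<close>
  define \<eta> where "\<eta> = \<epsilon> / (8 * (B\<^sup>2 + 1))"
  have \<eta>: "\<eta> > 0" unfolding \<eta>_def using e by (intro divide_pos_pos) (auto intro: add_nonneg_pos)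
  have "\<forall>\<^sub>F N in sequentially. cmod (\<Sum>n<N. \<Sum>m<N. a n * b m * c (n + m)) \<le> 4 * B\<^sup>2 * (0 + \<eta>) * (real N)\<^sup>2"
    using u
  proof (elim disjE)
    assume "uniform_exp_bound a 0"
    from trilinear_eventually_left[OF this \<eta> B0 order.refl, of 0] show ?thesis
      by eventually_elim (use B in auto)
  next
    assume "uniform_exp_bound b 0"
    from trilinear_eventually_left[OF this \<eta> B0 order.refl, of 0] show ?thesis
    proof eventually_elim
      case (elim N)
      have "(\<Sum>n<N. \<Sum>m<N. a n * b m * c (n + m)) = (\<Sum>n<N. \<Sum>m<N. b n * a m * c (n + m))"
        by (subst sum.swap) (simp add: mult.commute[of "a _" "b _"] add.commute)
      then show ?case using elim B by auto
    qed
  next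
    assume "uniform_exp_bound c 0"
    from trilinear_eventually_right[OF this \<eta> B0] show ?thesis
      by eventually_elim (use B in auto)
  qed
  then have "\<forall>\<^sub>F N in sequentially. norm (1 / of_nat N ^ 2 * (\<Sum>n<N. \<Sum>m<N. a n * b m * c (n + m)) - 0) < \<epsilon>"
    using eventually_gt_at_top[of 0]
  proof eventually_elim
    case (elim N)
    have "cmod (\<Sum>n<N. \<Sum>m<N. a n * b m * c (n + m)) / (real N)\<^sup>2 \<le> 4 * B\<^sup>2 * \<eta>"
      using elim by (simp add: divide_le_eq)
    also have "\<dots> \<le> 4 * (B\<^sup>2 + 1) * \<eta>" using \<eta> by (intro mult_right_mono) auto
    also have "\<dots> < 8 * (B\<^sup>2 + 1) * \<eta>" using \<eta> by (intro mult_strict_right_mono) (auto intro: add_nonneg_pos)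
    also have "\<dots> = \<epsilon>"
    proof -
      have "8 * (B\<^sup>2 + 1) \<noteq> 0" by (simp add: add_nonneg_eq_0_iff)
      then show ?thesis unfolding \<eta>_def times_divide_eq_right by (rule nonzero_mult_div_cancel_left)
    qed
    finally show ?case by (simp add: norm_mult norm_divide norm_power)
  qed
  then show "\<exists>no. \<forall>n\<ge>no. norm (1 / of_nat n ^ 2 * (\<Sum>n'<n. \<Sum>m<n. a n' * b m * c (n' + m)) - 0) < \<epsilon>"
    unfolding eventually_sequentially .
qed

text \<open>The power \<open>K ^ 3\<close> is the trivial order: \<open>K\<close> values of
  \<open>p\<close> times the square of \<open>K\<close> terms. The frequency may vary with
  \<open>p\<close> and \<open>K\<close>, because it will come from the trilinear bound for each
  fixed \<open>p\<close>.\<close>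

definition mean_square_exp_small :: "(nat \<Rightarrow> nat \<Rightarrow> complex) \<Rightarrow> bool" where
  "mean_square_exp_small y \<longleftrightarrow> (\<forall>\<epsilon>>0. \<forall>\<^sub>F K in sequentially. \<forall>z. (\<forall>p. cmod (z p) = 1) \<longrightarrow>
     (\<Sum>p<K. (cmod (\<Sum>k<K. y p k * z p ^ k))\<^sup>2) \<le> \<epsilon> * (real K) ^ 3)"

text \<open>Linearizes the modulus: a sum over \<open>p\<close> of moduli becomes a sum to which the
  trilinear bounds apply, with the phases \<open>cnj (sgn x)\<close> as one of the three
  sequences.\<close>

lemma norm_eq_mult_cnj_sgn: "complex_of_real (cmod x) = cnj (sgn x) * x"
proof (cases "x = 0")
  case False
  have "cnj (sgn x) * x = (x * cnj x) / of_real (cmod x)"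
    by (simp add: sgn_div_norm scaleR_conv_of_real divide_inverse mult_ac)
  also have "\<dots> = of_real (cmod x)"
    unfolding complex_norm_square[symmetric] using False by (simp add: power2_eq_square)
  finally show ?thesis ..
qed simp

lemma mean_square_exp_small_if_correlations:
  fixes \<delta> :: "nat \<Rightarrow> real"
  assumes \<delta>: "\<And>d. \<delta> d \<ge> 0" "(\<lambda>H. (\<Sum>d<H. \<delta> d) / real H) \<longlonglongrightarrow> 0"
    and corr: "\<And>d \<epsilon>. \<epsilon> > 0 \<Longrightarrow> \<forall>\<^sub>F K in sequentially.
      (\<Sum>p<K. cmod (\<Sum>k<K - d. y p k * cnj (y p (k + d)))) \<le> C * (\<delta> d + \<epsilon>) * (real K)\<^sup>2"
    and C: "C > 0"
  shows "mean_square_exp_small y"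
  unfolding mean_square_exp_small_def
proof (intro allI impI)
  fix \<epsilon> :: real assume e: "\<epsilon> > 0"
  \<comment> \<open>The factor 8 is 2 from van der Corput's inequality, 2 from
    \<open>K + H \<le> 2 * K\<close> and 2 from \<open>\<eta> + \<eta>\<close>.\<close>
  define \<eta> where "\<eta> = \<epsilon> / (8 * C)"
  have \<eta>: "\<eta> > 0" "8 * C * \<eta> = \<epsilon>" using e C by (simp_all add: \<eta>_def)
  have "\<forall>\<^sub>F H in sequentially. (\<Sum>d<H. \<delta> d) / real H < \<eta> \<and> H > 0"
    using order_tendstoD(2)[OF \<delta>(2) \<eta>(1)] eventually_gt_at_top by (rule eventually_conj)
  then obtain H where H: "(\<Sum>d<H. \<delta> d) / real H < \<eta>" "H > 0" by (auto dest: eventually_happens)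
  have "\<forall>\<^sub>F K in sequentially. \<forall>d\<in>{..<H}.
      (\<Sum>p<K. cmod (\<Sum>k<K - d. y p k * cnj (y p (k + d)))) \<le> C * (\<delta> d + \<eta>) * (real K)\<^sup>2"
    using corr[OF \<eta>(1)] by (intro eventually_ball_finite) auto
  then show "\<forall>\<^sub>F K in sequentially. \<forall>z. (\<forall>p. cmod (z p) = 1) \<longrightarrow>
     (\<Sum>p<K. (cmod (\<Sum>k<K. y p k * z p ^ k))\<^sup>2) \<le> \<epsilon> * (real K) ^ 3"
    using eventually_ge_at_top[of H]
  proof eventually_elim
    case (elim K)
    show ?case
    proof (intro allI impI)
      fix z :: "nat \<Rightarrow> complex" assume z: "\<forall>p. cmod (z p) = 1"
      have "(\<Sum>p<K. (cmod (\<Sum>k<K. y p k * z p ^ k))\<^sup>2) \<le>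
        (\<Sum>p<K. 2 * real (K + H) / real H * (\<Sum>d<H. cmod (\<Sum>k<K - d. y p k * cnj (y p (k + d)))))"
        using z H(2) by (intro sum_mono van_der_corput) auto
      also have "\<dots> = 2 * real (K + H) / real H * (\<Sum>d<H. \<Sum>p<K. cmod (\<Sum>k<K - d. y p k * cnj (y p (k + d))))"
        unfolding sum_distrib_left[symmetric] by (subst sum.swap) (rule refl)
      also have "\<dots> \<le> 2 * real (K + H) / real H * (\<Sum>d<H. C * (\<delta> d + \<eta>) * (real K)\<^sup>2)"
        using elim by (intro mult_left_mono sum_mono) auto
      also have "\<dots> \<le> 2 * real (K + K) / real H * (\<Sum>d<H. C * (\<delta> d + \<eta>) * (real K)\<^sup>2)"
        using elim C \<delta> \<eta> by (intro mult_right_mono divide_right_mono sum_nonneg mult_nonneg_nonneg) auto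
      also have "\<dots> = 4 * C * (real K) ^ 3 * ((\<Sum>d<H. \<delta> d) / real H + \<eta>)"
        using H(2) by (simp add: sum_distrib_left[symmetric] sum_distrib_right[symmetric] sum.distrib field_simps
          power2_eq_square power3_eq_cube)
      also have "\<dots> \<le> 4 * C * (real K) ^ 3 * (\<eta> + \<eta>)"
        using H C by (intro mult_left_mono) auto
      also have "\<dots> = (8 * C * \<eta>) * (real K) ^ 3" by simp
      finally show "(\<Sum>p<K. (cmod (\<Sum>k<K. y p k * z p ^ k))\<^sup>2) \<le> \<epsilon> * (real K) ^ 3"
        unfolding \<eta>(2) .
    qed
  qed
qed

text \<open>At lag \<open>d\<close> the correlation of \<open>s k * u (k + p)\<close> splits into a
  factor depending on \<open>k\<close> alone and the sequence \<open>u n * cnj (u (n + d))\<close>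
  at \<open>n = k + p\<close>. Summed over \<open>p\<close> against phases, this is a trilinear sum
  with that sequence at the index \<open>p + k\<close>. In the second claim it stands at the index
  \<open>k\<close> instead, and the values of \<open>s\<close> move to \<open>k + p\<close>.\<close>

lemma mean_square_exp_small_shift:
  fixes u s :: "nat \<Rightarrow> complex"
  assumes B: "\<And>n. cmod (s n) \<le> B"
    and w: "\<And>d. uniform_exp_bound (\<lambda>n. u n * cnj (u (n + d))) (\<delta> d)"
    and \<delta>: "\<And>d. \<delta> d \<ge> 0" "(\<lambda>H. (\<Sum>d<H. \<delta> d) / real H) \<longlonglongrightarrow> 0"
  shows "mean_square_exp_small (\<lambda>p k. s k * u (k + p))" (is ?A)
    and "mean_square_exp_small (\<lambda>p k. u k * s (k + p))" (is ?B)
proof -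
  \<comment> \<open>A common bound for products of two values of \<open>s\<close> and for the
    phases, of modulus at most 1.\<close>
  define D where "D = B\<^sup>2 + 1"
  have B0: "0 \<le> B" using order.trans[OF norm_ge_zero B] .
  have D: "D > 0" "1 \<le> D" by (simp_all add: D_def add_nonneg_pos)
  have sD: "cmod (s n * cnj (s m)) \<le> D" for n m
  proof -
    have "cmod (s n * cnj (s m)) \<le> B * B" using B B0 by (auto simp: norm_mult intro: mult_mono)
    then show ?thesis by (simp add: D_def power2_eq_square)
  qed
  have sgnD: "cmod (cnj (sgn x)) \<le> D" for x using D by (simp add: norm_sgn)
  show ?A
  proof (rule mean_square_exp_small_if_correlations[OF \<delta>, of _ "4 * D\<^sup>2"])
    fix d and \<epsilon> :: real assume e: "\<epsilon> > 0"
    have "\<forall>\<^sub>F K in sequentially. \<forall>a b. (\<forall>n. cmod (a n) \<le> D) \<longrightarrow> (\<forall>n. cmod (b n) \<le> D) \<longrightarrow>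
       cmod (\<Sum>n<K. \<Sum>m<K. a n * b m * (u (n + m) * cnj (u (n + m + d)))) \<le> 4 * D\<^sup>2 * (\<delta> d + \<epsilon>) * (real K)\<^sup>2"
      using D by (intro trilinear_eventually_right[OF w e]) auto
    then show "\<forall>\<^sub>F K in sequentially. (\<Sum>p<K. cmod (\<Sum>k<K - d. s k * u (k + p) * cnj (s (k + d) * u (k + d + p))))
        \<le> 4 * D\<^sup>2 * (\<delta> d + \<epsilon>) * (real K)\<^sup>2"
    proof eventually_elim
      case (elim K)
      define X where "X p = (\<Sum>k<K - d. s k * u (k + p) * cnj (s (k + d) * u (k + d + p)))" for p
      \<comment> \<open>Cutting off at \<open>K - d\<close> extends the sum over \<open>k\<close> to
        the full square.\<close>
      define b where "b k = (if k < K - d then s k * cnj (s (k + d)) else 0)" for k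
      have X: "X p = (\<Sum>k<K. b k * (u (p + k) * cnj (u (p + k + d))))" for p
        unfolding X_def by (intro sum.mono_neutral_cong_left) (auto simp: b_def mult_ac add_ac)
      have "complex_of_real (\<Sum>p<K. cmod (X p)) = (\<Sum>p<K. cnj (sgn (X p)) * X p)"
        unfolding of_real_sum norm_eq_mult_cnj_sgn ..
      also have "\<dots> = (\<Sum>p<K. \<Sum>k<K. cnj (sgn (X p)) * b k * (u (p + k) * cnj (u (p + k + d))))"
        by (subst (2) X) (simp add: sum_distrib_left mult.assoc)
      finally have "cmod (complex_of_real (\<Sum>p<K. cmod (X p))) = cmod \<dots>" by (rule arg_cong)
      also have "\<dots> \<le> 4 * D\<^sup>2 * (\<delta> d + \<epsilon>) * (real K)\<^sup>2"
        using sD sgnD D by (intro elim[rule_format]) (auto simp: b_def)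
      finally show ?case unfolding X_def[symmetric] norm_of_real by linarith
    qed
  qed (use D in auto)
  show ?B
  proof (rule mean_square_exp_small_if_correlations[OF \<delta>, of _ "4 * D\<^sup>2"])
    fix d and \<epsilon> :: real assume e: "\<epsilon> > 0"
    have "\<forall>\<^sub>F K in sequentially. \<forall>a b. (\<forall>n. cmod (a n) \<le> D) \<longrightarrow> (\<forall>n. cmod (b n) \<le> D) \<longrightarrow>
       cmod (\<Sum>n<K - d. \<Sum>m<K. (u n * cnj (u (n + d))) * a m * b (n + m)) \<le> 4 * D\<^sup>2 * (\<delta> d + \<epsilon>) * (real K)\<^sup>2"
      using D by (intro trilinear_eventually_left[OF w e _ \<delta>(1)]) auto
    then show "\<forall>\<^sub>F K in sequentially. (\<Sum>p<K. cmod (\<Sum>k<K - d. u k * s (k + p) * cnj (u (k + d) * s (k + d + p))))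
        \<le> 4 * D\<^sup>2 * (\<delta> d + \<epsilon>) * (real K)\<^sup>2"
    proof eventually_elim
      case (elim K)
      define X where "X p = (\<Sum>k<K - d. u k * s (k + p) * cnj (u (k + d) * s (k + d + p)))" for p
      define b where "b k = s k * cnj (s (k + d))" for k
      have X: "X p = (\<Sum>k<K - d. u k * cnj (u (k + d)) * b (k + p))" for p
        unfolding X_def by (intro sum.cong refl) (auto simp: b_def mult_ac add_ac)
      have "complex_of_real (\<Sum>p<K. cmod (X p)) = (\<Sum>p<K. cnj (sgn (X p)) * X p)"
        unfolding of_real_sum norm_eq_mult_cnj_sgn ..
      also have "\<dots> = (\<Sum>p<K. \<Sum>k<K - d. (u k * cnj (u (k + d))) * cnj (sgn (X p)) * b (k + p))"
        by (subst (2) X) (simp add: sum_distrib_left mult_ac)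
      also have "\<dots> = (\<Sum>k<K - d. \<Sum>p<K. (u k * cnj (u (k + d))) * cnj (sgn (X p)) * b (k + p))"
        by (rule sum.swap)
      finally have "cmod (complex_of_real (\<Sum>p<K. cmod (X p))) = cmod \<dots>" by (rule arg_cong)
      also have "\<dots> \<le> 4 * D\<^sup>2 * (\<delta> d + \<epsilon>) * (real K)\<^sup>2"
        using sD sgnD by (intro elim[rule_format]) (auto simp: b_def)
      finally show ?case unfolding X_def[symmetric] norm_of_real by linarith
    qed
  qed (use D in auto)
qed

text \<open>Cauchy-Schwarz over \<open>p\<close> turns the mean-square bound into one for the mean
  of the moduli. \<open>\<kappa> N\<close> is the length of the exponential sum: \<open>N\<close>,
  or \<open>2 * N\<close> if the small sequence stands at \<open>m + n\<close>.\<close>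

lemma cube_average_tendsto_zero_aux:
  fixes y :: "nat \<Rightarrow> nat \<Rightarrow> complex" and J :: "nat \<Rightarrow> nat \<Rightarrow> complex" and \<kappa> :: "nat \<Rightarrow> nat"
  assumes y: "mean_square_exp_small y"
    and \<kappa>: "\<And>N. N \<le> \<kappa> N" "\<And>N. \<kappa> N \<le> 2 * N"
    and J: "\<And>N p. \<exists>z. cmod z = 1 \<and> cmod (J N p) \<le> C * real N * cmod (\<Sum>k<\<kappa> N. y p k * z ^ k)"
    and C: "C \<ge> 0" and c: "\<And>p. cmod (c p) \<le> C"
  shows "(\<lambda>N. 1 / of_nat N ^ 3 * (\<Sum>p<N. c p * J N p)) \<longlonglongrightarrow> 0"
proof (rule LIMSEQ_I)
  fix \<epsilon> :: real assume e: "\<epsilon> > 0"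
  define \<eta> where "\<eta> = \<epsilon> / (8 * (C\<^sup>2 + 1))"
  have \<eta>: "\<eta> > 0" unfolding \<eta>_def using e by (intro divide_pos_pos) (auto intro: add_nonneg_pos)
  have "filterlim \<kappa> at_top sequentially"
    by (rule filterlim_at_top_mono[OF filterlim_ident]) (use \<kappa>(1) in auto)
  from eventually_compose_filterlim[OF y[unfolded mean_square_exp_small_def, rule_format, of "\<eta>\<^sup>2"] this]
  have "\<forall>\<^sub>F N in sequentially. \<forall>z. (\<forall>p. cmod (z p) = 1) \<longrightarrow>
     (\<Sum>p<\<kappa> N. (cmod (\<Sum>k<\<kappa> N. y p k * z p ^ k))\<^sup>2) \<le> \<eta>\<^sup>2 * (real (\<kappa> N)) ^ 3"
    using \<eta> by simp
  then have "\<forall>\<^sub>F N in sequentially. norm (1 / of_nat N ^ 3 * (\<Sum>p<N. c p * J N p) - 0) < \<epsilon>"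
    using eventually_gt_at_top[of 0]
  proof eventually_elim
    case (elim N)
    define K where "K = \<kappa> N"
    have K: "N \<le> K" "real K \<le> 2 * real N" using \<kappa>[of N] by (auto simp: K_def)
    obtain z where z: "\<And>p. cmod (z p) = 1" "\<And>p. cmod (J N p) \<le> C * real N * cmod (\<Sum>k<K. y p k * z p ^ k)"
      using J[of N] unfolding K_def by metis
    define Y where "Y p = cmod (\<Sum>k<K. y p k * z p ^ k)" for p
    have "(\<Sum>p<K. 1 * Y p) \<le> sqrt (\<Sum>p<K. 1\<^sup>2) * sqrt (\<Sum>p<K. (Y p)\<^sup>2)" by (rule sum_mult_le_sqrt)
    also have "\<dots> \<le> sqrt (real K) * sqrt (\<eta>\<^sup>2 * (real K) ^ 3)"
      using elim(1)[folded K_def, rule_format, of z] z by (intro mult_mono) (auto simp: Y_def sum_nonneg)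
    also have "\<dots> = \<eta> * (real K)\<^sup>2"
    proof -
      have "sqrt (real K) * sqrt (\<eta>\<^sup>2 * (real K) ^ 3) = sqrt ((\<eta> * (real K)\<^sup>2)\<^sup>2)"
        unfolding real_sqrt_mult[symmetric] by (simp add: power2_eq_square power3_eq_cube mult_ac)
      then show ?thesis using \<eta> by simp
    qed
    also have "\<dots> \<le> \<eta> * (2 * real N)\<^sup>2" using \<eta> K by (intro mult_left_mono power_mono) auto
    finally have Y: "(\<Sum>p<K. Y p) \<le> 4 * \<eta> * (real N)\<^sup>2" by (simp add: power_mult_distrib)
    have "cmod (\<Sum>p<N. c p * J N p) \<le> (\<Sum>p<N. C * (C * real N * Y p))"
      using z c C unfolding Y_def
      by (intro order.trans[OF norm_sum] sum_mono) (auto simp: norm_mult intro!: mult_mono)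
    also have "\<dots> = C\<^sup>2 * real N * (\<Sum>p<N. Y p)" by (simp add: sum_distrib_left power2_eq_square mult_ac)
    \<comment> \<open>\<open>mean_square_exp_small\<close> uses the same length for \<open>p\<close>
      and for \<open>k\<close>, so the range of \<open>p\<close> is enlarged from \<open>N\<close>
      to \<open>K\<close>.\<close>
    also have "\<dots> \<le> C\<^sup>2 * real N * (\<Sum>p<K. Y p)"
      using K by (intro mult_left_mono sum_mono2) (auto simp: Y_def)
    also have "\<dots> \<le> C\<^sup>2 * real N * (4 * \<eta> * (real N)\<^sup>2)" by (intro mult_left_mono Y) auto
    also have "\<dots> = 4 * C\<^sup>2 * \<eta> * (real N) ^ 3" by (simp add: power2_eq_square power3_eq_cube)
    finally have "cmod (\<Sum>p<N. c p * J N p) / (real N) ^ 3 \<le> 4 * C\<^sup>2 * \<eta>"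
      using elim(2) by (simp add: divide_le_eq)
    also have "\<dots> \<le> 4 * (C\<^sup>2 + 1) * \<eta>" using \<eta> by (intro mult_right_mono) auto
    also have "\<dots> < 8 * (C\<^sup>2 + 1) * \<eta>" using \<eta> by (intro mult_strict_right_mono) (auto intro: add_nonneg_pos)
    also have "\<dots> = \<epsilon>"
    proof -
      have "8 * (C\<^sup>2 + 1) \<noteq> 0" by (simp add: add_nonneg_eq_0_iff)
      then show ?thesis unfolding \<eta>_def times_divide_eq_right by (rule nonzero_mult_div_cancel_left)
    qed
    finally show ?case by (simp add: norm_mult norm_divide norm_power)
  qed
  then show "\<exists>no. \<forall>n\<ge>no. norm (1 / of_nat n ^ 3 * (\<Sum>p<n. c p * J n p) - 0) < \<epsilon>"
    unfolding eventually_sequentially .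
qed

lemma cube_average_tendsto_zero_fibre:
  fixes ya yb yc :: "nat \<Rightarrow> nat \<Rightarrow> complex"
  assumes B: "\<And>p k. cmod (ya p k) \<le> B" "\<And>p k. cmod (yb p k) \<le> B" "\<And>p k. cmod (yc p k) \<le> B"
    and c: "\<And>p. cmod (c p) \<le> B"
    and y: "mean_square_exp_small ya \<or> mean_square_exp_small yb \<or> mean_square_exp_small yc"
  shows "(\<lambda>N. 1 / of_nat N ^ 3 * (\<Sum>p<N. c p * (\<Sum>m<N. \<Sum>n<N. ya p m * yb p n * yc p (m + n)))) \<longlonglongrightarrow> 0"
proof -
  have B0: "0 \<le> B" using order.trans[OF norm_ge_zero c] .
  \<comment> \<open>Serves both as the constant of the trilinear bounds and as a bound for
    \<open>c\<close>.\<close>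
  define C where "C = 2 * B\<^sup>2 + B"
  have C: "C \<ge> 0" "B \<le> C" using B0 by (simp_all add: C_def)
  have le: "x \<le> 2 * B\<^sup>2 * real N * cmod v \<Longrightarrow> x \<le> C * real N * cmod v" for x N v
    using B0 by (elim order.trans) (intro mult_right_mono; simp add: C_def)
  have cC: "cmod (c p) \<le> C" for p using c C order.trans by blast
  show ?thesis using y
  proof (elim disjE)
    assume y: "mean_square_exp_small ya"
    show ?thesis
    proof (rule cube_average_tendsto_zero_aux[OF y, where \<kappa>="\<lambda>N. N" and C=C])
      show "\<exists>z. cmod z = 1 \<and> cmod (\<Sum>m<N. \<Sum>n<N. ya p m * yb p n * yc p (m + n)) \<le>
         C * real N * cmod (\<Sum>k<N. ya p k * z ^ k)" for N p
        using trilinear_bound_left[of B N "yb p" "yc p" "ya p"] B B0 le by meson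
    qed (use C cC in auto)
  next
    assume y: "mean_square_exp_small yb"
    show ?thesis
    proof (rule cube_average_tendsto_zero_aux[OF y, where \<kappa>="\<lambda>N. N" and C=C])
      show "\<exists>z. cmod z = 1 \<and> cmod (\<Sum>m<N. \<Sum>n<N. ya p m * yb p n * yc p (m + n)) \<le>
         C * real N * cmod (\<Sum>k<N. yb p k * z ^ k)" for N p
        using trilinear_bound_middle[of B N "ya p" "yc p" "yb p"] B B0 le by meson
    qed (use C cC in auto)
  next
    assume y: "mean_square_exp_small yc"
    show ?thesis
    proof (rule cube_average_tendsto_zero_aux[OF y, where \<kappa>="\<lambda>N. 2 * N" and C=C])
      show "\<exists>z. cmod z = 1 \<and> cmod (\<Sum>m<N. \<Sum>n<N. ya p m * yb p n * yc p (m + n)) \<le>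
         C * real N * cmod (\<Sum>k<2*N. yc p k * z ^ k)" for N p
        using trilinear_bound_right[of B N "ya p" "yb p" "yc p"] B B0 le by meson
    qed (use C cC in auto)
  qed
qed

section \<open>Averages along orbits\<close>

context ergodic_system
begin

text \<open>Birkhoff's theorem is used for the countably many functions \<open>mderiv f h\<close>;
  off the resulting null set the bound holds for all frequencies simultaneously, as in the uniform
  Wiener-Wintner theorem.\<close>

lemma orbit_uniform_exp_bound:
  assumes f: "bounded_measurable M f"
    and R: "(\<lambda>H. (\<Sum>h<H. (cmod (corr f 0 h))\<^sup>2) / real H) \<longlonglongrightarrow> R"
  shows "AE x in M. uniform_exp_bound (\<lambda>n. f ((T ^^ n) x)) (sqrt (2 * sqrt R))"
proof -
  obtain B where B: "B \<ge> 0" "\<And>x. x \<in> space M \<Longrightarrow> cmod (f x) \<le> B" using f by (metis bounded_measurableE)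
  have "AE x in M. (\<lambda>n. (\<Sum>i<n. mderiv f h ((T ^^ i) x)) / of_nat n) \<longlonglongrightarrow> (\<integral>x. mderiv f h x \<partial>M)" for h
  proof -
    obtain C where "C \<ge> 0" "\<And>x. x \<in> space M \<Longrightarrow> cmod (mderiv f h x) \<le> C"
      using bounded_measurableE[OF bounded_measurable_mderiv[OF f]] by metis
    then show ?thesis
      by (intro birkhoff[where B=C] bounded_measurable_borel bounded_measurable_mderiv f)
  qed
  then have "AE x in M. \<forall>h. (\<lambda>n. (\<Sum>i<n. mderiv f h ((T ^^ i) x)) / of_nat n) \<longlonglongrightarrow> (\<integral>x. mderiv f h x \<partial>M)"
    unfolding AE_all_countable by blast
  with AE_space show ?thesis
  proof eventually_elim
    case (elim x)
    show ?case
    proof (rule uniform_exp_bound_of_correlations[OF _ _ R])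
      show "cmod (f ((T ^^ n) x)) \<le> B" for n using B(2) funpow_in_space elim(1) by blast
      show "(\<lambda>N. (\<Sum>n<N. f ((T ^^ n) x) * cnj (f ((T ^^ (n + h)) x))) / of_nat N) \<longlonglongrightarrow> corr f 0 h" for h
        using elim(2)[rule_format, of h]
        by (simp add: mderiv_def[abs_def] corr_def funpow_add add.commute[of _ h])
    qed
  qed
qed

lemma orbit_uniform_exp_bound_zero:
  assumes f: "bounded_measurable M f" and orth: "f \<in> orthocomplement M (kronecker_factor M T)"
  shows "AE x in M. uniform_exp_bound (\<lambda>n. f ((T ^^ n) x)) 0"
proof -
  have "(\<integral>x. f x * cnj (g x) \<partial>M) = 0" if g: "g \<in> eigenfunctions M T" for g
  proof -
    have "g \<in> kronecker_factor M T"
      unfolding kronecker_factor_def closed_linear_span_def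
    proof (intro CollectI conjI allI impI)
      show "g \<in> L2 M" using g by (simp add: eigenfunctions_def)
      show "\<exists>(k::nat) (c :: nat \<Rightarrow> complex) e. (\<forall>i<k. e i \<in> eigenfunctions M T) \<and> L2_norm M (\<lambda>x. g x - (\<Sum>i<k. c i * e i x)) < \<epsilon>"
        if "0 < \<epsilon>" for \<epsilon>
        using that g
        by (intro exI[where x="1::nat"] exI[where x="\<lambda>_::nat. 1::complex"] exI[where x="\<lambda>_::nat. g"])
           (simp add: L2_norm_def)
    qed
    then show ?thesis using orth by (simp add: orthocomplement_def)
  qed
  from orbit_uniform_exp_bound[OF f corr_norm_mean_tendsto_zero[OF f this]] show ?thesis by simp
qed

text \<open>With \<open>R\<close> the fourth power of the seminorm, \<open>sqrt (2 * sqrt R)\<close>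
  becomes linear in the seminorm.\<close>

lemma orbit_mderiv_uniform_exp_bound:
  assumes f: "bounded_measurable M f"
  shows "AE x in M. \<forall>d. uniform_exp_bound (\<lambda>n. f ((T ^^ n) x) * cnj (f ((T ^^ (n + d)) x)))
    (sqrt 2 * seminorm2 M T (mderiv f d))"
  unfolding AE_all_countable
proof
  fix d
  define s where "s = seminorm2 M T (mderiv f d)"
  have s: "0 \<le> s" unfolding s_def by (rule seminorm2_limit(2)[OF bounded_measurable_mderiv[OF f]])
  have "sqrt (s ^ 4) = s\<^sup>2"
    by (rule real_sqrt_unique) (simp_all add: power_even_eq[of _ 2, simplified] flip: power_mult)
  then have "sqrt (2 * sqrt (s ^ 4)) = sqrt 2 * s" using s by (simp add: real_sqrt_mult)
  with orbit_uniform_exp_bound[OF bounded_measurable_mderiv[OF f] seminorm2_limit(1)[OF bounded_measurable_mderiv[OF f]], of d]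
  show "AE x in M. uniform_exp_bound (\<lambda>n. f ((T ^^ n) x) * cnj (f ((T ^^ (n + d)) x)))
    (sqrt 2 * seminorm2 M T (mderiv f d))"
    by (simp add: s_def mderiv_def funpow_add add.commute[of _ d])
qed

end

text \<open>The third seminorm controls the fourth powers of the seminorms of the derivatives,
  whereas the exponential sums are bounded by their first powers.\<close>

lemma cesaro_zero_of_pow4:
  fixes s :: "nat \<Rightarrow> real"
  assumes s: "\<And>n. s n \<ge> 0" and lim: "(\<lambda>H. (\<Sum>h<H. s h ^ 4) / real H) \<longlonglongrightarrow> 0"
  shows "(\<lambda>H. (\<Sum>h<H. s h) / real H) \<longlonglongrightarrow> 0"
proof (rule LIMSEQ_I)
  fix \<epsilon> :: real assume e: "\<epsilon> > 0"
  define \<eta> where "\<eta> = \<epsilon> / 2"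
  have \<eta>: "\<eta> > 0" using e by (simp add: \<eta>_def)
  \<comment> \<open>In place of Hoelder's inequality: a value above \<open>\<eta>\<close> is at most
    its fourth power divided by the cube of \<open>\<eta>\<close>.\<close>
  have le: "s h \<le> \<eta> + s h ^ 4 / \<eta> ^ 3" for h
  proof (cases "s h \<le> \<eta>")
    case True
    have "0 \<le> s h ^ 4 / \<eta> ^ 3" using \<eta> s by simp
    with True show ?thesis by linarith
  next
    case False
    then have "\<eta> ^ 3 * s h \<le> s h ^ 3 * s h" using \<eta> s by (intro mult_right_mono power_mono) auto
    also have "\<dots> = s h ^ 4" by (simp add: power_numeral_reduce)
    finally have "s h \<le> s h ^ 4 / \<eta> ^ 3" using \<eta> by (simp add: le_divide_eq mult.commute)
    then show ?thesis using \<eta> by linarith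
  qed
  obtain n0 where n0: "\<And>H. H \<ge> n0 \<Longrightarrow> \<bar>(\<Sum>h<H. s h ^ 4) / real H\<bar> < \<eta> ^ 4"
    using LIMSEQ_D[OF lim, of "\<eta> ^ 4"] \<eta> by auto
  show "\<exists>no. \<forall>n\<ge>no. norm ((\<Sum>h<n. s h) / real n - 0) < \<epsilon>"
  proof (intro exI[of _ "Suc n0"] allI impI)
    fix H assume H: "Suc n0 \<le> H"
    have "(\<Sum>h<H. s h) \<le> (\<Sum>h<H. \<eta> + s h ^ 4 / \<eta> ^ 3)" by (intro sum_mono le)
    also have "\<dots> = real H * \<eta> + (\<Sum>h<H. s h ^ 4) / \<eta> ^ 3" by (simp add: sum.distrib sum_divide_distrib)
    finally have "(\<Sum>h<H. s h) / real H \<le> (real H * \<eta> + (\<Sum>h<H. s h ^ 4) / \<eta> ^ 3) / real H"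
      by (intro divide_right_mono) auto
    also have "\<dots> = \<eta> + ((\<Sum>h<H. s h ^ 4) / real H) / \<eta> ^ 3" using H by (simp add: add_divide_distrib)
    also have "((\<Sum>h<H. s h ^ 4) / real H) / \<eta> ^ 3 < \<eta> ^ 4 / \<eta> ^ 3"
    proof (rule divide_strict_right_mono)
      show "(\<Sum>h<H. s h ^ 4) / real H < \<eta> ^ 4"
        using n0[of H, OF Suc_leD[OF H]] by linarith
    qed (use \<eta> in simp)
    also have "\<eta> ^ 4 / \<eta> ^ 3 = \<eta>" using \<eta> by (simp add: power_numeral_reduce)
    finally have "(\<Sum>h<H. s h) / real H < \<epsilon>" by (simp add: \<eta>_def)
    moreover have "0 \<le> (\<Sum>h<H. s h) / real H" using s by (simp add: sum_nonneg)
    ultimately show "norm ((\<Sum>h<H. s h) / real H - 0) < \<epsilon>" by simp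
  qed
qed

text \<open>For fixed \<open>p\<close> the factors pair up as 1 with 5, 2 with 6 and 3 with 7, into
  functions of \<open>m\<close>, \<open>n\<close> and \<open>m + n\<close>; in each pair one
  sequence is a shift by \<open>p\<close>, as \<open>mean_square_exp_small_shift\<close>
  requires.\<close>

lemma cube_average_tendsto_zero:
  fixes a :: "nat \<Rightarrow> nat \<Rightarrow> complex" and \<delta> :: "nat \<Rightarrow> real"
  assumes B: "\<And>i n. i \<in> {1..7} \<Longrightarrow> cmod (a i n) \<le> B"
    and \<delta>: "\<And>d. \<delta> d \<ge> 0" "(\<lambda>H. (\<Sum>d<H. \<delta> d) / real H) \<longlonglongrightarrow> 0"
    and i: "i \<in> {1..7}" "i \<noteq> 4" 
    and w: "\<And>d. uniform_exp_bound (\<lambda>n. a i n * cnj (a i (n + d))) (\<delta> d)"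
  shows "(\<lambda>N. 1 / of_nat N ^ 3 * (\<Sum>m<N. \<Sum>n<N. \<Sum>p<N. a 1 m * a 2 n * a 3 (m + n) * a 4 p *
     a 5 (m + p) * a 6 (n + p) * a 7 (m + n + p))) \<longlonglongrightarrow> 0"
proof -
  define C where "C = B\<^sup>2 + B"
  have B0: "0 \<le> B" using order.trans[OF norm_ge_zero B[of 1]] by simp
  have C: "B \<le> C" "B * B \<le> C" using B0 by (simp_all add: C_def power2_eq_square)
  have small: "mean_square_exp_small (\<lambda>p k. a j k * a j' (k + p))"
    if "j \<in> {1..7}" "j' \<in> {1..7}" "i = j \<or> i = j'" for j j'
    using that(3)
  proof
    assume "i = j"
    then show ?thesis using that w \<delta> B
      by (intro mean_square_exp_small_shift(2)[where B=B and \<delta>=\<delta>]) auto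
  next
    assume "i = j'"
    then show ?thesis using that w \<delta> B
      by (intro mean_square_exp_small_shift(1)[where B=B and \<delta>=\<delta>]) auto
  qed
  have bd: "cmod (a j k * a j' k') \<le> C" if "j \<in> {1..7}" "j' \<in> {1..7}" for j j' k k'
    using mult_mono[OF B[OF that(1)] B[OF that(2)]] B0 C(2) by (simp add: norm_mult) (meson order.trans)
  have "(\<lambda>N. 1 / of_nat N ^ 3 * (\<Sum>p<N. a 4 p * (\<Sum>m<N. \<Sum>n<N. (a 1 m * a 5 (m + p)) *
      (a 2 n * a 6 (n + p)) * (a 3 (m + n) * a 7 (m + n + p))))) \<longlonglongrightarrow> 0"
  proof (rule cube_average_tendsto_zero_fibre[where B=C and c="a 4" and ya="\<lambda>p m. a 1 m * a 5 (m + p)" and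
        yb="\<lambda>p n. a 2 n * a 6 (n + p)" and yc="\<lambda>p k. a 3 k * a 7 (k + p)"])
    show "cmod (a 4 p) \<le> C" for p using B[of 4 p] C(1) by simp
    have "i = 1 \<or> i = 5 \<or> i = 2 \<or> i = 6 \<or> i = 3 \<or> i = 7" using i by auto
    then show "mean_square_exp_small (\<lambda>p m. a 1 m * a 5 (m + p)) \<or> mean_square_exp_small (\<lambda>p n. a 2 n * a 6 (n + p)) \<or>
       mean_square_exp_small (\<lambda>p k. a 3 k * a 7 (k + p))"
      using small[of 1 5] small[of 2 6] small[of 3 7] by auto
  qed (auto intro!: bd)
  moreover have "(\<Sum>p<N. a 4 p * (\<Sum>m<N. \<Sum>n<N. (a 1 m * a 5 (m + p)) *
      (a 2 n * a 6 (n + p)) * (a 3 (m + n) * a 7 (m + n + p))))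
    = (\<Sum>m<N. \<Sum>n<N. \<Sum>p<N. a 1 m * a 2 n * a 3 (m + n) * a 4 p * a 5 (m + p) * a 6 (n + p) * a 7 (m + n + p))" for N
  proof -
    have "(\<Sum>m<N. \<Sum>n<N. \<Sum>p<N. a 1 m * a 2 n * a 3 (m + n) * a 4 p * a 5 (m + p) * a 6 (n + p) * a 7 (m + n + p))
      = (\<Sum>m<N. \<Sum>p<N. \<Sum>n<N. a 1 m * a 2 n * a 3 (m + n) * a 4 p * a 5 (m + p) * a 6 (n + p) * a 7 (m + n + p))"
      by (intro sum.cong refl sum.swap)
    also have "\<dots> = (\<Sum>p<N. \<Sum>m<N. \<Sum>n<N. a 1 m * a 2 n * a 3 (m + n) * a 4 p * a 5 (m + p) * a 6 (n + p) * a 7 (m + n + p))"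
      by (rule sum.swap)
    also have "\<dots> = (\<Sum>p<N. a 4 p * (\<Sum>m<N. \<Sum>n<N. (a 1 m * a 5 (m + p)) *
      (a 2 n * a 6 (n + p)) * (a 3 (m + n) * a 7 (m + n + p))))"
      unfolding sum_distrib_left by (intro sum.cong refl) (simp only: mult.assoc mult.commute mult.left_commute)
    finally show ?thesis ..
  qed
  ultimately show ?thesis by simp
qed

text \<open>For fixed \<open>p\<close> the factor with index \<open>4\<close> is a constant, so the bound by exponential sums does not
  see it. Swapping \<open>m\<close> and \<open>p\<close> moves it to index \<open>1\<close>.\<close>

lemma avg3_swap:
  defines "\<pi> \<equiv> \<lambda>i::nat. if i = 1 then 4 else if i = 4 then 1 else if i = 3 then 6 else if i = 6 then 3 else i"
  shows "avg3 T f x N = avg3 T (\<lambda>i. f (\<pi> i)) x N"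
proof -
  let ?t = "\<lambda>m n p. f 1 ((T ^^ m) x) * f 2 ((T ^^ n) x) * f 3 ((T ^^ (m + n)) x) * f 4 ((T ^^ p) x) *
     f 5 ((T ^^ (m + p)) x) * f 6 ((T ^^ (n + p)) x) * f 7 ((T ^^ (m + n + p)) x)"
  have "(\<Sum>m<N. \<Sum>n<N. \<Sum>p<N. ?t m n p) = (\<Sum>m<N. \<Sum>p<N. \<Sum>n<N. ?t m n p)"
    by (intro sum.cong refl sum.swap)
  also have "\<dots> = (\<Sum>p<N. \<Sum>m<N. \<Sum>n<N. ?t m n p)" by (rule sum.swap)
  also have "\<dots> = (\<Sum>p<N. \<Sum>n<N. \<Sum>m<N. ?t m n p)" by (intro sum.cong refl sum.swap)
  finally have "(\<Sum>m<N. \<Sum>n<N. \<Sum>p<N. ?t m n p) = (\<Sum>m<N. \<Sum>n<N. \<Sum>p<N. ?t p n m)" .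
  moreover have "?t p n m = f (\<pi> 1) ((T ^^ m) x) * f (\<pi> 2) ((T ^^ n) x) * f (\<pi> 3) ((T ^^ (m + n)) x) * f (\<pi> 4) ((T ^^ p) x) *
     f (\<pi> 5) ((T ^^ (m + p)) x) * f (\<pi> 6) ((T ^^ (n + p)) x) * f (\<pi> 7) ((T ^^ (m + n + p)) x)" for m n p
    by (simp add: \<pi>_def add.commute[of p] add.commute[of n m] add.assoc add.left_commute[of n m] mult_ac)
  ultimately show ?thesis by (simp add: avg3_def)
qed

context ergodic_system
begin

lemma common_bound:
  assumes "finite I" "\<And>i. i \<in> I \<Longrightarrow> bounded_measurable M (f i)"
  obtains B where "\<And>i x. i \<in> I \<Longrightarrow> x \<in> space M \<Longrightarrow> cmod (f i x) \<le> B"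
proof -
  have "\<forall>i\<in>I. \<exists>B. \<forall>x\<in>space M. cmod (f i x) \<le> B" using assms(2) bounded_measurableE by metis
  then obtain b where b: "\<And>i x. i \<in> I \<Longrightarrow> x \<in> space M \<Longrightarrow> cmod (f i x) \<le> b i" by metis
  show thesis
  proof (rule that)
    fix i x assume ix: "i \<in> I" "x \<in> space M"
    then have "b i \<le> Max (b ` I)" using assms(1) by auto
    then show "cmod (f i x) \<le> Max (b ` I)" using b[OF ix] by linarith
  qed
qed

lemma avg2_tendsto_zero:
  assumes f: "\<And>i. i \<in> {1..3} \<Longrightarrow> bounded_measurable M (f i)"
    and i: "i \<in> {1..3}" "f i \<in> orthocomplement M (kronecker_factor M T)"
  shows "AE x in M. avg2 T f x \<longlonglongrightarrow> 0"
proof -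
  obtain B where B: "\<And>i x. i \<in> {1..3} \<Longrightarrow> x \<in> space M \<Longrightarrow> cmod (f i x) \<le> B"
    using common_bound[of "{1..3}" f] f by auto
  from orbit_uniform_exp_bound_zero[OF f[OF i(1)] i(2)] AE_space show ?thesis
  proof eventually_elim
    case (elim x)
    have "i = 1 \<or> i = 2 \<or> i = 3" using i(1) by auto
    then show ?case unfolding avg2_def
      using elim B funpow_in_space[OF elim(2)]
      by (intro square_average_tendsto_zero[where B=B]) auto
  qed
qed

lemma avg3_tendsto_zero_if_not_4:
  assumes f: "\<And>i. i \<in> {1..7} \<Longrightarrow> bounded_measurable M (f i)"
    and i: "i \<in> {1..7}" "i \<noteq> 4" "seminorm3 M T (f i) = 0"
  shows "AE x in M. avg3 T f x \<longlonglongrightarrow> 0"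
proof -
  obtain B where B: "\<And>i x. i \<in> {1..7} \<Longrightarrow> x \<in> space M \<Longrightarrow> cmod (f i x) \<le> B"
    using common_bound[of "{1..7}" f] f by auto
  define s where "s d = seminorm2 M T (mderiv (f i) d)" for d
  have s: "0 \<le> s d" for d
    unfolding s_def by (rule seminorm2_limit(2)[OF bounded_measurable_mderiv[OF f[OF i(1)]]])
  have "(\<lambda>H. (\<Sum>d<H. s d) / real H) \<longlonglongrightarrow> 0"
    using seminorm3_zero_limit[OF f[OF i(1)] i(3)]
    by (intro cesaro_zero_of_pow4[where s=s]) (simp_all add: s s_def[symmetric])
  from tendsto_mult_right_zero[OF this, of "sqrt 2"]
  have lim: "(\<lambda>H. (\<Sum>d<H. sqrt 2 * s d) / real H) \<longlonglongrightarrow> 0" by (simp add: sum_distrib_left)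
  from orbit_mderiv_uniform_exp_bound[OF f[OF i(1)]] AE_space show ?thesis
  proof eventually_elim
    case (elim x)
    show ?case unfolding avg3_def
    proof (rule cube_average_tendsto_zero[where a="\<lambda>i n. f i ((T ^^ n) x)" and B=B and \<delta>="\<lambda>d. sqrt 2 * s d", OF _ _ lim i(1,2)])
      show "uniform_exp_bound (\<lambda>n. f i ((T ^^ n) x) * cnj (f i ((T ^^ (n + d)) x))) (sqrt 2 * s d)" for d
        using elim(1) by (simp add: s_def)
    qed (use B funpow_in_space[OF elim(2)] s in auto)
  qed
qed

lemma avg3_tendsto_zero:
  assumes f: "\<And>i. i \<in> {1..7} \<Longrightarrow> bounded_measurable M (f i)"
    and i: "i \<in> {1..7}" "seminorm3 M T (f i) = 0"
  shows "AE x in M. avg3 T f x \<longlonglongrightarrow> 0"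
proof (cases "i = 4")
  case False
  then show ?thesis using assms by (intro avg3_tendsto_zero_if_not_4)
next
  case True
  define \<pi> where "\<pi> = (\<lambda>i::nat. if i = 1 then 4 else if i = 4 then 1 else if i = 3 then 6 else if i = 6 then 3 else i)"
  \<comment> \<open>After the permutation the function with vanishing seminorm stands at index
    1.\<close>
  have "AE x in M. avg3 T (\<lambda>i. f (\<pi> i)) x \<longlonglongrightarrow> 0"
    by (rule avg3_tendsto_zero_if_not_4[where i=1]) (use True i f in \<open>auto simp: \<pi>_def\<close>)
  moreover have "avg3 T f x = avg3 T (\<lambda>i. f (\<pi> i)) x" for x
    using avg3_swap[of T f x] by (auto simp: \<pi>_def fun_eq_iff)
  ultimately show ?thesis by simp
qed

end

theorem theorem2:
  fixes M :: "'a measure" and T :: "'a \<Rightarrow> 'a"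
  assumes "ergodic_system M T"
  shows
    "(\<forall>f :: nat \<Rightarrow> 'a \<Rightarrow> complex.
        (\<forall>i\<in>{1..3}. bounded_measurable M (f i)) \<longrightarrow>
        (\<exists>i\<in>{1..3}. f i \<in> orthocomplement M (kronecker_factor M T)) \<longrightarrow>
        (AE x in M. avg2 T f x \<longlonglongrightarrow> 0)) \<and>
     (\<forall>CL. is_CL_factor M T CL \<longrightarrow>
        (\<forall>f :: nat \<Rightarrow> 'a \<Rightarrow> complex.
          (\<forall>i\<in>{1..7}. bounded_measurable M (f i)) \<longrightarrow>
          (\<exists>i\<in>{1..7}. f i \<in> factor_perp M CL) \<longrightarrow>
          (AE x in M. avg3 T f x \<longlonglongrightarrow> 0)))"
proof -
  interpret ergodic_system M T by fact
  show ?thesis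
  proof (intro conjI allI impI)
    fix f :: "nat \<Rightarrow> 'a \<Rightarrow> complex"
    assume "\<forall>i\<in>{1..3}. bounded_measurable M (f i)"
      and "\<exists>i\<in>{1..3}. f i \<in> orthocomplement M (kronecker_factor M T)"
    then show "AE x in M. avg2 T f x \<longlonglongrightarrow> 0" using avg2_tendsto_zero by blast
  next
    fix CL and f :: "nat \<Rightarrow> 'a \<Rightarrow> complex"
    assume CL: "is_CL_factor M T CL" and f: "\<forall>i\<in>{1..7}. bounded_measurable M (f i)"
      and "\<exists>i\<in>{1..7}. f i \<in> factor_perp M CL"
    then obtain i where i: "i \<in> {1..7}" "f i \<in> factor_perp M CL" by blast
    moreover from i have "f i \<in> Linf M" by (simp add: factor_perp_def)
    ultimately have "seminorm3 M T (f i) = 0" using CL by (auto simp: is_CL_factor_def)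
    with i f show "AE x in M. avg3 T f x \<longlonglongrightarrow> 0" using avg3_tendsto_zero by blast
  qed
qed

end
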